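(* Let $\boldsymbol u=(\sigma,\mu,\omega)^{\intercal}$, with values in $\boldsymbol W=H_0\Lambda^{-}\times H_0\Lambda\times H_0\Lambda^{+}$, be the solution of the mixed formulation of the Hodge wave equation $$\langle\sigma_t,\tau\rangle-\langle d^{-}\tau,\mu\rangle=0\quad\forall\,\tau\in H_0\Lambda^{-},$$ $$\langle\mu_t,v\rangle+\langle d^{-}\sigma,v\rangle+\langle\omega,dv\rangle=\langle f,v\rangle\quad\forall\,v\in H_0\Lambda,$$ $$\langle\omega_t,\phi\rangle-\langle d\mu,\phi\rangle=0\quad\forall\,\phi\in H_0\Lambda^{+},$$ for $t\in(0,T]$, with initial conditions $\sigma(\cdot,0)=\delta u_0$, $\mu(\cdot,0)=u_1$, $\omega(\cdot,0)=du_0$. Define $$E(t)=\left(\|\sigma(\cdot,t)\|^2+\|\mu(\cdot,t)\|^2+\|\omega(\cdot,t)\|^2\right)^{1/2},$$ $$H(t)=\left(\|d^{-}\sigma(\cdot,t)\|^2+\|d\mu(\cdot,t)\|^2+\|\delta\mu(\cdot,t)\|^2+\|\delta^{+}\omega(\cdot,t)\|^2\right)^{1/2}.$$ If $f\in L^1((0,T),L^2\Lambda)$, then $$\sup_{0\le t\le T}E(t)\le E(0)+2\int_0^T\|f(\cdot,s)\|\,ds.$$ Furthermore, if $f\in W^{1,1}((0,T),L^2\Lambda)$, then $$\sup_{0\le t\le T}H(t)\le H(0)+4\|f\|_{L^\infty(L^2)}+2\int_0^T\|f_t(\cdot,s)\|\,ds.$$ When $f=0$, the inequalities become equalities and there is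 energy conservation: $E(t)=E(0)$ and $H(t)=H(0)$ for all $t>0$ (i.e. $t\in(0,T]$).
   Context: Let $n\ge2$, let $\Omega\subset\mathbb R^n$ be a bounded domain homeomorphic to a ball with piecewise smooth Lipschitz boundary, let $T>0$ be finite, and fix $0\le k\le n$. $L^2\Lambda^j$ is the space of $L^2$ differential $j$-forms on $\Omega$, with inner product $\langle\cdot,\cdot\rangle$ and norm $\|\cdot\|$. $d$ is the exterior derivative, $H\Lambda^j=\{\omega\in L^2\Lambda^j: d\omega\in L^2\Lambda^{j+1}\}$, $\mathrm{tr}$ is the trace on $\partial\Omega$, and $H_0\Lambda^j=\{\omega\in H\Lambda^j:\mathrm{tr}\,\omega=0\}$. $\delta:\Lambda^{j}\to\Lambda^{j-1}$ is the coderivative, $H^*\Lambda^j=\{\omega\in L^2\Lambda^j:\delta\omega\in L^2\Lambda^{j-1}\}$, and $\langle d\omega,\mu\rangle=\langle\omega,\delta\mu\rangle$ for all $\omega\in H_0\Lambda^{j}$, $\mu\in H^*\Lambda^{j+1}$. It is assumed that the harmonic space $\{\omega\in H_0\Lambda^j\cap H^*\Lambda^j: d\omega=0,\ \delta\omega=0\}$ is trivial for $1\le j\le n-1$. A superscript $-$, no superscript, and a superscript $+$ refer to form degrees $k-1$, $k$, $k+1$ respectively; e.g. $d^-$ maps $(k-1)$-forms to $k$-forms, $d$ maps $k$-forms to $(k+1)$-forms, $\delta$ maps $k$-forms to $(k-1)$-forms, $\delta^+$ maps $(k+1)$-forms to $k$-forms. For $k=0$ (resp. $k=n$) the spaces of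 $(k-1)$-forms (resp. $(k+1)$-forms) are $\{0\}$. Subscript $t$ denotes the time derivative. $u_0,u_1$ are given initial data, $f$ is a given time-dependent $k$-form, and $\|f\|_{L^\infty(L^2)}=\operatorname{ess\,sup}_{0\le t\le T}\|f(\cdot,t)\|$. The solution is understood to take values in $H_0\Lambda^-\times(H_0\Lambda\cap H^*\Lambda)\times(H_0\Lambda^+\cap H^*\Lambda^+)$, so that $H(t)$ is defined. *)

theory Defs
  imports "HOL-Analysis.Analysis" "HOL-Probability.Essential_Supremum"
begin

section \<open>Smooth functions and domains\<close>

primrec Ck_on :: "nat \<Rightarrow> 'a::euclidean_space set \<Rightarrow> ('a \<Rightarrow> 'b::real_normed_vector) \<Rightarrow> bool" where
  "Ck_on 0 S f \<longleftrightarrow> continuous_on S f"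
| "Ck_on (Suc m) S f \<longleftrightarrow>
     f differentiable_on S \<and> (\<forall>b\<in>Basis. Ck_on m S (\<lambda>x. frechet_derivative f (at x) b))"

text \<open>Only used for open \<open>S\<close>, where differentiability within \<open>S\<close> is differentiability.\<close>

definition smooth_on :: "'a::euclidean_space set \<Rightarrow> ('a \<Rightarrow> 'b::real_normed_vector) \<Rightarrow> bool" where
  "smooth_on S f \<longleftrightarrow> (\<forall>m. Ck_on m S f)"

definition Cc_inf :: "'a::euclidean_space set \<Rightarrow> ('a \<Rightarrow> 'b::real_normed_vector) set" where
  "Cc_inf U = {\<phi>. smooth_on UNIV \<phi> \<and> (\<exists>K. compact K \<and> K \<subseteq> U \<and> (\<forall>x. x \<notin> K \<longrightarrow> \<phi> x = 0))}"

text \<open>Near each boundary point, the domain is the region above the graph of a Lipschitz function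
  over the hyperplane orthogonal to a unit vector \<open>e\<close>. That function is written as a function \<open>g\<close> on
  the whole space which is constant along \<open>e\<close>. It is piecewise smooth: up to a null set, the
  neighbourhood is covered by finitely many disjoint connected open pieces on each of which \<open>g\<close> is
  smooth. Smoothness up to the boundary of a piece is not required, so that conical points are
  allowed as well as curvilinear polyhedra.\<close>

definition piecewise_smooth_lipschitz_boundary :: "'a::euclidean_space set \<Rightarrow> bool" where
  "piecewise_smooth_lipschitz_boundary \<Omega> \<longleftrightarrow>
     (\<forall>p\<in>frontier \<Omega>. \<exists>e V g L \<U>.
        norm e = 1 \<and> open V \<and> p \<in> V \<and>
        L-lipschitz_on UNIV g \<and> (\<forall>y s. g (y + s *\<^sub>R e) = g y) \<and>
        \<Omega> \<inter> V = {y \<in> V. g y < y \<bullet> e} \<and>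
        finite \<U> \<and> disjoint \<U> \<and> negligible (V - \<Union>\<U>) \<and>
        (\<forall>U\<in>\<U>. open U \<and> connected U \<and> smooth_on U g))"

definition ball_like_domain :: "(real^'n) set \<Rightarrow> bool" where
  "ball_like_domain \<Omega> \<longleftrightarrow> open \<Omega> \<and> connected \<Omega> \<and> bounded \<Omega> \<and>
     \<Omega> homeomorphic ball (0 :: real^'n) 1 \<and> piecewise_smooth_lipschitz_boundary \<Omega>"


section \<open>Differential forms\<close>

text \<open>The component of a form at \<open>I = {i\<^sub>1 < \<dots> < i\<^sub>j}\<close> is the coefficient of
  \<open>dx\<^bsub>i\<^sub>1\<^esub> \<and> \<dots> \<and> dx\<^bsub>i\<^sub>j\<^esub>\<close>; the linear order on the index type orders the coordinates. These basis
  forms are orthonormal, so the pointwise inner product of forms is the Euclidean one.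
  Degrees are integers: in degrees \<open>-1\<close> and \<open>n + 1\<close> the only form is \<open>0\<close>.\<close>

type_synonym 'n form = "real^'n \<Rightarrow> real^('n set)"

definition Alt :: "int \<Rightarrow> (real^('n::{finite,linorder} set)) set" where
  "Alt j = {a. \<forall>I. int (card I) \<noteq> j \<longrightarrow> a $ I = 0}"

definition partial_deriv :: "'n::{finite,linorder} \<Rightarrow> 'n form \<Rightarrow> 'n form" where
  "partial_deriv i \<phi> x = frechet_derivative \<phi> (at x) (axis i 1)"

text \<open>\<open>dx\<^sub>i \<and> dx\<^sub>I = wedge_sign i I dx\<^bsub>I \<union> {i}\<^esub>\<close> for \<open>i \<notin> I\<close>.\<close>

definition wedge_sign :: "'n::{finite,linorder} \<Rightarrow> 'n set \<Rightarrow> real" where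
  "wedge_sign i I = (-1) ^ card {m \<in> I. m < i}"

text \<open>Coderivative of a smooth form, with the sign that makes it the formal adjoint of the exterior
  derivative \<open>smooth_d\<close>.\<close>

definition smooth_d :: "'n::{finite,linorder} form \<Rightarrow> 'n form" where
  "smooth_d \<phi> x = (\<chi> J. \<Sum>i\<in>J. wedge_sign i (J - {i}) * partial_deriv i \<phi> x $ (J - {i}))"

definition smooth_\<delta> :: "'n::{finite,linorder} form \<Rightarrow> 'n form" where
  "smooth_\<delta> \<phi> x = (\<chi> I. - (\<Sum>i\<in>- I. wedge_sign i I * partial_deriv i \<phi> x $ insert i I))"

definition test_forms :: "(real^'n::{finite,linorder}) set \<Rightarrow> int \<Rightarrow> 'n::{finite,linorder} form set" where
  "test_forms U j = {\<phi> \<in> Cc_inf U. \<forall>x. \<phi> x \<in> Alt j}"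


section \<open>Spaces of square integrable forms\<close>

text \<open>Elements of \<open>L\<^sup>2\<close> are represented by functions; \<open>eq_L2\<close> is equality in \<open>L\<^sup>2\<close>.\<close>

definition L2 :: "(real^'n::{finite,linorder}) set \<Rightarrow> int \<Rightarrow> 'n::{finite,linorder} form set" where
  "L2 \<Omega> j = {\<omega>. \<omega> \<in> borel_measurable (lebesgue_on \<Omega>) \<and>
                 integrable (lebesgue_on \<Omega>) (\<lambda>x. (norm (\<omega> x))\<^sup>2) \<and>
                 (AE x in lebesgue_on \<Omega>. \<omega> x \<in> Alt j)}"

definition ip :: "(real^'n::{finite,linorder}) set \<Rightarrow> 'n::{finite,linorder} form \<Rightarrow> 'n form \<Rightarrow> real" where
  "ip \<Omega> \<omega> \<eta> = (\<integral>x. \<omega> x \<bullet> \<eta> x \<partial>lebesgue_on \<Omega>)"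

definition L2norm :: "(real^'n::{finite,linorder}) set \<Rightarrow> 'n::{finite,linorder} form \<Rightarrow> real" where
  "L2norm \<Omega> \<omega> = sqrt (ip \<Omega> \<omega> \<omega>)"

definition eq_L2 :: "(real^'n::{finite,linorder}) set \<Rightarrow> 'n::{finite,linorder} form \<Rightarrow> 'n form \<Rightarrow> bool" where
  "eq_L2 \<Omega> \<omega> \<eta> \<longleftrightarrow> (AE x in lebesgue_on \<Omega>. \<omega> x = \<eta> x)"

text \<open>Exterior derivative and coderivative of \<open>j\<close>-forms in the sense of distributions.\<close>

definition has_d :: "(real^'n::{finite,linorder}) set \<Rightarrow> int \<Rightarrow> 'n::{finite,linorder} form \<Rightarrow> 'n form \<Rightarrow> bool" where
  "has_d \<Omega> j \<omega> \<eta> \<longleftrightarrow> \<omega> \<in> L2 \<Omega> j \<and> \<eta> \<in> L2 \<Omega> (j + 1) \<and>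
     (\<forall>\<phi>\<in>test_forms \<Omega> (j + 1). ip \<Omega> \<eta> \<phi> = ip \<Omega> \<omega> (smooth_\<delta> \<phi>))"

definition has_\<delta> :: "(real^'n::{finite,linorder}) set \<Rightarrow> int \<Rightarrow> 'n::{finite,linorder} form \<Rightarrow> 'n form \<Rightarrow> bool" where
  "has_\<delta> \<Omega> j \<mu> \<rho> \<longleftrightarrow> \<mu> \<in> L2 \<Omega> j \<and> \<rho> \<in> L2 \<Omega> (j - 1) \<and>
     (\<forall>\<phi>\<in>test_forms \<Omega> (j - 1). ip \<Omega> \<rho> \<phi> = ip \<Omega> \<mu> (smooth_d \<phi>))"

definition Hd :: "(real^'n::{finite,linorder}) set \<Rightarrow> int \<Rightarrow> 'n::{finite,linorder} form set" where
  "Hd \<Omega> j = {\<omega>. \<exists>\<eta>. has_d \<Omega> j \<omega> \<eta>}"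

definition Hstar :: "(real^'n::{finite,linorder}) set \<Rightarrow> int \<Rightarrow> 'n::{finite,linorder} form set" where
  "Hstar \<Omega> j = {\<mu>. \<exists>\<rho>. has_\<delta> \<Omega> j \<mu> \<rho>}"

text \<open>For \<open>\<omega> \<in> Hd \<Omega> j\<close> resp.\ \<open>\<mu> \<in> Hstar \<Omega> j\<close> these are unique up to null sets.\<close>

definition ext_d :: "(real^'n::{finite,linorder}) set \<Rightarrow> int \<Rightarrow> 'n::{finite,linorder} form \<Rightarrow> 'n form" where
  "ext_d \<Omega> j \<omega> = (SOME \<eta>. has_d \<Omega> j \<omega> \<eta>)"

definition codiff :: "(real^'n::{finite,linorder}) set \<Rightarrow> int \<Rightarrow> 'n::{finite,linorder} form \<Rightarrow> 'n form" where
  "codiff \<Omega> j \<mu> = (SOME \<rho>. has_\<delta> \<Omega> j \<mu> \<rho>)"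

text \<open>The trace of \<open>\<omega> \<in> Hd \<Omega> j\<close> is a distribution on the boundary, defined by Green's formula: for
  \<open>\<mu>\<close> smooth up to the boundary, the pairing of \<open>tr \<omega>\<close> with \<open>tr (\<star>\<mu>)\<close>, which for smooth \<open>\<omega>\<close> is the
  boundary integral of \<open>tr \<omega> \<and> tr (\<star>\<mu>)\<close>, equals \<open>\<langle>d\<omega>, \<mu>\<rangle> - \<langle>\<omega>, \<delta>\<mu>\<rangle>\<close>. The forms smooth up to the
  boundary are the restrictions of those in \<open>test_forms UNIV\<close>.\<close>

definition trace_pairing ::
    "(real^'n::{finite,linorder}) set \<Rightarrow> int \<Rightarrow> 'n::{finite,linorder} form \<Rightarrow> 'n form \<Rightarrow> real" where
  "trace_pairing \<Omega> j \<omega> \<mu> = ip \<Omega> (ext_d \<Omega> j \<omega>) \<mu> - ip \<Omega> \<omega> (smooth_\<delta> \<mu>)"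

definition H0 :: "(real^'n::{finite,linorder}) set \<Rightarrow> int \<Rightarrow> 'n::{finite,linorder} form set" where
  "H0 \<Omega> j = {\<omega> \<in> Hd \<Omega> j. \<forall>\<mu>\<in>test_forms UNIV (j + 1). trace_pairing \<Omega> j \<omega> \<mu> = 0}"

definition harmonic :: "(real^'n::{finite,linorder}) set \<Rightarrow> int \<Rightarrow> 'n::{finite,linorder} form set" where
  "harmonic \<Omega> j = {\<omega> \<in> H0 \<Omega> j \<inter> Hstar \<Omega> j.
     eq_L2 \<Omega> (ext_d \<Omega> j \<omega>) (\<lambda>_. 0) \<and> eq_L2 \<Omega> (codiff \<Omega> j \<omega>) (\<lambda>_. 0)}"


section \<open>Time-dependent forms\<close>

abbreviation time :: "real \<Rightarrow> real measure" where
  "time T \<equiv> lebesgue_on {0<..<T}"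

text \<open>\<open>L\<^sup>1((0,T), L\<^sup>2\<Lambda>\<^sup>j)\<close> in the sense of Bochner: almost everywhere limits of simple functions, with
  integrable norm.\<close>

definition L1_time ::
    "(real^'n::{finite,linorder}) set \<Rightarrow> int \<Rightarrow> real \<Rightarrow> (real \<Rightarrow> 'n::{finite,linorder} form) set" where
  "L1_time \<Omega> j T = {f.
     (AE t in time T. f t \<in> L2 \<Omega> j) \<and>
     (\<exists>s. (\<forall>i. simple_function (time T) (s i)) \<and> (\<forall>i t. s i t \<in> L2 \<Omega> j) \<and>
          (AE t in time T. (\<lambda>i. L2norm \<Omega> (\<lambda>x. s i t x - f t x)) \<longlonglongrightarrow> 0)) \<and>
     integrable (time T) (\<lambda>t. L2norm \<Omega> (f t))}"

text \<open>\<open>f \<in> W\<^sup>1\<^sup>,\<^sup>1((0,T), L\<^sup>2\<Lambda>\<^sup>j)\<close> with weak time derivative \<open>g\<close>. The identity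
  \<open>\<integral> \<phi>' f dt = - \<integral> \<phi> g dt\<close> between Bochner integrals is an identity in \<open>L\<^sup>2\<Lambda>\<^sup>j\<close>, expressed by testing
  with all \<open>v \<in> L\<^sup>2\<Lambda>\<^sup>j\<close>.\<close>

definition W11_time ::
    "(real^'n::{finite,linorder}) set \<Rightarrow> int \<Rightarrow> real \<Rightarrow> (real \<Rightarrow> 'n::{finite,linorder} form) \<Rightarrow> (real \<Rightarrow> 'n form) \<Rightarrow> bool"
  where
  "W11_time \<Omega> j T f g \<longleftrightarrow> f \<in> L1_time \<Omega> j T \<and> g \<in> L1_time \<Omega> j T \<and>
     (\<forall>\<phi>\<in>Cc_inf {0<..<T}. \<forall>v\<in>L2 \<Omega> j.
        (\<integral>t. deriv \<phi> t * ip \<Omega> (f t) v \<partial>time T) = - (\<integral>t. \<phi> t * ip \<Omega> (g t) v \<partial>time T))"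

definition continuous_time ::
    "(real^'n::{finite,linorder}) set \<Rightarrow> real \<Rightarrow> (real \<Rightarrow> 'n::{finite,linorder} form) \<Rightarrow> bool" where
  "continuous_time \<Omega> T u \<longleftrightarrow>
     (\<forall>t\<in>{0..T}. ((\<lambda>s. L2norm \<Omega> (\<lambda>x. u s x - u t x)) \<longlongrightarrow> 0) (at t within {0..T}))"


section \<open>The Hodge wave equation\<close>

text \<open>Strong solutions of the mixed formulation: each unknown is the continuous representative of a
  function in \<open>W\<^sup>1\<^sup>,\<^sup>1((0,T), L\<^sup>2)\<close>, so that the initial conditions make sense, and the equations hold
  for almost every time, the right-hand side being only integrable in time.\<close>

definition hodge_wave_solution ::
    "(real^'n::{finite,linorder}) set \<Rightarrow> int \<Rightarrow> real \<Rightarrow> (real \<Rightarrow> 'n::{finite,linorder} form) \<Rightarrow> 'n form \<Rightarrow> 'n form \<Rightarrow>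
     (real \<Rightarrow> 'n form) \<Rightarrow> (real \<Rightarrow> 'n form) \<Rightarrow> (real \<Rightarrow> 'n form) \<Rightarrow> bool" where
  "hodge_wave_solution \<Omega> k T f u\<^sub>0 u\<^sub>1 \<sigma> \<mu> \<omega> \<longleftrightarrow>
     (\<forall>t\<in>{0..T}. \<sigma> t \<in> H0 \<Omega> (k - 1) \<and>
                 \<mu> t \<in> H0 \<Omega> k \<inter> Hstar \<Omega> k \<and>
                 \<omega> t \<in> H0 \<Omega> (k + 1) \<inter> Hstar \<Omega> (k + 1)) \<and>
     continuous_time \<Omega> T \<sigma> \<and> continuous_time \<Omega> T \<mu> \<and> continuous_time \<Omega> T \<omega> \<and>
     (\<exists>\<sigma>\<^sub>t \<mu>\<^sub>t \<omega>\<^sub>t.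
        W11_time \<Omega> (k - 1) T \<sigma> \<sigma>\<^sub>t \<and> W11_time \<Omega> k T \<mu> \<mu>\<^sub>t \<and> W11_time \<Omega> (k + 1) T \<omega> \<omega>\<^sub>t \<and>
        (AE t in time T.
           (\<forall>\<tau>\<in>H0 \<Omega> (k - 1). ip \<Omega> (\<sigma>\<^sub>t t) \<tau> - ip \<Omega> (ext_d \<Omega> (k - 1) \<tau>) (\<mu> t) = 0) \<and>
           (\<forall>v\<in>H0 \<Omega> k. ip \<Omega> (\<mu>\<^sub>t t) v + ip \<Omega> (ext_d \<Omega> (k - 1) (\<sigma> t)) v
                          + ip \<Omega> (\<omega> t) (ext_d \<Omega> k v) = ip \<Omega> (f t) v) \<and>
           (\<forall>\<phi>\<in>H0 \<Omega> (k + 1). ip \<Omega> (\<omega>\<^sub>t t) \<phi> - ip \<Omega> (ext_d \<Omega> k (\<mu> t)) \<phi> = 0))) \<and>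
     eq_L2 \<Omega> (\<sigma> 0) (codiff \<Omega> k u\<^sub>0) \<and> eq_L2 \<Omega> (\<mu> 0) u\<^sub>1 \<and> eq_L2 \<Omega> (\<omega> 0) (ext_d \<Omega> k u\<^sub>0)"

definition energy_E ::
    "(real^'n::{finite,linorder}) set \<Rightarrow> (real \<Rightarrow> 'n::{finite,linorder} form) \<Rightarrow> (real \<Rightarrow> 'n form) \<Rightarrow>
     (real \<Rightarrow> 'n form) \<Rightarrow> real \<Rightarrow> real" where
  "energy_E \<Omega> \<sigma> \<mu> \<omega> t =
     sqrt ((L2norm \<Omega> (\<sigma> t))\<^sup>2 + (L2norm \<Omega> (\<mu> t))\<^sup>2 + (L2norm \<Omega> (\<omega> t))\<^sup>2)"

definition energy_H ::
    "(real^'n::{finite,linorder}) set \<Rightarrow> int \<Rightarrow> (real \<Rightarrow> 'n::{finite,linorder} form) \<Rightarrow> (real \<Rightarrow> 'n form) \<Rightarrow>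
     (real \<Rightarrow> 'n form) \<Rightarrow> real \<Rightarrow> real" where
  "energy_H \<Omega> k \<sigma> \<mu> \<omega> t =
     sqrt ((L2norm \<Omega> (ext_d \<Omega> (k - 1) (\<sigma> t)))\<^sup>2 + (L2norm \<Omega> (ext_d \<Omega> k (\<mu> t)))\<^sup>2
           + (L2norm \<Omega> (codiff \<Omega> k (\<mu> t)))\<^sup>2 + (L2norm \<Omega> (codiff \<Omega> (k + 1) (\<omega> t)))\<^sup>2)"

end

theory Submission
  imports Defs
begin

text \<open>
  Write \<open>u = (\<sigma>, \<mu>, \<omega>)\<close> and let \<open>A u = (\<delta>\<mu>, - d\<sigma> - \<delta>\<omega>, d\<mu>)\<close>, so that the equation reads
  \<open>u\<^sub>t = A u + (0, f, 0)\<close> with \<open>A\<close> formally skew-adjoint. Testing with \<open>u\<close> bounds \<open>E\<close>. Since \<open>d\<sigma>\<close> and \<open>\<delta>\<omega>\<close>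
  are orthogonal, \<open>H(t) = \<parallel>A u(t)\<parallel>\<close>. The solution is not known to be twice differentiable in time, so
  \<open>H\<close> is bounded through difference quotients: \<open>\<parallel>u(t + h) - u(t)\<parallel>\<close> grows in \<open>t\<close> by at most
  \<open>h \<integral> \<parallel>f\<^sub>t\<parallel>\<close>, and at the initial time it is at most \<open>h (H + sup \<parallel>f\<parallel>)\<close>. All estimates run in both
  directions of time, which gives conservation for \<open>f = 0\<close>.

  Green's formula for \<open>H\<^sub>0\<Lambda>\<close> and \<open>H\<^sup>*\<Lambda>\<close> is not taken from the geometry of the domain. The equations yield
  it for \<open>u(t)\<close> at almost every time; starting from such a time, the estimates bound \<open>A u\<close> uniformly,
  and weak limits extend it to every time, including \<open>t = 0\<close>.
\<close>


section \<open>Curves with an integrable weak derivative\<close>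

text \<open>The obstacle is that \<open>H0\<close> is defined by testing with forms smooth up to the
  boundary and \<open>Hstar\<close> by testing with compactly supported forms only, so the
  definitions alone do not give <d x, y> = <x, \<delta> y> for x in one space and y in the other; on
  the domain this would be a density theorem up to the boundary. The equations help because their
  tests run through all of H_0: the component of u_t (minus the source) and the distributional
  coderivative agree on compactly supported forms, hence are equal in L^2, and the equation then is
  Green's formula. The constants: the increment from a good time costs h (H + sup |f|), and the
  return from u_t to A u = u_t - f costs sup |f| once more. This gives H(t) \<le> H(a) + 2 sup |f| +
  \<integral> |f_t|, and for E the factor 1 in front of \<integral> |f|. Although u_t exists only
  almost everywhere, A u(t) is bounded at every single time: its pairing with a compactly supported
  form is continuous in t, so bounds on averages over short intervals suffice.\<close>

text \<open>Testing with fixed vectors \<open>v\<close> reduces everything to integrals of real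
  functions; no integral with values in \<open>'a\<close> is formed. The majorant \<open>m\<close>
  is there for dominated convergence in \<open>weak_deriv_energy\<close>.\<close>

definition weak_deriv :: "real \<Rightarrow> real \<Rightarrow> (real \<Rightarrow> 'a::real_inner) \<Rightarrow> (real \<Rightarrow> 'a) \<Rightarrow> bool" where
  "weak_deriv a b u g \<longleftrightarrow> continuous_on {a..b} u \<and>
     (\<exists>m N. m integrable_on {a..b} \<and> negligible N \<and> (\<forall>r\<in>{a..b} - N. norm (g r) \<le> m r)) \<and>
     (\<forall>v s t. a \<le> s \<longrightarrow> s \<le> t \<longrightarrow> t \<le> b \<longrightarrow> ((\<lambda>r. g r \<bullet> v) has_integral (u t - u s) \<bullet> v) {s..t})"

lemma weak_deriv_has_integral:
  assumes "weak_deriv a b u g" "a \<le> s" "s \<le> t" "t \<le> b"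
  shows "((\<lambda>r. g r \<bullet> v) has_integral (u t - u s) \<bullet> v) {s..t}"
  using assms unfolding weak_deriv_def by blast

lemma weak_deriv_continuous: "weak_deriv a b u g \<Longrightarrow> continuous_on {a..b} u"
  by (simp add: weak_deriv_def)

lemma weak_deriv_subinterval:
  assumes "weak_deriv a b u g" "a \<le> a'" "b' \<le> b"
  shows "weak_deriv a' b' u g"
proof -
  obtain m N where m: "m integrable_on {a..b}" "negligible N" "\<And>r. r \<in> {a..b} - N \<Longrightarrow> norm (g r) \<le> m r"
    using assms(1) unfolding weak_deriv_def by blast
  have "m integrable_on {a'..b'}"
    using m(1) assms integrable_on_subinterval by fastforce
  moreover have "continuous_on {a'..b'} u"
    using assms unfolding weak_deriv_def by (auto elim: continuous_on_subset)
  ultimately show ?thesis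
    unfolding weak_deriv_def using assms m
    by (intro conjI exI[of _ m] exI[of _ N] allI impI ballI weak_deriv_has_integral[OF assms(1)]) auto
qed

text \<open>Time reversal turns each forward growth estimate into a backward one.\<close>

lemma weak_deriv_reflect:
  assumes "weak_deriv a b u g"
  shows "weak_deriv (-b) (-a) (\<lambda>r. u (-r)) (\<lambda>r. - g (-r))"
proof -
  obtain m N where m: "m integrable_on {a..b}" "negligible N" "\<And>r. r \<in> {a..b} - N \<Longrightarrow> norm (g r) \<le> m r"
    using assms(1) unfolding weak_deriv_def by blast
  have "(\<lambda>r. m (-r)) integrable_on {-b..-a}"
    using m(1) by (simp add: integrable_reflect_real)
  moreover have "negligible (uminus ` N)"
    using m(2) by (intro negligible_differentiable_image_negligible) (auto intro!: derivative_intros)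
  moreover have "\<forall>r\<in>{-b..-a} - uminus ` N. norm (- g (-r)) \<le> m (-r)"
  proof
    fix r assume r: "r \<in> {-b..-a} - uminus ` N"
    then have "-r \<notin> N" by force
    with r show "norm (- g (-r)) \<le> m (-r)"
      using m(3)[of "-r"] by auto
  qed
  moreover have "continuous_on {-b..-a} (\<lambda>r. u (-r))"
    by (rule continuous_on_compose2[OF weak_deriv_continuous[OF assms]]) (auto intro!: continuous_intros)
  moreover have "((\<lambda>r. - g (-r) \<bullet> v) has_integral (u (-t) - u (-s)) \<bullet> v) {s..t}"
    if "-b \<le> s" "s \<le> t" "t \<le> -a" for s t v
  proof -
    have "((\<lambda>r. g r \<bullet> v) has_integral (u (-s) - u (-t)) \<bullet> v) {-t..-s}"
      using that by (intro weak_deriv_has_integral[OF assms]) auto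
    then have "((\<lambda>r. g (-r) \<bullet> v) has_integral (u (-s) - u (-t)) \<bullet> v) {s..t}"
      using has_integral_reflect_real[of "\<lambda>r. g r \<bullet> v" "(u (-s) - u (-t)) \<bullet> v" "-s" "-t"] by simp
    from has_integral_neg[OF this] show ?thesis
      by (simp add: inner_diff_left)
  qed
  ultimately show ?thesis unfolding weak_deriv_def by blast
qed

section \<open>The energy identity for weakly differentiable curves\<close>

text \<open>A discrete product rule: on a partition interval [s, t] the constant
  \<open>u s + u t\<close> gives exactly (u t - u s) . (u s + u t) = |u t|^2 - |u s|^2, and the sum
  telescopes. As \<open>S r\<close> adds two values of \<open>u\<close> taken within \<delta> of r,
  it tends to 2 u(r) when the mesh shrinks.\<close>

lemma weak_deriv_step_functions:
  assumes w: "weak_deriv a b u g" and "\<delta> > 0" "t - a \<le> real n * \<delta>" "a \<le> t" "t \<le> b"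
  shows "\<exists>S. (\<forall>r\<in>{a..t}. \<exists>x\<in>{a..t}. \<exists>y\<in>{a..t}. \<bar>x - r\<bar> \<le> \<delta> \<and> \<bar>y - r\<bar> \<le> \<delta> \<and> S r = u x + u y) \<and>
             ((\<lambda>r. g r \<bullet> S r) has_integral (norm (u t))\<^sup>2 - (norm (u a))\<^sup>2) {a..t}"
  using assms(3-)
proof (induction n arbitrary: t)
  case 0
  then have "t = a" by simp
  show ?case unfolding \<open>t = a\<close>
    by (intro exI[of _ "\<lambda>r. u a + u a"] conjI) (use \<open>\<delta> > 0\<close> in auto)
next
  case (Suc n)
  define s where "s = max a (t - \<delta>)"
  have s: "a \<le> s" "s \<le> t" "s \<le> b" "t - s \<le> \<delta>" using Suc.prems \<open>\<delta> > 0\<close> by (auto simp: s_def)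
  have "s - a \<le> real n * \<delta>"
    using Suc.prems \<open>\<delta> > 0\<close> by (auto simp: s_def max_def algebra_simps)
  from Suc.IH[OF this s(1,3)] obtain S where S:
    "\<And>r. r\<in>{a..s} \<Longrightarrow> \<exists>x\<in>{a..s}. \<exists>y\<in>{a..s}. \<bar>x - r\<bar> \<le> \<delta> \<and> \<bar>y - r\<bar> \<le> \<delta> \<and> S r = u x + u y"
    "((\<lambda>r. g r \<bullet> S r) has_integral (norm (u s))\<^sup>2 - (norm (u a))\<^sup>2) {a..s}" by blast
  define S' where "S' = (\<lambda>r. if r \<le> s then S r else u s + u t)"
  have 1: "((\<lambda>r. g r \<bullet> S' r) has_integral (norm (u s))\<^sup>2 - (norm (u a))\<^sup>2) {a..s}"
    using S(2) by (rule has_integral_eq[rotated]) (auto simp: S'_def)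
  have "((\<lambda>r. g r \<bullet> (u s + u t)) has_integral (u t - u s) \<bullet> (u s + u t)) {s..t}"
    using s Suc.prems by (intro weak_deriv_has_integral[OF w]) auto
  then have 2: "((\<lambda>r. g r \<bullet> S' r) has_integral (u t - u s) \<bullet> (u s + u t)) {s..t}"
    by (rule has_integral_spike_finite[where S="{s}", rotated 2]) (auto simp: S'_def)
  have "(u t - u s) \<bullet> (u s + u t) = (norm (u t))\<^sup>2 - (norm (u s))\<^sup>2"
    by (simp add: algebra_simps power2_norm_eq_inner inner_commute)
  with has_integral_combine[OF s(1,2) 1 2]
  have "((\<lambda>r. g r \<bullet> S' r) has_integral (norm (u t))\<^sup>2 - (norm (u a))\<^sup>2) {a..t}"
    by simp
  moreover have "\<exists>x\<in>{a..t}. \<exists>y\<in>{a..t}. \<bar>x - r\<bar> \<le> \<delta> \<and> \<bar>y - r\<bar> \<le> \<delta> \<and> S' r = u x + u y"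
    if r: "r \<in> {a..t}" for r
  proof (cases "r \<le> s")
    case True
    with r have "r \<in> {a..s}" by auto
    from S(1)[OF this] obtain x y where "x\<in>{a..s}" "y\<in>{a..s}" "\<bar>x - r\<bar> \<le> \<delta>" "\<bar>y - r\<bar> \<le> \<delta>" "S r = u x + u y" by blast
    then show ?thesis using s True by (intro bexI[of _ x] bexI[of _ y]) (auto simp: S'_def)
  next
    case False
    then show ?thesis using s r by (intro bexI[of _ s] bexI[of _ t]) (auto simp: S'_def)
  qed
  ultimately show ?case by blast
qed

lemma weak_deriv_spike:
  assumes "weak_deriv a b u g" "negligible N" "\<And>r. r \<in> {a..b} - N \<Longrightarrow> g' r = g r"
  shows "weak_deriv a b u g'"
proof -
  obtain m M where m: "m integrable_on {a..b}" "negligible M" "\<And>r. r \<in> {a..b} - M \<Longrightarrow> norm (g r) \<le> m r"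
    using assms(1) unfolding weak_deriv_def by blast
  have "((\<lambda>r. g' r \<bullet> v) has_integral (u t - u s) \<bullet> v) {s..t}" if "a \<le> s" "s \<le> t" "t \<le> b" for v s t
    using weak_deriv_has_integral[OF assms(1) that, of v]
    by (rule has_integral_spike[OF assms(2), rotated]) (use assms(3) that in auto)
  then show ?thesis
    using assms m unfolding weak_deriv_def
    by (intro conjI exI[of _ m] exI[of _ "M \<union> N"]) auto
qed

text \<open>Dominated convergence along the step functions of mesh 1/(k+1); their integrals have the
  same value for every k, so only the integrand moves.\<close>

lemma weak_deriv_energy:
  assumes w: "weak_deriv a b u g" and "a \<le> b"
  shows "((\<lambda>r. 2 * (g r \<bullet> u r)) has_integral (norm (u b))\<^sup>2 - (norm (u a))\<^sup>2) {a..b}"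
proof -
  obtain m N where m: "m integrable_on {a..b}" "negligible N" "\<And>r. r \<in> {a..b} - N \<Longrightarrow> norm (g r) \<le> m r"
    using w unfolding weak_deriv_def by blast
  \<comment> \<open>The bound by \<open>m\<close> holds off \<open>N\<close> only, whereas the
    convergence theorem asks for it at every point; \<open>g0\<close> and \<open>m0\<close> vanish
    on \<open>N\<close>.\<close>
  define g0 where "g0 = (\<lambda>r. if r \<in> N then 0 else g r)"
  have w0: "weak_deriv a b u g0"
    using w m(2) by (rule weak_deriv_spike) (auto simp: g0_def)
  define m0 where "m0 = (\<lambda>r. if r \<in> N then 0 else m r)"
  have m0: "m0 integrable_on {a..b}"
    using m(1,2) by (rule integrable_spike) (auto simp: m0_def)
  have gm: "norm (g0 r) \<le> m0 r" if "r \<in> {a..b}" for r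
    using that m(3) by (auto simp: m0_def g0_def)
  have cont: "continuous_on {a..b} u" using weak_deriv_continuous w .
  then have "bounded (u ` {a..b})"
    by (intro compact_imp_bounded compact_continuous_image) auto
  then obtain B where B: "\<And>r. r \<in> {a..b} \<Longrightarrow> norm (u r) \<le> B"
    unfolding bounded_iff by blast
  define P where "P k S \<longleftrightarrow> (\<forall>r\<in>{a..b}. \<exists>x\<in>{a..b}. \<exists>y\<in>{a..b}. \<bar>x - r\<bar> \<le> 1 / Suc k \<and> \<bar>y - r\<bar> \<le> 1 / Suc k \<and> S r = u x + u y) \<and>
             ((\<lambda>r. g0 r \<bullet> S r) has_integral (norm (u b))\<^sup>2 - (norm (u a))\<^sup>2) {a..b}" for k S
  have "\<exists>S. P k S" for k
  proof -
    obtain n where "(b - a) * Suc k \<le> real n" using real_arch_simple by blast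
    then have "b - a \<le> real n * (1 / Suc k)" by (simp add: field_simps)
    then show ?thesis using weak_deriv_step_functions[OF w0, of "1 / Suc k" b n] \<open>a \<le> b\<close> by (auto simp: P_def)
  qed
  then obtain S where "\<And>k. P k (S k)" by metis
  then obtain S where S:
    "\<And>k r. r\<in>{a..b} \<Longrightarrow> \<exists>x\<in>{a..b}. \<exists>y\<in>{a..b}. \<bar>x - r\<bar> \<le> 1 / Suc k \<and> \<bar>y - r\<bar> \<le> 1 / Suc k \<and> S k r = u x + u y"
    "\<And>k. ((\<lambda>r. g0 r \<bullet> S k r) has_integral (norm (u b))\<^sup>2 - (norm (u a))\<^sup>2) {a..b}" unfolding P_def by blast
  have conv: "(\<lambda>k. g0 r \<bullet> S k r) \<longlonglongrightarrow> 2 * (g0 r \<bullet> u r)" if r: "r \<in> {a..b}" for r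
  proof -
    obtain x y where xy: "\<And>k. x k \<in> {a..b}" "\<And>k. y k \<in> {a..b}" "\<And>k. \<bar>x k - r\<bar> \<le> 1 / Suc k"
      "\<And>k. \<bar>y k - r\<bar> \<le> 1 / Suc k" "\<And>k. S k r = u (x k) + u (y k)"
      using S(1)[OF r] by metis
    have lim0: "(\<lambda>k. 1 / real (Suc k)) \<longlonglongrightarrow> 0" using LIMSEQ_inverse_real_of_nat by (simp add: inverse_eq_divide)
    have "x \<longlonglongrightarrow> r"
      by (rule LIM_zero_cancel, rule Lim_null_comparison[OF _ lim0]) (use xy in auto)
    moreover have "y \<longlonglongrightarrow> r"
      by (rule LIM_zero_cancel, rule Lim_null_comparison[OF _ lim0]) (use xy in auto)
    ultimately have "(\<lambda>k. u (x k)) \<longlonglongrightarrow> u r" "(\<lambda>k. u (y k)) \<longlonglongrightarrow> u r"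
      using cont r xy by (auto simp: continuous_on_sequentially o_def)
    then have "(\<lambda>k. g0 r \<bullet> (u (x k) + u (y k))) \<longlonglongrightarrow> g0 r \<bullet> (u r + u r)" by (intro tendsto_intros)
    then show ?thesis by (simp add: xy(5) inner_add_right)
  qed
  have bd: "norm (g0 r \<bullet> S k r) \<le> m0 r * (2 * B)" if r: "r \<in> {a..b}" for r k
  proof -
    obtain x y where xy: "x \<in> {a..b}" "y \<in> {a..b}" "S k r = u x + u y" using S(1)[OF r] by metis
    have "norm (S k r) \<le> 2 * B" using xy B[of x] B[of y] norm_triangle_ineq[of "u x" "u y"] by simp
    moreover have "norm (g0 r \<bullet> S k r) \<le> norm (g0 r) * norm (S k r)" using Cauchy_Schwarz_ineq2 by auto
    ultimately show ?thesis using gm[OF r]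
      by (meson mult_mono norm_ge_zero order_trans)
  qed
  have dom: "(\<lambda>r. m0 r * (2 * B)) integrable_on {a..b}" using m0 by (rule integrable_on_mult_left)
  have "(\<lambda>r. 2 * (g0 r \<bullet> u r)) integrable_on {a..b}"
    "(\<lambda>k. integral {a..b} (\<lambda>r. g0 r \<bullet> S k r)) \<longlonglongrightarrow> integral {a..b} (\<lambda>r. 2 * (g0 r \<bullet> u r))"
    using dominated_convergence[OF has_integral_integrable[OF S(2)] dom bd conv] by auto
  moreover have "integral {a..b} (\<lambda>r. g0 r \<bullet> S k r) = (norm (u b))\<^sup>2 - (norm (u a))\<^sup>2" for k
    using S(2) by (rule integral_unique)
  ultimately have "((\<lambda>r. 2 * (g0 r \<bullet> u r)) has_integral (norm (u b))\<^sup>2 - (norm (u a))\<^sup>2) {a..b}"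
    by (simp add: LIMSEQ_const_iff has_integral_iff)
  then show ?thesis
    by (rule has_integral_spike[OF m(2), rotated]) (auto simp: g0_def)
qed

text \<open>Lets a scalar majorant obey the same energy identity as the curve that is compared with
  it.\<close>

lemma weak_deriv_integral:
  fixes c :: "real \<Rightarrow> real"
  assumes "c absolutely_integrable_on {a..b}"
  shows "weak_deriv a b (\<lambda>t. k + integral {a..t} c) c"
  unfolding weak_deriv_def
proof (intro conjI allI impI)
  have c: "c integrable_on {a..b}" "(\<lambda>r. norm (c r)) integrable_on {a..b}"
    using assms by (auto simp: absolutely_integrable_on_def)
  have ci: "c integrable_on {s..t}" if "a \<le> s" "t \<le> b" for s t
    using c(1) by (rule integrable_on_subinterval) (use that in auto)
  show "continuous_on {a..b} (\<lambda>t. k + integral {a..t} c)"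
    by (intro continuous_intros indefinite_integral_continuous_1 c)
  show "\<exists>m N. m integrable_on {a..b} \<and> negligible N \<and> (\<forall>r\<in>{a..b} - N. norm (c r) \<le> m r)"
    using c(2) by (intro exI[of _ "\<lambda>r. norm (c r)"] exI[of _ "{}"]) auto
  fix v s t :: real assume st: "a \<le> s" "s \<le> t" "t \<le> b"
  have "integral {a..s} c + integral {s..t} c = integral {a..t} c"
    using st by (intro Henstock_Kurzweil_Integration.integral_combine ci) auto
  then have "(k + integral {a..t} c) - (k + integral {a..s} c) = integral {s..t} c" by simp
  then have "(c has_integral ((k + integral {a..t} c) - (k + integral {a..s} c))) {s..t}"
    using ci[of s t] st by (simp only: has_integral_integral)
  then show "((\<lambda>r. c r \<bullet> v) has_integral ((k + integral {a..t} c) - (k + integral {a..s} c)) \<bullet> v) {s..t}"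
    by (simp add: has_integral_mult_left)
qed

section \<open>Growth of the norm in both directions of time\<close>

lemma closure_minus_negligible:
  fixes N :: "real set"
  assumes "negligible N" "a < b"
  shows "closure ({a..b} - N) = {a..b}"
proof
  show "closure ({a..b} - N) \<subseteq> {a..b}" by (intro closure_minimal) auto
  have "{a<..<b} \<subseteq> closure ({a..b} - N)"
  proof
    fix t assume t: "t \<in> {a<..<b}"
    show "t \<in> closure ({a..b} - N)"
      unfolding closure_approachable
    proof (intro allI impI)
      fix e :: real assume "e > 0"
      define l where "l = min e (b - t)"
      have "\<not> negligible {t<..<t + l}"
        using t \<open>e > 0\<close> negligible_interval(2)[of t "t + l"] by (simp add: l_def min_def)
      then obtain x where "x \<in> {t<..<t + l}" "x \<notin> N" using assms(1) negligible_subset by blast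
      then show "\<exists>x\<in>{a..b} - N. dist x t < e" using t by (intro bexI[of _ x]) (auto simp: l_def dist_real_def)
    qed
  qed
  then have "closure {a<..<b} \<subseteq> closure ({a..b} - N)" by (rule closure_minimal) simp
  then show "{a..b} \<subseteq> closure ({a..b} - N)" using assms(2) by simp
qed

text \<open>First crossing: \<open>\<parallel>u\<parallel>\<close> stays below \<open>z(r) = \<parallel>u(a)\<parallel> + \<epsilon> + \<integral>\<^sub>a\<^sup>r c\<close>, because up to a first time \<open>t\<close> with
  \<open>z(t) \<le> \<parallel>u(t)\<parallel>\<close> the energy identities give \<open>\<parallel>u\<parallel>\<^sup>2 - \<parallel>u(a)\<parallel>\<^sup>2 \<le> \<integral> 2 c z = z\<^sup>2 - z(a)\<^sup>2\<close>.\<close>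

lemma weak_deriv_norm_growth:
  assumes w: "weak_deriv a b u g" and "a \<le> b" and c: "c integrable_on {a..b}" "\<And>r. r \<in> {a..b} \<Longrightarrow> 0 \<le> c r"
    and N: "negligible N" "\<And>r. r \<in> {a..b} - N \<Longrightarrow> g r \<bullet> u r \<le> c r * norm (u r)"
  shows "norm (u b) \<le> norm (u a) + integral {a..b} c"
proof (rule field_le_epsilon)
  fix \<epsilon> :: real assume "\<epsilon> > 0"
  \<comment> \<open>The margin \<epsilon> makes |u(a)|^2 < z(a)^2 strict; this strictness is what
    contradicts z(t) \<le> |u(t)| at the first crossing.\<close>
  define z where "z = (\<lambda>r. norm (u a) + \<epsilon> + integral {a..r} c)"
  have ci: "c integrable_on {s..t}" if "a \<le> s" "t \<le> b" for s t
    using c(1) by (rule integrable_on_subinterval) (use that in auto)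
  have zw: "weak_deriv a b z c"
    unfolding z_def by (intro weak_deriv_integral nonnegative_absolutely_integrable_1 c)
  note zcont = weak_deriv_continuous[OF zw]
  have "norm (u b) \<le> z b"
  proof (rule ccontr)
    assume contra: "\<not> norm (u b) \<le> z b"
    define A where "A = {t\<in>{a..b}. z t \<le> norm (u t)}"
    have "closed A" unfolding A_def
      by (intro continuous_on_closed_Collect_le continuous_intros zcont weak_deriv_continuous[OF w])
    have "bounded A" by (rule bounded_subset[of "{a..b}"]) (auto simp: A_def)
    with \<open>closed A\<close> have cA: "compact A" by (simp add: compact_eq_bounded_closed)
    have "b \<in> A" using contra \<open>a \<le> b\<close> by (auto simp: A_def)
    then obtain t where t: "t \<in> A" "\<And>s. s \<in> A \<Longrightarrow> t \<le> s"
      using compact_attains_inf[OF cA] by blast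
    have tab: "a \<le> t" "t \<le> b" using t by (auto simp: A_def)
    have lt: "norm (u r) < z r" if "r \<in> {a..t}" "r \<noteq> t" for r
      using t(2)[of r] that tab by (force simp: A_def)
    have 1: "((\<lambda>r. 2 * (g r \<bullet> u r)) has_integral (norm (u t))\<^sup>2 - (norm (u a))\<^sup>2) {a..t}"
      by (rule weak_deriv_energy[OF weak_deriv_subinterval[OF w]]) (use tab in auto)
    have 2: "((\<lambda>r. 2 * (c r \<bullet> z r)) has_integral (norm (z t))\<^sup>2 - (norm (z a))\<^sup>2) {a..t}"
      by (rule weak_deriv_energy[OF weak_deriv_subinterval[OF zw]]) (use tab in auto)
    define h where "h = (\<lambda>r. if r \<in> insert t N then 2 * (c r \<bullet> z r) else 2 * (g r \<bullet> u r))"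
    have 3: "(h has_integral (norm (u t))\<^sup>2 - (norm (u a))\<^sup>2) {a..t}"
      by (rule has_integral_spike[OF _ _ 1, where S = "insert t N"]) (use N in \<open>auto simp: h_def\<close>)
    have "(norm (u t))\<^sup>2 - (norm (u a))\<^sup>2 \<le> (norm (z t))\<^sup>2 - (norm (z a))\<^sup>2"
    proof (rule has_integral_le[OF 3 2])
      fix r assume r: "r \<in> {a..t}"
      show "h r \<le> 2 * (c r \<bullet> z r)"
      proof (cases "r \<in> insert t N")
        case False
        then have "g r \<bullet> u r \<le> c r * norm (u r)" using N(2)[of r] r tab by auto
        also have "\<dots> \<le> c r * z r" using lt[of r] r False c(2)[of r] tab by (intro mult_left_mono) auto
        finally show ?thesis using False by (simp add: h_def)
      qed (simp add: h_def)
    qed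
    moreover have "(norm (z a))\<^sup>2 > (norm (u a))\<^sup>2"
      using \<open>\<epsilon> > 0\<close> by (intro power_strict_mono) (auto simp: z_def)
    ultimately have "(norm (u t))\<^sup>2 < (norm (z t))\<^sup>2" by linarith
    then have "norm (u t) < norm (z t)" by (rule power_less_imp_less_base) simp
    moreover have "0 \<le> z t"
      unfolding z_def using \<open>\<epsilon> > 0\<close> tab by (intro add_nonneg_nonneg integral_nonneg ci) (use c(2) in auto)
    ultimately show False using t(1) by (auto simp: A_def)
  qed
  then show "norm (u b) \<le> norm (u a) + integral {a..b} c + \<epsilon>" by (simp add: z_def)
qed

lemma weak_deriv_norm_growth_backward:
  assumes w: "weak_deriv a b u g" and "a \<le> b" and c: "c integrable_on {a..b}" "\<And>r. r \<in> {a..b} \<Longrightarrow> 0 \<le> c r"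
    and N: "negligible N" "\<And>r. r \<in> {a..b} - N \<Longrightarrow> - (g r \<bullet> u r) \<le> c r * norm (u r)"
  shows "norm (u a) \<le> norm (u b) + integral {a..b} c"
proof -
  have "negligible (uminus ` N)"
    using N(1) by (intro negligible_differentiable_image_negligible) (auto intro!: derivative_intros)
  moreover have "- g (-r) \<bullet> u (-r) \<le> c (-r) * norm (u (-r))" if "r \<in> {-b..-a} - uminus ` N" for r
  proof -
    have "-r \<notin> N" using that by force
    then show ?thesis using N(2)[of "-r"] that by auto
  qed
  ultimately have "norm (u (- (-a))) \<le> norm (u (- (-b))) + integral {-b..-a} (\<lambda>r. c (-r))"
    using c by (intro weak_deriv_norm_growth[OF weak_deriv_reflect[OF w], where N = "uminus ` N"])
      (auto simp: integrable_reflect_real \<open>a \<le> b\<close>)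
  then show ?thesis using \<open>a \<le> b\<close> by simp
qed

lemma weak_deriv_norm_le:
  assumes w: "weak_deriv a b u g" and st: "s \<in> {a..b}" "t \<in> {a..b}"
    and c: "c integrable_on {a..b}" "\<And>r. r \<in> {a..b} \<Longrightarrow> 0 \<le> c r"
    and N: "negligible N" "\<And>r. r \<in> {a..b} - N \<Longrightarrow> \<bar>g r \<bullet> u r\<bar> \<le> c r * norm (u r)"
  shows "norm (u t) \<le> norm (u s) + integral {min s t..max s t} c"
proof (cases "s \<le> t")
  case True
  have "c integrable_on {s..t}" using c(1) by (rule integrable_on_subinterval) (use st in auto)
  moreover have "g r \<bullet> u r \<le> c r * norm (u r)" if "r \<in> {s..t} - N" for r
    using N(2)[of r] that st by (simp add: abs_le_iff)
  ultimately show ?thesis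
    using weak_deriv_norm_growth[OF weak_deriv_subinterval[OF w], of s t c N] True st c N(1) by auto
next
  case False
  have "c integrable_on {t..s}" using c(1) by (rule integrable_on_subinterval) (use st in auto)
  moreover have "- (g r \<bullet> u r) \<le> c r * norm (u r)" if "r \<in> {t..s} - N" for r
    using N(2)[of r] that st by (simp add: abs_le_iff)
  ultimately show ?thesis
    using weak_deriv_norm_growth_backward[OF weak_deriv_subinterval[OF w], of t s c N] False st c N(1) by auto
qed

section \<open>Translations, differences, products and pairs of curves\<close>

lemma weak_deriv_shift:
  assumes "weak_deriv a b u g"
  shows "weak_deriv (a - h) (b - h) (\<lambda>r. u (r + h)) (\<lambda>r. g (r + h))"
proof -
  obtain m N where m: "m integrable_on {a..b}" "negligible N" "\<And>r. r \<in> {a..b} - N \<Longrightarrow> norm (g r) \<le> m r"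
    using assms(1) unfolding weak_deriv_def by blast
  have "(\<lambda>r. m (r + h)) integrable_on {a-h..b-h}"
    using m(1) by (rule integrable_shift_real_ivl)
  moreover have "negligible ((+) (-h) ` N)" using m(2) by (rule negligible_translation)
  moreover have "\<forall>r\<in>{a-h..b-h} - (+) (-h) ` N. norm (g (r + h)) \<le> m (r + h)"
  proof
    fix r assume r: "r \<in> {a-h..b-h} - (+) (-h) ` N"
    then have "r + h \<notin> N" by force
    with r show "norm (g (r + h)) \<le> m (r + h)" using m(3)[of "r + h"] by auto
  qed
  moreover have "continuous_on {a-h..b-h} (\<lambda>r. u (r + h))"
    by (rule continuous_on_compose2[OF weak_deriv_continuous[OF assms]]) (auto intro!: continuous_intros)
  moreover have "((\<lambda>r. g (r + h) \<bullet> v) has_integral (u (t + h) - u (s + h)) \<bullet> v) {s..t}"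
    if "a - h \<le> s" "s \<le> t" "t \<le> b - h" for s t v
    using has_integral_shift_real_ivl[OF weak_deriv_has_integral[OF assms, of "s + h" "t + h" v], of h] that by simp
  ultimately show ?thesis unfolding weak_deriv_def by blast
qed

lemma weak_deriv_diff:
  assumes 1: "weak_deriv a b u g" and 2: "weak_deriv a b u' g'"
  shows "weak_deriv a b (\<lambda>r. u r - u' r) (\<lambda>r. g r - g' r)"
proof -
  obtain m N where m: "m integrable_on {a..b}" "negligible N" "\<And>r. r \<in> {a..b} - N \<Longrightarrow> norm (g r) \<le> m r"
    using 1 unfolding weak_deriv_def by blast
  obtain m' N' where m': "m' integrable_on {a..b}" "negligible N'" "\<And>r. r \<in> {a..b} - N' \<Longrightarrow> norm (g' r) \<le> m' r"
    using 2 unfolding weak_deriv_def by blast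
  have "norm (g r - g' r) \<le> m r + m' r" if "r \<in> {a..b} - (N \<union> N')" for r
    using m(3)[of r] m'(3)[of r] that norm_triangle_ineq4[of "g r" "g' r"] by auto
  moreover have "(\<lambda>r. m r + m' r) integrable_on {a..b}" using m m' by (intro integrable_add)
  moreover have "negligible (N \<union> N')" using m m' by (intro negligible_Un)
  moreover have "continuous_on {a..b} (\<lambda>r. u r - u' r)"
    by (intro continuous_intros weak_deriv_continuous[OF 1] weak_deriv_continuous[OF 2])
  moreover have "((\<lambda>r. (g r - g' r) \<bullet> v) has_integral ((u t - u' t) - (u s - u' s)) \<bullet> v) {s..t}"
    if "a \<le> s" "s \<le> t" "t \<le> b" for v s t
    using has_integral_diff[OF weak_deriv_has_integral[OF 1 that, of v] weak_deriv_has_integral[OF 2 that, of v]]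
    by (simp add: inner_diff_left algebra_simps)
  ultimately show ?thesis unfolding weak_deriv_def by blast
qed

lemma weak_deriv_const: "weak_deriv a b (\<lambda>r. c) (\<lambda>r. 0)"
  unfolding weak_deriv_def
  by (intro conjI exI[of _ "\<lambda>_. 0"] exI[of _ "{}"]) auto

lemma weak_deriv_product:
  assumes u: "weak_deriv a b u g" and v: "weak_deriv a b v h" and "a \<le> b"
  shows "((\<lambda>r. g r \<bullet> v r + u r \<bullet> h r) has_integral u b \<bullet> v b - u a \<bullet> v a) {a..b}"
proof -
  \<comment> \<open>Polarization: 4 u . v = |u + v|^2 - |u - v|^2, with the sum written as u - (0 -
    v) so that the rule for differences applies.\<close>
  have "weak_deriv a b (\<lambda>r. u r - (0 - v r)) (\<lambda>r. g r - (0 - h r))"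
    by (intro weak_deriv_diff u v weak_deriv_const)
  from has_integral_diff[OF weak_deriv_energy[OF this \<open>a \<le> b\<close>] weak_deriv_energy[OF weak_deriv_diff[OF u v] \<open>a \<le> b\<close>]]
  have "((\<lambda>r. 4 *\<^sub>R (g r \<bullet> v r + u r \<bullet> h r)) has_integral 4 *\<^sub>R (u b \<bullet> v b - u a \<bullet> v a)) {a..b}"
    by (simp add: power2_norm_eq_inner algebra_simps inner_commute)
  from has_integral_cmul[OF this, of "1/4"] show ?thesis by (simp add: add_divide_distrib diff_divide_distrib)
qed

lemma weak_deriv_Pair:
  assumes 1: "weak_deriv a b u g" and 2: "weak_deriv a b u' g'"
  shows "weak_deriv a b (\<lambda>r. (u r, u' r)) (\<lambda>r. (g r, g' r))"
proof -
  obtain m N where m: "m integrable_on {a..b}" "negligible N" "\<And>r. r \<in> {a..b} - N \<Longrightarrow> norm (g r) \<le> m r"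
    using 1 unfolding weak_deriv_def by blast
  obtain m' N' where m': "m' integrable_on {a..b}" "negligible N'" "\<And>r. r \<in> {a..b} - N' \<Longrightarrow> norm (g' r) \<le> m' r"
    using 2 unfolding weak_deriv_def by blast
  have "norm (g r, g' r) \<le> m r + m' r" if "r \<in> {a..b} - (N \<union> N')" for r
    using m(3)[of r] m'(3)[of r] that norm_Pair_le[of "g r" "g' r"] by auto
  moreover have "(\<lambda>r. m r + m' r) integrable_on {a..b}" using m m' by (intro integrable_add)
  moreover have "negligible (N \<union> N')" using m m' by (intro negligible_Un)
  moreover have "continuous_on {a..b} (\<lambda>r. (u r, u' r))"
    by (intro continuous_intros weak_deriv_continuous[OF 1] weak_deriv_continuous[OF 2])
  moreover have "((\<lambda>r. (g r, g' r) \<bullet> v) has_integral ((u t, u' t) - (u s, u' s)) \<bullet> v) {s..t}"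
    if "a \<le> s" "s \<le> t" "t \<le> b" for v s t
    using has_integral_add[OF weak_deriv_has_integral[OF 1 that, of "fst v"] weak_deriv_has_integral[OF 2 that, of "snd v"]]
    by (cases v) simp
  ultimately show ?thesis unfolding weak_deriv_def by blast
qed

section \<open>An abstract mixed wave equation\<close>

text \<open>For a bounded family, weak convergence need only be tested on a dense set: replacing
  \<open>y\<close> by a nearby \<open>c\<close> changes the pairings by at most the bound times the
  distance.\<close>

lemma tendsto_inner_closure:
  fixes z :: "'b \<Rightarrow> 'a::real_inner"
  assumes C: "\<And>c. c \<in> C \<Longrightarrow> ((\<lambda>x. z x \<bullet> c) \<longlongrightarrow> z0 \<bullet> c) F"
    and M: "\<forall>\<^sub>F x in F. norm (z x) \<le> M" and y: "y \<in> closure C"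
  shows "((\<lambda>x. z x \<bullet> y) \<longlongrightarrow> z0 \<bullet> y) F"
proof (rule tendstoI)
  fix e :: real assume "e > 0"
  define L where "L = \<bar>M\<bar> + norm z0 + 1"
  have L: "L > 0" by (simp add: L_def add_nonneg_pos)
  obtain c where c: "c \<in> C" "dist c y < e / (2 * L)"
    using y \<open>e > 0\<close> L unfolding closure_approachable by (metis divide_pos_pos mult_pos_pos zero_less_numeral)
  have "\<forall>\<^sub>F x in F. dist (z x \<bullet> c) (z0 \<bullet> c) < e / 2"
    using tendstoD[OF C[OF c(1)], of "e / 2"] \<open>e > 0\<close> by simp
  with M show "\<forall>\<^sub>F x in F. dist (z x \<bullet> y) (z0 \<bullet> y) < e"
  proof eventually_elim
    case (elim x)
    have "\<bar>(z x - z0) \<bullet> (y - c)\<bar> \<le> norm (z x - z0) * norm (y - c)" by (rule Cauchy_Schwarz_ineq2)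
    also have "\<dots> \<le> L * (e / (2 * L))"
    proof (rule mult_mono)
      show "norm (z x - z0) \<le> L" using elim(1) norm_triangle_ineq4[of "z x" z0] by (simp add: L_def)
      show "norm (y - c) \<le> e / (2 * L)" using c(2) by (simp add: dist_norm norm_minus_commute)
    qed (use L in auto)
    also have "\<dots> = e / 2" using L by simp
    finally have "\<bar>(z x - z0) \<bullet> (y - c)\<bar> \<le> e / 2" .
    then have "\<bar>z x \<bullet> y - z0 \<bullet> y - (z x \<bullet> c - z0 \<bullet> c)\<bar> \<le> e / 2"
      by (simp add: inner_diff_left inner_diff_right)
    then show ?case using elim(2) unfolding dist_real_def by linarith
  qed
qed

lemma norm_fst_snd_le: "norm (fst (snd c)) \<le> norm c"
  using norm_fst_le[of "fst (snd c)" "snd (snd c)"] norm_snd_le[of "snd c" "fst c"] by simp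

text \<open>Duality with test vectors that approach \<open>y\<close> itself: the inequality is
  closed in c, and at c = y it reads |y|^2 \<le> K |y|.\<close>

lemma norm_le_by_closure:
  fixes y :: "'a::real_inner"
  assumes "y \<in> closure C" "\<And>c. c \<in> C \<Longrightarrow> y \<bullet> c \<le> K * norm c" "0 \<le> K"
  shows "norm y \<le> K"
proof -
  have "closed {c. y \<bullet> c \<le> K * norm c}"
    by (intro closed_Collect_le continuous_intros)
  then have "closure C \<subseteq> {c. y \<bullet> c \<le> K * norm c}"
    using assms(2) by (intro closure_minimal) auto
  then have "norm y * norm y \<le> K * norm y"
    using assms(1) by (auto simp flip: power2_norm_eq_inner simp: power2_eq_square)
  then show ?thesis using assms(3) by (cases "y = 0") auto
qed

text \<open>A continuous function is the limit of its averages over shrinking intervals.\<close>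

lemma norm_le_of_local_integral_bound:
  fixes q :: "real \<Rightarrow> real"
  assumes q: "continuous_on {0..T} q" and t: "t \<in> {0..T}" and "T > 0" "h0 > 0"
    and L: "\<And>a b. 0 \<le> a \<Longrightarrow> a \<le> b \<Longrightarrow> b \<le> T \<Longrightarrow> b - a \<le> h0 \<Longrightarrow> \<bar>integral {a..b} q\<bar> \<le> L * (b - a)"
  shows "\<bar>q t\<bar> \<le> L"
proof (rule field_le_epsilon)
  fix e :: real assume "e > 0"
  then obtain d where d: "d > 0" "\<And>r. r \<in> {0..T} \<Longrightarrow> dist r t < d \<Longrightarrow> dist (q r) (q t) < e"
    using q t unfolding continuous_on_iff by metis
  define l where "l = min (min d h0) T / 2"
  have l: "l > 0" "l < d" "l < h0" "l \<le> T / 2" using d \<open>T > 0\<close> \<open>h0 > 0\<close> by (auto simp: l_def min_def)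
  \<comment> \<open>Close to \<open>T\<close> the averaging interval extends to the left of
    \<open>t\<close>, otherwise to the right.\<close>
  define a where "a = (if t + l \<le> T then t else t - l)"
  define b where "b = a + l"
  have ab: "0 \<le> a" "b \<le> T" "a < b" "b - a = l" "t \<in> {a..b}"
    using l t by (auto simp: a_def b_def)
  have qi: "q integrable_on {a..b}"
    by (rule integrable_continuous_interval) (use ab in \<open>auto intro: continuous_on_subset[OF q]\<close>)
  have "norm (integral {a..b} (\<lambda>r. q r - q t)) \<le> e * (b - a)"
  proof (rule integral_bound)
    fix r assume r: "r \<in> {a..b}"
    then have "dist r t < d" using ab l by (auto simp: dist_real_def)
    then show "norm (q r - q t) \<le> e" using d(2)[of r] r ab by (auto simp: dist_real_def)
  qed (use ab in \<open>auto intro!: continuous_intros continuous_on_subset[OF q]\<close>)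
  moreover have "integral {a..b} (\<lambda>r. q r - q t) = integral {a..b} q - q t * (b - a)"
    using qi ab by (subst Henstock_Kurzweil_Integration.integral_diff) auto
  moreover have "\<bar>integral {a..b} q\<bar> \<le> L * (b - a)" using ab l by (intro L) auto
  ultimately have "\<bar>q t * (b - a)\<bar> \<le> (L + e) * (b - a)"
    by (simp add: algebra_simps abs_le_iff)
  then have "\<bar>q t\<bar> * (b - a) \<le> (L + e) * (b - a)" using ab by (simp add: abs_mult)
  then show "\<bar>q t\<bar> \<le> L + e" using ab by simp
qed

text \<open>\<open>\<Gamma>1\<close> and \<open>\<Gamma>2\<close> are the graphs of \<open>d\<close> on \<open>H\<^sub>0\<Lambda>\<^sup>k\<^sup>-\<^sup>1\<close> and \<open>H\<^sub>0\<Lambda>\<^sup>k\<close>, \<open>V1\<close>, \<open>V2\<close>, \<open>V3\<close> the \<open>L\<^sup>2\<close> spaces and \<open>C1\<close>, \<open>C2\<close>, \<open>C3\<close>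
  the compactly supported smooth forms of degrees \<open>k - 1\<close>, \<open>k\<close>, \<open>k + 1\<close>; \<open>\<delta>m\<close> and \<open>\<delta>w\<close> are coderivatives in
  the sense of distributions only.\<close>

locale mixed_wave =
  fixes T :: real and \<Gamma>1 \<Gamma>2 :: "('a::real_inner \<times> 'a) set" and D3 V1 V2 V3 C1 C2 C3 :: "'a set"
    and s m w ds dm \<delta>m \<delta>w s' m' w' f :: "real \<Rightarrow> 'a" and N :: "real set"
  assumes T: "T > 0"
    and sub\<Gamma>1: "subspace \<Gamma>1" and sub\<Gamma>2: "subspace \<Gamma>2" and subD3: "subspace D3" and subV2: "subspace V2"
    and \<Gamma>1_V: "\<And>x y. (x, y) \<in> \<Gamma>1 \<Longrightarrow> x \<in> V1" and \<Gamma>2_V: "\<And>x y. (x, y) \<in> \<Gamma>2 \<Longrightarrow> x \<in> V2"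
    and \<Gamma>_complex: "\<And>x y. (x, y) \<in> \<Gamma>1 \<Longrightarrow> (y, 0) \<in> \<Gamma>2"
    and C3_D3: "C3 \<subseteq> D3"
    and dense: "V1 \<subseteq> closure C1" "V2 \<subseteq> closure C2" "V3 \<subseteq> closure C3"
    and C1: "\<And>c. c \<in> C1 \<Longrightarrow> \<exists>e. (c, e) \<in> \<Gamma>1 \<and> (\<forall>t\<in>{0..T}. \<delta>m t \<bullet> c = m t \<bullet> e)"
    and C2: "\<And>c. c \<in> C2 \<Longrightarrow> \<exists>e. (c, e) \<in> \<Gamma>2 \<and> (\<forall>t\<in>{0..T}. \<delta>w t \<bullet> c = w t \<bullet> e)"
    and C2': "\<And>c. c \<in> C2 \<Longrightarrow> \<exists>e. \<forall>x y. (x, y) \<in> \<Gamma>1 \<longrightarrow> y \<bullet> c = x \<bullet> e"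
    and C3: "\<And>c. c \<in> C3 \<Longrightarrow> \<exists>e. \<forall>x y. (x, y) \<in> \<Gamma>2 \<longrightarrow> y \<bullet> c = x \<bullet> e"
    and sD: "\<And>t. t \<in> {0..T} \<Longrightarrow> (s t, ds t) \<in> \<Gamma>1"
    and mD: "\<And>t. t \<in> {0..T} \<Longrightarrow> (m t, dm t) \<in> \<Gamma>2"
    and wD: "\<And>t. t \<in> {0..T} \<Longrightarrow> w t \<in> D3"
    and in_V: "\<And>t. t \<in> {0..T} \<Longrightarrow> ds t \<in> V2" "\<And>t. t \<in> {0..T} \<Longrightarrow> dm t \<in> V3"
      "\<And>t. t \<in> {0..T} \<Longrightarrow> \<delta>m t \<in> V1" "\<And>t. t \<in> {0..T} \<Longrightarrow> \<delta>w t \<in> V2"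
    and s': "weak_deriv 0 T s s'" and m': "weak_deriv 0 T m m'" and w': "weak_deriv 0 T w w'"
    and N: "negligible N"
    and eq1: "\<And>t x y. t \<in> {0..T} - N \<Longrightarrow> (x, y) \<in> \<Gamma>1 \<Longrightarrow> s' t \<bullet> x = y \<bullet> m t"
    and eq2: "\<And>t x y. t \<in> {0..T} - N \<Longrightarrow> (x, y) \<in> \<Gamma>2 \<Longrightarrow> m' t \<bullet> x + ds t \<bullet> x + w t \<bullet> y = f t \<bullet> x"
    and eq3: "\<And>t x. t \<in> {0..T} - N \<Longrightarrow> x \<in> D3 \<Longrightarrow> w' t \<bullet> x = dm t \<bullet> x"
begin

definition U :: "real \<Rightarrow> 'a \<times> 'a \<times> 'a" where "U t = (s t, m t, w t)"
definition U' :: "real \<Rightarrow> 'a \<times> 'a \<times> 'a" where "U' t = (s' t, m' t, w' t)"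
text \<open>A u with coderivatives in the sense of distributions; until \<open>green\<close> is
  known, these are tied to \<open>m\<close> and \<open>w\<close> only through compactly supported
  forms.\<close>

definition Y :: "real \<Rightarrow> 'a \<times> 'a \<times> 'a" where "Y t = (\<delta>m t, - ds t - \<delta>w t, dm t)"

text \<open>Green's formula for the solution at time \<open>t\<close>, not only against compactly supported forms.\<close>

definition green :: "real \<Rightarrow> bool" where
  "green t \<longleftrightarrow> (\<forall>x y. (x, y) \<in> \<Gamma>1 \<longrightarrow> y \<bullet> m t = x \<bullet> \<delta>m t) \<and> (\<forall>x y. (x, y) \<in> \<Gamma>2 \<longrightarrow> y \<bullet> w t = x \<bullet> \<delta>w t)"

definition H :: "real \<Rightarrow> real" where
  "H t = sqrt ((norm (ds t))\<^sup>2 + (norm (dm t))\<^sup>2 + (norm (\<delta>m t))\<^sup>2 + (norm (\<delta>w t))\<^sup>2)"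

lemma U_deriv: "weak_deriv 0 T U U'"
  unfolding U_def[abs_def] U'_def[abs_def] by (intro weak_deriv_Pair s' m' w')

lemma norm_U: "norm (U t) = sqrt ((norm (s t))\<^sup>2 + (norm (m t))\<^sup>2 + (norm (w t))\<^sup>2)"
  by (simp add: U_def norm_Pair add.assoc)

text \<open>Skew symmetry: when each equation is tested with its own unknown, ds . m and w . dm each
  occur twice with opposite signs and only f . m remains. Since |f . m| is bounded, not just f . m,
  the estimate runs in both directions of time.\<close>

lemma energy_bound:
  assumes c: "c integrable_on {0..T}" "\<And>r. r \<in> {0..T} \<Longrightarrow> 0 \<le> c r"
    and M: "negligible M" "\<And>r. r \<in> {0..T} - M \<Longrightarrow> norm (f r) \<le> c r"
    and "a \<in> {0..T}" "b \<in> {0..T}"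
  shows "norm (U b) \<le> norm (U a) + integral {min a b..max a b} c"
proof (rule weak_deriv_norm_le[OF U_deriv \<open>a \<in> _\<close> \<open>b \<in> _\<close> c])
  show "negligible (M \<union> N)" using M N by (intro negligible_Un)
  fix r assume r: "r \<in> {0..T} - (M \<union> N)"
  have "U' r \<bullet> U r = f r \<bullet> m r"
    using eq1[of r "s r" "ds r"] eq2[of r "m r" "dm r"] eq3[of r "w r"] sD[of r] mD[of r] wD[of r] r
    by (simp add: U_def U'_def inner_commute)
  also have "\<bar>\<dots>\<bar> \<le> norm (f r) * norm (m r)" by (rule Cauchy_Schwarz_ineq2)
  also have "\<dots> \<le> c r * norm (U r)"
  proof (rule mult_mono)
    show "norm (m r) \<le> norm (U r)"
      unfolding norm_U by (rule real_le_rsqrt) auto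
  qed (use M r c in auto)
  finally show "\<bar>U' r \<bullet> U r\<bar> \<le> c r * norm (U r)" .
qed auto

text \<open>The equation is available for all of \<Gamma>1, the defining property of
  \<open>\<delta>m t\<close> only for test forms. On these they agree, so the residual
  \<open>s' t - \<delta>m t\<close> is orthogonal to \<open>C1\<close> and by density to
  \<open>V1\<close>; hence the equation for a general pair is Green's formula. The second half has
  the residual \<open>m' t + ds t - f t + \<delta>w t\<close>.\<close>

lemma green_AE:
  assumes t: "t \<in> {0..T} - N"
  shows "green t"
proof -
  have ortho: "x \<bullet> z = 0" if "\<And>c. c \<in> C \<Longrightarrow> c \<bullet> z = 0" "x \<in> closure C" for x z :: 'a and C
  proof -
    have "closed {c. c \<bullet> z = 0}" by (intro closed_Collect_eq continuous_intros)
    then have "closure C \<subseteq> {c. c \<bullet> z = 0}" using that by (intro closure_minimal) auto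
    then show ?thesis using that by auto
  qed
  have 1: "c \<bullet> (s' t - \<delta>m t) = 0" if "c \<in> C1" for c
    using C1[OF that] eq1[OF t, of c] t by (force simp: inner_diff_right inner_commute)
  have 2: "c \<bullet> (m' t + ds t - f t + \<delta>w t) = 0" if "c \<in> C2" for c
    using C2[OF that] eq2[OF t, of c] t by (force simp: inner_diff_right inner_add_right inner_commute)
  show ?thesis unfolding green_def
  proof (intro conjI allI impI)
    fix x y assume xy: "(x, y) \<in> \<Gamma>1"
    then have "x \<bullet> (s' t - \<delta>m t) = 0"
      using dense(1) \<Gamma>1_V by (intro ortho[OF 1]) auto
    then show "y \<bullet> m t = x \<bullet> \<delta>m t"
      using eq1[OF t xy] by (simp add: inner_diff_right inner_commute)
  next
    fix x y assume xy: "(x, y) \<in> \<Gamma>2"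
    then have "x \<bullet> (m' t + ds t - f t + \<delta>w t) = 0"
      using dense(2) \<Gamma>2_V by (intro ortho[OF 2]) auto
    then show "y \<bullet> w t = x \<bullet> \<delta>w t"
      using eq2[OF t xy] by (simp add: inner_diff_right inner_add_right inner_commute)
  qed
qed

lemma green_H:
  assumes "green t" "t \<in> {0..T}"
  shows "norm (Y t) = H t"
proof -
  \<comment> \<open>Green's formula for the pair (d\<sigma>, 0), which lies in the graph because d d
    = 0; it says that the two parts of the middle component are orthogonal.\<close>
  have "0 \<bullet> w t = ds t \<bullet> \<delta>w t"
    using assms \<Gamma>_complex[OF sD[OF assms(2)]] unfolding green_def by blast
  then have "(norm (- ds t - \<delta>w t))\<^sup>2 = (norm (ds t))\<^sup>2 + (norm (\<delta>w t))\<^sup>2"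
    by (simp add: power2_norm_eq_inner inner_diff_right inner_diff_left inner_commute)
  then show ?thesis by (simp add: H_def Y_def norm_Pair algebra_simps)
qed

text \<open>All derivatives are moved onto the test form, so the pairing with \<open>Y\<close> is a
  continuous function of time that is meaningful at every t, while \<open>U'\<close> is known only
  almost everywhere. This is the bridge from estimates for \<open>U\<close> to pointwise estimates
  for \<open>Y\<close>.\<close>

lemma Y_test:
  assumes "c \<in> C1 \<times> C2 \<times> C3"
  obtains q where "continuous_on {0..T} q" "\<And>t. t \<in> {0..T} \<Longrightarrow> Y t \<bullet> c = q t"
    "\<And>t. t \<in> {0..T} - N \<Longrightarrow> U' t \<bullet> c = q t + f t \<bullet> fst (snd c)"
proof -
  obtain c1 c2 c3 where c: "c = (c1, c2, c3)" "c1 \<in> C1" "c2 \<in> C2" "c3 \<in> C3" using assms by auto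
  obtain e1 where e1: "(c1, e1) \<in> \<Gamma>1" "\<And>t. t \<in> {0..T} \<Longrightarrow> \<delta>m t \<bullet> c1 = m t \<bullet> e1" using C1[OF c(2)] by blast
  obtain e2 where e2: "(c2, e2) \<in> \<Gamma>2" "\<And>t. t \<in> {0..T} \<Longrightarrow> \<delta>w t \<bullet> c2 = w t \<bullet> e2" using C2[OF c(3)] by blast
  obtain e2' where e2': "\<And>x y. (x, y) \<in> \<Gamma>1 \<Longrightarrow> y \<bullet> c2 = x \<bullet> e2'" using C2'[OF c(3)] by blast
  obtain e3 where e3: "\<And>x y. (x, y) \<in> \<Gamma>2 \<Longrightarrow> y \<bullet> c3 = x \<bullet> e3" using C3[OF c(4)] by blast
  define q where "q t = m t \<bullet> e1 - s t \<bullet> e2' - w t \<bullet> e2 + m t \<bullet> e3" for t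
  show thesis
  proof
    show "continuous_on {0..T} q" unfolding q_def
      by (intro continuous_intros weak_deriv_continuous[OF s'] weak_deriv_continuous[OF m'] weak_deriv_continuous[OF w'])
    show "Y t \<bullet> c = q t" if t: "t \<in> {0..T}" for t
      using e1(2)[OF t] e2(2)[OF t] e2'[OF sD[OF t]] e3[OF mD[OF t]]
      by (simp add: Y_def c q_def inner_diff_left)
    show "U' t \<bullet> c = q t + f t \<bullet> fst (snd c)" if t: "t \<in> {0..T} - N" for t
    proof -
      have "U' t \<bullet> c = s' t \<bullet> c1 + m' t \<bullet> c2 + w' t \<bullet> c3"
        by (simp add: U'_def c)
      also have "\<dots> = e1 \<bullet> m t + (f t \<bullet> c2 - ds t \<bullet> c2 - w t \<bullet> e2) + dm t \<bullet> c3"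
        using eq1[OF t e1(1)] eq2[OF t e2(1)] eq3[OF t, of c3] c(4) C3_D3 by auto
      also have "\<dots> = q t + f t \<bullet> c2"
        using t e2'[OF sD, of t] e3[OF mD, of t] by (simp add: q_def inner_commute)
      finally show ?thesis by (simp add: c)
    qed
  qed
qed

lemma Y_closure: "t \<in> {0..T} \<Longrightarrow> Y t \<in> closure (C1 \<times> C2 \<times> C3)"
  using dense in_V[of t] subspace_diff[OF subV2 subspace_neg[OF subV2], of "ds t" "\<delta>w t"]
  by (auto simp: Y_def closure_Times)

end

section \<open>Difference quotients for a source with integrable time derivative\<close>

text \<open>The source has no values at single times, so its initial value enters only as a constant
  \<open>c\<close>, which like its exceptional set depends on \<open>v\<close>. The bounds
  \<open>F\<close> and \<open>g\<close> hold off one common null set.\<close>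

locale mixed_wave_W11 = mixed_wave T \<Gamma>1 \<Gamma>2 D3 V1 V2 V3 C1 C2 C3 s m w ds dm \<delta>m \<delta>w s' m' w' f N
  for T :: real and \<Gamma>1 \<Gamma>2 :: "('a::real_inner \<times> 'a) set" and D3 V1 V2 V3 C1 C2 C3 :: "'a set"
    and s m w ds dm \<delta>m \<delta>w s' m' w' f :: "real \<Rightarrow> 'a" and N :: "real set" +
  fixes f' :: "real \<Rightarrow> 'a" and F :: real and g :: "real \<Rightarrow> real" and M :: "real set"
  assumes F: "0 \<le> F" and M: "negligible M"
    and f_le: "\<And>r. r \<in> {0..T} - M \<Longrightarrow> norm (f r) \<le> F"
    and f'_le: "\<And>r. r \<in> {0..T} - M \<Longrightarrow> norm (f' r) \<le> g r"
    and g: "g integrable_on {0..T}" "\<And>r. r \<in> {0..T} \<Longrightarrow> 0 \<le> g r"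
    and f': "\<And>v. \<exists>c M. negligible M \<and> (\<forall>r\<in>{0..T} - M. ((\<lambda>x. f' x \<bullet> v) has_integral (f r \<bullet> v - c)) {0..r})"
begin

text \<open>The difference U - U(a) solves the same equation with the additional constant source A
  u(a). Green's formula at time \<open>a\<close> is exactly what is needed to take d off the varying
  part and put a coderivative on u(a).\<close>

lemma increment_bound:
  assumes a: "a \<in> {0..T}" "green a" and t: "t \<in> {0..T}"
  shows "norm (U t - U a) \<le> (norm (Y a) + F) * \<bar>t - a\<bar>"
proof -
  have wd: "weak_deriv 0 T (\<lambda>r. U r - U a) (\<lambda>r. U' r - 0)"
    by (intro weak_deriv_diff U_deriv weak_deriv_const)
  have "norm (U t - U a) \<le> norm (U a - U a) + integral {min a t..max a t} (\<lambda>r. norm (Y a) + F)"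
  proof (rule weak_deriv_norm_le[OF wd a(1) t])
    show "negligible (M \<union> N)" using M N by (intro negligible_Un)
    fix r assume r: "r \<in> {0..T} - (M \<union> N)"
    define x v p where "x = s r - s a" and "v = m r - m a" and "p = w r - w a"
    define dx dv where "dx = ds r - ds a" and "dv = dm r - dm a"
    have g1: "(x, dx) \<in> \<Gamma>1"
      using subspace_diff[OF sub\<Gamma>1 sD[of r] sD[of a]] r a by (simp add: x_def dx_def)
    have g2: "(v, dv) \<in> \<Gamma>2"
      using subspace_diff[OF sub\<Gamma>2 mD[of r] mD[of a]] r a by (simp add: v_def dv_def)
    have g3: "p \<in> D3" using subspace_diff[OF subD3 wD[of r] wD[of a]] r a by (simp add: p_def)
    have *: "dx \<bullet> m a = x \<bullet> \<delta>m a" "dv \<bullet> w a = v \<bullet> \<delta>w a"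
      using a(2) g1 g2 unfolding green_def by blast+
    have r': "r \<in> {0..T} - N" using r by auto
    have "(U' r - 0) \<bullet> (U r - U a) = s' r \<bullet> x + m' r \<bullet> v + w' r \<bullet> p"
      by (simp add: U_def U'_def x_def v_def p_def)
    also have "\<dots> = dx \<bullet> m r + (f r \<bullet> v - ds r \<bullet> v - w r \<bullet> dv) + dm r \<bullet> p"
      using eq1[OF r' g1] eq2[OF r' g2] eq3[OF r' g3] by simp
    also have "\<dots> = (dx \<bullet> v + dx \<bullet> m a) + (f r \<bullet> v - (dx \<bullet> v + ds a \<bullet> v) - (p \<bullet> dv + w a \<bullet> dv)) + (dv \<bullet> p + dm a \<bullet> p)"
      by (simp add: v_def p_def dx_def dv_def inner_diff_left inner_diff_right)
    \<comment> \<open>The products dx . v and p . dv cancel by skew symmetry; Green's formula at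
      \<open>a\<close> rewrites the two remaining terms.\<close>
    also have "\<dots> = \<delta>m a \<bullet> x + (f r \<bullet> v + (- ds a - \<delta>w a) \<bullet> v) + dm a \<bullet> p"
      using * by (simp add: inner_commute inner_diff_left inner_diff_right)
    also have "\<dots> = (Y a + (0, f r, 0)) \<bullet> (U r - U a)"
      by (simp add: Y_def U_def x_def v_def p_def inner_add_left)
    finally have "\<bar>(U' r - 0) \<bullet> (U r - U a)\<bar> \<le> norm (Y a + (0, f r, 0)) * norm (U r - U a)"
      by (simp add: Cauchy_Schwarz_ineq2)
    also have "norm (Y a + (0, f r, 0)) \<le> norm (Y a) + F"
      using norm_triangle_ineq[of "Y a" "(0, f r, 0)"] f_le[of r] r by (simp add: norm_Pair)
    finally show "\<bar>(U' r - 0) \<bullet> (U r - U a)\<bar> \<le> (norm (Y a) + F) * norm (U r - U a)"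
      by (simp add: mult_right_mono)
  qed (use F in auto)
  also have "\<dots> = (norm (Y a) + F) * \<bar>t - a\<bar>" by (auto simp: min_def max_def)
  finally show ?thesis .
qed

text \<open>\<open>Y\<close> is \<open>U'\<close> minus the source, so a Lipschitz constant
  \<open>K\<close> of \<open>U\<close> at small scales controls its averages by K + F, and
  continuity in time of the tested quantity removes the averaging.\<close>

lemma Y_bound:
  assumes t: "t \<in> {0..T}" and "h0 > 0" "0 \<le> K"
    and K: "\<And>a b. 0 \<le> a \<Longrightarrow> a \<le> b \<Longrightarrow> b \<le> T \<Longrightarrow> b - a \<le> h0 \<Longrightarrow> norm (U b - U a) \<le> K * (b - a)"
  shows "norm (Y t) \<le> K + F"
proof (rule norm_le_by_closure[OF Y_closure[OF t]])
  fix c assume "c \<in> C1 \<times> C2 \<times> C3"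
  then obtain q where q: "continuous_on {0..T} q" "\<And>t. t \<in> {0..T} \<Longrightarrow> Y t \<bullet> c = q t"
    "\<And>t. t \<in> {0..T} - N \<Longrightarrow> U' t \<bullet> c = q t + f t \<bullet> fst (snd c)" using Y_test by blast
  have "\<bar>integral {a..b} q\<bar> \<le> ((K + F) * norm c) * (b - a)" if ab: "0 \<le> a" "a \<le> b" "b \<le> T" "b - a \<le> h0" for a b
  proof -
    have qi: "q integrable_on {a..b}"
      by (rule integrable_continuous_interval) (use ab in \<open>auto intro: continuous_on_subset[OF q(1)]\<close>)
    \<comment> \<open>Off N \<union> M this is the pairing of the source with the middle component
      of \<open>c\<close>; on the null set it is put to 0 so that the bound holds at every
      point.\<close>
    define d where "d r = (if r \<in> N \<union> M then 0 else U' r \<bullet> c - q r)" for r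
    have "((\<lambda>r. U' r \<bullet> c - q r) has_integral (U b - U a) \<bullet> c - integral {a..b} q) {a..b}"
      by (intro has_integral_diff weak_deriv_has_integral[OF U_deriv] integrable_integral qi ab)
    then have "(d has_integral (U b - U a) \<bullet> c - integral {a..b} q) {a..b}"
      by (rule has_integral_spike[of "N \<union> M", rotated 2]) (use N M in \<open>auto simp: d_def\<close>)
    moreover have "norm (d r) \<le> F * norm c" if "r \<in> {a..b}" for r
    proof (cases "r \<in> N \<union> M")
      case False
      then have "d r = f r \<bullet> fst (snd c)" using q(3)[of r] that ab by (simp add: d_def)
      moreover have "\<bar>f r \<bullet> fst (snd c)\<bar> \<le> norm (f r) * norm (fst (snd c))" by (rule Cauchy_Schwarz_ineq2)
      moreover have "norm (f r) * norm (fst (snd c)) \<le> F * norm c"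
        using f_le[of r] False that ab norm_fst_snd_le[of c] F
        by (intro mult_mono) auto
      ultimately show ?thesis by simp
    qed (use F in \<open>auto simp: d_def\<close>)
    ultimately have "norm ((U b - U a) \<bullet> c - integral {a..b} q) \<le> F * norm c * (b - a)"
      using has_integral_bound[of "F * norm c" d _ a b] F ab by simp
    moreover have "\<bar>(U b - U a) \<bullet> c\<bar> \<le> K * (b - a) * norm c"
      using Cauchy_Schwarz_ineq2[of "U b - U a" c] K[OF ab] mult_right_mono[OF K[OF ab], of "norm c"] by simp
    ultimately show ?thesis by (simp add: algebra_simps abs_le_iff)
  qed
  then have "\<bar>q t\<bar> \<le> (K + F) * norm c"
    by (intro norm_le_of_local_integral_bound[OF q(1) t T \<open>h0 > 0\<close>]) auto
  then show "Y t \<bullet> c \<le> (K + F) * norm c" using q(2)[OF t] by simp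
qed (use F \<open>0 \<le> K\<close> in auto)

text \<open>The null set off which \<open>\<langle>f(r + h) - f(r), v\<rangle>\<close> is the integral of \<open>\<langle>f', v\<rangle>\<close> depends on \<open>v\<close>; it is enough to use
  the countably many \<open>v = m(q + h) - m(q)\<close> with \<open>q\<close> rational, by continuity of \<open>m\<close>.\<close>

lemma translation_bound:
  assumes h: "0 \<le> h" and a: "a \<in> {0..T - h}" and b: "b \<in> {0..T - h}"
  shows "norm (U (b + h) - U b) \<le> norm (U (a + h) - U a) + h * integral {0..T} g"
proof -
  \<comment> \<open>With a primitive of \<open>g\<close>, its integral over [r, r + h] becomes G(r +
    h) - G(r), a continuous function of r that can serve as the growth rate.\<close>
  define G where "G r = integral {0..r} g" for r
  have gi: "g integrable_on {x..y}" if "0 \<le> x" "y \<le> T" for x y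
    using g(1) by (rule integrable_on_subinterval) (use that in auto)
  have G_diff: "G y - G x = integral {x..y} g" if "0 \<le> x" "x \<le> y" "y \<le> T" for x y
  proof -
    have "integral {0..x} g + integral {x..y} g = integral {0..y} g"
      using that by (intro Henstock_Kurzweil_Integration.integral_combine gi) auto
    then show ?thesis by (simp add: G_def)
  qed
  have G_mono: "G x \<le> G y" if "0 \<le> x" "x \<le> y" "y \<le> T" for x y
    using G_diff[OF that] integral_nonneg[OF gi, of x y] g(2) that by auto
  have Gc: "continuous_on {0..T} G"
    unfolding G_def by (rule indefinite_integral_continuous_1[OF g(1)])
  have "weak_deriv (0 - h) (T - h) (\<lambda>r. U (r + h)) (\<lambda>r. U' (r + h))"
    by (rule weak_deriv_shift[OF U_deriv])
  then have "weak_deriv 0 (T - h) (\<lambda>r. U (r + h)) (\<lambda>r. U' (r + h))"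
    by (rule weak_deriv_subinterval) (use h in auto)
  moreover have "weak_deriv 0 (T - h) U U'"
    by (rule weak_deriv_subinterval[OF U_deriv]) (use h in auto)
  ultimately have wd: "weak_deriv 0 (T - h) (\<lambda>r. U (r + h) - U r) (\<lambda>r. U' (r + h) - U' r)"
    by (rule weak_deriv_diff)
  have "\<forall>v. \<exists>c M. negligible M \<and> (\<forall>r\<in>{0..T} - M. ((\<lambda>x. f' x \<bullet> v) has_integral (f r \<bullet> v - c)) {0..r})"
    using f' by blast
  then obtain C L where L: "\<And>v. negligible (L v)"
    "\<And>v r. r \<in> {0..T} - L v \<Longrightarrow> ((\<lambda>x. f' x \<bullet> v) has_integral (f r \<bullet> v - C v)) {0..r}"
    by (metis (no_types))
  define Q where "Q = {0<..<T - h} \<inter> \<rat>"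
  define v where "v r = m (r + h) - m r" for r
  have mc: "continuous_on {0..T-h} v"
    unfolding v_def
    by (intro continuous_intros continuous_on_compose2[OF weak_deriv_continuous[OF m']]
       continuous_on_subset[OF weak_deriv_continuous[OF m']]) (use h in auto)
  \<comment> \<open>The equations and the integral formula are used at r and at r + h, hence the
    translates by -h.\<close>
  define M' where "M' = N \<union> (+) (-h) ` N \<union> (\<Union>q\<in>Q. L (v q) \<union> (+) (-h) ` L (v q))"
  have "countable Q" unfolding Q_def by (auto intro: countable_rat countable_subset[OF _ countable_rat])
  then have M'n: "negligible M'"
  proof -
    have "negligible (L x \<union> (+) (-h) ` L x)" for x
      by (intro negligible_Un negligible_translation L)
    with \<open>countable Q\<close> N show ?thesis
    unfolding M'_def
    by (intro negligible_Un negligible_translation N negligible_countable_Union countable_image) blast+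
  qed
  have f_diff: "\<bar>(f (r + h) - f r) \<bullet> v r\<bar> \<le> (G (r + h) - G r) * norm (v r)" if r: "r \<in> {0<..<T-h} - M'" for r
  proof -
    have "\<bar>(f (r + h) - f r) \<bullet> v q\<bar> \<le> (G (r + h) - G r) * norm (v q)" if q: "q \<in> Q" for q
    proof -
      have "r \<notin> L (v q)" "r + h \<notin> L (v q)" using r q by (force simp: M'_def)+
      then have 1: "((\<lambda>x. f' x \<bullet> v q) has_integral (f r \<bullet> v q - C (v q))) {0..r}"
        and 2: "((\<lambda>x. f' x \<bullet> v q) has_integral (f (r + h) \<bullet> v q - C (v q))) {0..r + h}"
        using r h by (auto intro!: L(2))
      have i3: "(\<lambda>x. f' x \<bullet> v q) integrable_on {r..r+h}"
        by (rule integrable_on_subinterval[OF has_integral_integrable[OF 2]]) (use r in auto)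
      have "integral {0..r} (\<lambda>x. f' x \<bullet> v q) + integral {r..r+h} (\<lambda>x. f' x \<bullet> v q) = integral {0..r+h} (\<lambda>x. f' x \<bullet> v q)"
        using r h by (intro Henstock_Kurzweil_Integration.integral_combine has_integral_integrable[OF 2]) auto
      then have 3: "integral {r..r+h} (\<lambda>x. f' x \<bullet> v q) = (f (r + h) - f r) \<bullet> v q"
        using integral_unique[OF 1] integral_unique[OF 2] by (simp add: inner_diff_left)
      define k where "k x = (if x \<in> M then 0 else f' x \<bullet> v q)" for x
      have "integral {r..r+h} k = integral {r..r+h} (\<lambda>x. f' x \<bullet> v q)"
        by (rule integral_spike[OF M]) (auto simp: k_def)
      moreover have "norm (integral {r..r+h} k) \<le> integral {r..r+h} (\<lambda>x. g x * norm (v q))"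
      proof (rule integral_norm_bound_integral)
        show "k integrable_on {r..r+h}"
          using i3 M by (rule integrable_spike) (auto simp: k_def)
        show "(\<lambda>x. g x * norm (v q)) integrable_on {r..r+h}"
          using r by (intro integrable_on_mult_left gi) auto
        fix x assume x: "x \<in> {r..r+h}"
        have "norm (f' x) * norm (v q) \<le> g x * norm (v q)" if "x \<notin> M"
          using f'_le[of x] x r that by (intro mult_right_mono) auto
        then show "norm (k x) \<le> g x * norm (v q)"
          using Cauchy_Schwarz_ineq2[of "f' x" "v q"] g(2)[of x] x r by (auto simp: k_def)
      qed
      ultimately show ?thesis using 3 G_diff[of r "r + h"] r h by simp
    qed
    then have *: "0 \<le> (G (r + h) - G r) * norm (v q) - \<bar>(f (r + h) - f r) \<bullet> v q\<bar>" if "q \<in> Q" for q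
      using that by (simp add: algebra_simps)
    have cl: "closure Q = closure {0<..<T-h}"
      unfolding Q_def by (rule closure_open_Int_superset) (auto simp: Rats_closure_real)
    also have "\<dots> = {0..T-h}" using r by (intro closure_greaterThanLessThan) auto
    finally have cl: "closure Q = {0..T-h}" .
    have "0 \<le> (G (r + h) - G r) * norm (v r) - \<bar>(f (r + h) - f r) \<bullet> v r\<bar>"
      by (rule continuous_ge_on_closure[OF _ _ *, of Q])
        (use r in \<open>auto simp: cl intro!: continuous_intros mc\<close>)
    then show ?thesis by simp
  qed
  have ci: "(\<lambda>r. G (r + h) - G r) integrable_on {0..T-h}"
    by (intro integrable_continuous_interval continuous_intros continuous_on_compose2[OF Gc] continuous_on_subset[OF Gc])
      (use h in auto)
  have "norm (U (b + h) - U b) \<le> norm (U (a + h) - U a) + integral {min a b..max a b} (\<lambda>r. G (r + h) - G r)"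
  proof (rule weak_deriv_norm_le[OF wd a b ci, of "insert 0 (insert (T - h) M')"])
    show "negligible (insert 0 (insert (T - h) M'))" using M'n by simp
    fix r assume r: "r \<in> {0..T-h} - insert 0 (insert (T-h) M')"
    then have nN: "r \<in> {0..T} - N" "r + h \<in> {0..T} - N" using h by (force simp: M'_def)+
    then have rT: "r \<in> {0..T}" "r + h \<in> {0..T}" by auto
    have g1: "(s (r + h) - s r, ds (r + h) - ds r) \<in> \<Gamma>1"
      using subspace_diff[OF sub\<Gamma>1 sD[OF rT(2)] sD[OF rT(1)]] by simp
    have g2: "(m (r + h) - m r, dm (r + h) - dm r) \<in> \<Gamma>2"
      using subspace_diff[OF sub\<Gamma>2 mD[OF rT(2)] mD[OF rT(1)]] by simp
    have "(U' (r + h) - U' r) \<bullet> (U (r + h) - U r) = (f (r + h) - f r) \<bullet> v r"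
    proof -
      define x dx dv p where "x = s (r + h) - s r" and "dx = ds (r + h) - ds r"
        and "dv = dm (r + h) - dm r" and "p = w (r + h) - w r"
      have g1: "(x, dx) \<in> \<Gamma>1" and g2: "(v r, dv) \<in> \<Gamma>2" and g3: "p \<in> D3"
        using g1 g2 subspace_diff[OF subD3 wD[OF rT(2)] wD[OF rT(1)]]
        by (simp_all add: x_def dx_def dv_def p_def v_def)
      \<comment> \<open>The increments of the unknowns lie in the domains of d and serve as test
        functions at both times; the terms with d cancel as in the energy identity and the increment
        of the source remains.\<close>
      have "(U' (r + h) - U' r) \<bullet> (U (r + h) - U r)
          = (s' (r + h) \<bullet> x - s' r \<bullet> x) + (m' (r + h) \<bullet> v r - m' r \<bullet> v r) + (w' (r + h) \<bullet> p - w' r \<bullet> p)"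
        by (simp add: U_def U'_def x_def v_def p_def inner_diff_left)
      also have "s' (r + h) \<bullet> x - s' r \<bullet> x = dx \<bullet> v r"
        using eq1[OF nN(1) g1] eq1[OF nN(2) g1] by (simp add: v_def inner_diff_right)
      also have "m' (r + h) \<bullet> v r - m' r \<bullet> v r = (f (r + h) - f r) \<bullet> v r - dx \<bullet> v r - p \<bullet> dv"
        using eq2[OF nN(1) g2] eq2[OF nN(2) g2] by (simp add: dx_def p_def inner_diff_left)
      also have "w' (r + h) \<bullet> p - w' r \<bullet> p = dv \<bullet> p"
        using eq3[OF nN(1) g3] eq3[OF nN(2) g3] by (simp add: dv_def inner_diff_left)
      finally show ?thesis by (simp add: inner_commute)
    qed
    also have "\<bar>\<dots>\<bar> \<le> (G (r + h) - G r) * norm (v r)" using f_diff[of r] r by auto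
    also have "\<dots> \<le> (G (r + h) - G r) * norm (U (r + h) - U r)"
    proof (rule mult_left_mono)
      have "v r = fst (snd (U (r + h) - U r))" by (simp add: v_def U_def)
      then show "norm (v r) \<le> norm (U (r + h) - U r)"
        by (simp only: norm_fst_snd_le)
    qed (use G_mono[of r "r + h"] rT h in auto)
    finally show "\<bar>(U' (r + h) - U' r) \<bullet> (U (r + h) - U r)\<bar> \<le> (G (r + h) - G r) * norm (U (r + h) - U r)" .
  qed (use G_mono h in auto)
  \<comment> \<open>The double integral telescopes: after a shift it is the integral of G over
    [y, y + h] minus that over [x, x + h], and 0 \<le> G \<le> G(T) bounds this by h G(T).\<close>
  also have "integral {min a b..max a b} (\<lambda>r. G (r + h) - G r) \<le> h * integral {0..T} g"
  proof -
    have Gi: "G integrable_on {x..y}" if "0 \<le> x" "y \<le> T" for x y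
      by (rule integrable_continuous_interval) (use that in \<open>auto intro: continuous_on_subset[OF Gc]\<close>)
    define x y where "x = min a b" and "y = max a b"
    have xy: "0 \<le> x" "x \<le> y" "y \<le> T - h" using a b by (auto simp: x_def y_def)
    have "integral {x..y} (\<lambda>r. G (r + h)) = integral {x+h..y+h} G"
      using integral_shift_real_ivl[of "x + h" h "y + h" G] by simp
    moreover have "(\<lambda>r. G (r + h)) integrable_on {x..y}"
      using integrable_shift_real_ivl[OF Gi[of "x + h" "y + h"], of h] xy h by simp
    ultimately have "integral {x..y} (\<lambda>r. G (r + h) - G r) = integral {x+h..y+h} G - integral {x..y} G"
      using xy h by (subst Henstock_Kurzweil_Integration.integral_diff) (auto intro!: Gi)
    moreover have "integral {x..x+h} G + integral {x+h..y+h} G = integral {x..y+h} G"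
      using xy h by (intro Henstock_Kurzweil_Integration.integral_combine Gi) auto
    moreover have "integral {x..y} G + integral {y..y+h} G = integral {x..y+h} G"
      using xy h by (intro Henstock_Kurzweil_Integration.integral_combine Gi) auto
    moreover have "integral {y..y+h} G \<le> integral {y..y+h} (\<lambda>_. G T)"
      using xy h by (intro integral_le Gi) (auto intro!: G_mono)
    moreover have "0 \<le> integral {x..x+h} G"
      using xy h by (intro integral_nonneg Gi) (auto intro!: integral_nonneg gi g(2) simp: G_def)
    moreover have "integral {y..y+h} (\<lambda>_. G T) = h * G T" using h by simp
    ultimately have "integral {x..y} (\<lambda>r. G (r + h) - G r) \<le> h * G T" by linarith
    then show ?thesis unfolding x_def y_def by (simp only: G_def)
  qed
  finally show ?thesis by simp
qed

text \<open>The origin of 2 F: one F comes from \<open>increment_bound\<close> at \<open>a\<close>,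
  the other from \<open>Y_bound\<close>. In between, \<open>translation_bound\<close> carries the
  increment from \<open>a\<close> to any other place.\<close>

lemma Y_le_green:
  assumes a: "a \<in> {0..T}" "green a" and t: "t \<in> {0..T}"
  shows "norm (Y t) \<le> H a + 2 * F + integral {0..T} g"
proof -
  define K where "K = H a + F + integral {0..T} g"
  have "0 \<le> H a" by (simp add: H_def)
  then have "0 \<le> K" using F integral_nonneg[OF g(1)] g(2) by (simp add: K_def)
  have "norm (U y - U x) \<le> K * (y - x)" if xy: "0 \<le> x" "x \<le> y" "y \<le> T" "y - x \<le> T / 2" for x y
  proof -
    define h where "h = y - x"
    \<comment> \<open>Chosen so that \<open>a\<close> is an end point of [p, p + h]. If a > T - h,
      then a - h is not negative because h \<le> T / 2.\<close>
    define p where "p = (if a \<le> T - h then a else a - h)"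
    have h: "0 \<le> h" "h \<le> T / 2" using xy by (auto simp: h_def)
    then have p: "p \<in> {0..T - h}" using a by (auto simp: p_def)
    have "norm (U (p + h) - U p) \<le> (norm (Y a) + F) * h"
    proof (cases "a \<le> T - h")
      case True
      then show ?thesis using increment_bound[OF a, of "a + h"] h a(1) by (simp add: p_def)
    next
      case False
      then show ?thesis using increment_bound[OF a, of "a - h"] h a(1)
        by (simp add: p_def norm_minus_commute)
    qed
    moreover have "norm (U (x + h) - U x) \<le> norm (U (p + h) - U p) + h * integral {0..T} g"
      using translation_bound[OF h(1) p, of x] xy by (simp add: h_def)
    ultimately show ?thesis using green_H[OF a(2,1)] by (simp add: h_def K_def algebra_simps)
  qed
  then have "norm (Y t) \<le> K + F"
    using T \<open>0 \<le> K\<close> by (intro Y_bound[OF t, of "T / 2"]) auto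
  then show ?thesis by (simp add: K_def)
qed

text \<open>Good times r n accumulate at every t. Against test forms the coderivatives at r n
  converge because \<open>m\<close> and \<open>w\<close> are continuous in time;
  \<open>Y_le_green\<close>, started at r 0, bounds them uniformly, so they converge against all of
  \<open>V1\<close> and \<open>V2\<close>, and both sides of Green's formula pass to the
  limit.\<close>

lemma green_everywhere:
  assumes t: "t \<in> {0..T}"
  shows "green t"
proof -
  have "t \<in> closure ({0..T} - N)" using closure_minus_negligible[OF N T] t by simp
  then obtain r where r: "\<And>n. r n \<in> {0..T} - N" and "r \<longlonglongrightarrow> t" unfolding closure_sequential by blast
  have gr: "green (r n)" for n using green_AE r by blast
  define M0 where "M0 = H (r 0) + 2 * F + integral {0..T} g"
  have HM: "H (r n) \<le> M0" for n
    using Y_le_green[OF _ gr[of 0], of "r n"] green_H[OF gr[of n]] r by (auto simp: M0_def)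
  have "norm (\<delta>m x) \<le> H x" "norm (\<delta>w x) \<le> H x" for x
    unfolding H_def by (rule real_le_rsqrt; simp)+
  then have bd: "norm (\<delta>m (r n)) \<le> M0" "norm (\<delta>w (r n)) \<le> M0" for n
    using HM order_trans by blast+
  have lim: "(\<lambda>n. z (r n) \<bullet> e) \<longlonglongrightarrow> z t \<bullet> e" if "continuous_on {0..T} z" for z :: "real \<Rightarrow> 'a" and e
    using that \<open>r \<longlonglongrightarrow> t\<close> r t by (intro tendsto_intros) (auto simp: continuous_on_sequentially o_def)
  note mlim = lim[OF weak_deriv_continuous[OF m']] and wlim = lim[OF weak_deriv_continuous[OF w']]
  have \<delta>m: "(\<lambda>n. \<delta>m (r n) \<bullet> x) \<longlonglongrightarrow> \<delta>m t \<bullet> x" if "x \<in> V1" for x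
  proof (rule tendsto_inner_closure)
    show "x \<in> closure C1" using that dense by auto
    show "\<forall>\<^sub>F n in sequentially. norm (\<delta>m (r n)) \<le> M0" using bd by simp
    fix c assume "c \<in> C1"
    then obtain e where "\<And>t. t \<in> {0..T} \<Longrightarrow> \<delta>m t \<bullet> c = m t \<bullet> e" using C1 by blast
    then show "(\<lambda>n. \<delta>m (r n) \<bullet> c) \<longlonglongrightarrow> \<delta>m t \<bullet> c" using mlim[of e] t r by auto
  qed
  have \<delta>w: "(\<lambda>n. \<delta>w (r n) \<bullet> x) \<longlonglongrightarrow> \<delta>w t \<bullet> x" if "x \<in> V2" for x
  proof (rule tendsto_inner_closure)
    show "x \<in> closure C2" using that dense by auto
    show "\<forall>\<^sub>F n in sequentially. norm (\<delta>w (r n)) \<le> M0" using bd by simp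
    fix c assume "c \<in> C2"
    then obtain e where "\<And>t. t \<in> {0..T} \<Longrightarrow> \<delta>w t \<bullet> c = w t \<bullet> e" using C2 by blast
    then show "(\<lambda>n. \<delta>w (r n) \<bullet> c) \<longlonglongrightarrow> \<delta>w t \<bullet> c" using wlim[of e] t r by auto
  qed
  show ?thesis unfolding green_def
  proof (intro conjI allI impI)
    fix x y assume xy: "(x, y) \<in> \<Gamma>1"
    have "(\<lambda>n. m (r n) \<bullet> y) \<longlonglongrightarrow> \<delta>m t \<bullet> x"
      using \<delta>m[OF \<Gamma>1_V[OF xy]] gr xy by (simp add: green_def inner_commute)
    with mlim[of y] have "m t \<bullet> y = \<delta>m t \<bullet> x" by (rule LIMSEQ_unique)
    then show "y \<bullet> m t = x \<bullet> \<delta>m t" by (simp add: inner_commute)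
  next
    fix x y assume xy: "(x, y) \<in> \<Gamma>2"
    have "(\<lambda>n. w (r n) \<bullet> y) \<longlonglongrightarrow> \<delta>w t \<bullet> x"
      using \<delta>w[OF \<Gamma>2_V[OF xy]] gr xy by (simp add: green_def inner_commute)
    with wlim[of y] have "w t \<bullet> y = \<delta>w t \<bullet> x" by (rule LIMSEQ_unique)
    then show "y \<bullet> w t = x \<bullet> \<delta>w t" by (simp add: inner_commute)
  qed
qed

lemma H_bound:
  assumes "a \<in> {0..T}" "t \<in> {0..T}"
  shows "H t \<le> H a + 2 * F + integral {0..T} g"
  using Y_le_green[OF assms(1) green_everywhere[OF assms(1)] assms(2)] green_H[OF green_everywhere[OF assms(2)] assms(2)]
  by simp

end

section \<open>Smooth cutoff functions\<close>

lemma Ck_on_Suc_imp: "Ck_on (Suc m) S f \<Longrightarrow> Ck_on m S f"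
proof (induction m arbitrary: f)
  case 0
  then show ?case by (simp add: differentiable_imp_continuous_on)
qed auto

lemma Ck_on_UNIV_Suc:
  "Ck_on (Suc m) UNIV f \<longleftrightarrow>
     (\<forall>x. f differentiable at x) \<and> (\<forall>b\<in>Basis. Ck_on m UNIV (\<lambda>x. frechet_derivative f (at x) b))"
  by (simp add: differentiable_on_def)

lemma frechet_derivative_eq: "(f has_derivative f') (at x) \<Longrightarrow> frechet_derivative f (at x) = f'"
  by (metis frechet_derivative_at)

lemma Ck_on_SucI:
  assumes "\<And>x. (f has_derivative f' x) (at x)" "\<And>b. b \<in> Basis \<Longrightarrow> Ck_on m UNIV (\<lambda>x. f' x b)"
  shows "Ck_on (Suc m) UNIV f"
  unfolding Ck_on_UNIV_Suc using assms(2)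
  by (auto simp: frechet_derivative_eq[OF assms(1)] intro: differentiableI[OF assms(1)])

lemma Ck_on_const: "Ck_on m UNIV (\<lambda>x. c)"
  by (induction m arbitrary: c) (auto simp: differentiable_on_const)

lemma Ck_on_add:
  "Ck_on m UNIV f \<Longrightarrow> Ck_on m UNIV g \<Longrightarrow> Ck_on m UNIV (\<lambda>x. f x + g x)"
proof (induction m arbitrary: f g)
  case (Suc m)
  show ?case
  proof (rule Ck_on_SucI)
    show "((\<lambda>x. f x + g x) has_derivative (\<lambda>b. frechet_derivative f (at x) b + frechet_derivative g (at x) b)) (at x)" for x
      using Suc.prems unfolding Ck_on_UNIV_Suc by (intro has_derivative_add) (auto simp: frechet_derivative_works)
  qed (use Suc in \<open>auto simp: Ck_on_UNIV_Suc simp del: Ck_on.simps\<close>)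
qed (auto intro: continuous_intros)

lemma Ck_on_linear:
  assumes L: "bounded_linear L"
  shows "Ck_on m UNIV f \<Longrightarrow> Ck_on m UNIV (\<lambda>x. L (f x))"
proof (induction m arbitrary: f)
  case (Suc m)
  show ?case
  proof (rule Ck_on_SucI)
    show "((\<lambda>x. L (f x)) has_derivative (\<lambda>b. L (frechet_derivative f (at x) b))) (at x)" for x
      using Suc.prems unfolding Ck_on_UNIV_Suc
      by (intro bounded_linear.has_derivative[OF L]) (auto simp: frechet_derivative_works)
  qed (use Suc in \<open>auto simp: Ck_on_UNIV_Suc simp del: Ck_on.simps\<close>)
qed (auto intro: bounded_linear.continuous_on[OF L])

lemma Ck_on_mult:
  fixes f g :: "_ \<Rightarrow> real"
  shows "Ck_on m UNIV f \<Longrightarrow> Ck_on m UNIV g \<Longrightarrow> Ck_on m UNIV (\<lambda>x. f x * g x)"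
proof (induction m arbitrary: f g)
  case (Suc m)
  show ?case
  proof (rule Ck_on_SucI)
    show "((\<lambda>x. f x * g x) has_derivative (\<lambda>b. f x * frechet_derivative g (at x) b + frechet_derivative f (at x) b * g x)) (at x)" for x
      using Suc.prems unfolding Ck_on_UNIV_Suc by (intro has_derivative_mult) (auto simp: frechet_derivative_works)
    show "Ck_on m UNIV (\<lambda>x. f x * frechet_derivative g (at x) b + frechet_derivative f (at x) b * g x)"
      if "b \<in> Basis" for b
      using Suc.prems that unfolding Ck_on_UNIV_Suc
      by (intro Ck_on_add Suc.IH Ck_on_Suc_imp[OF Suc.prems(1)] Ck_on_Suc_imp[OF Suc.prems(2)]) auto
  qed
qed (auto intro: continuous_intros)

lemma Ck_on_bounded_linear: "bounded_linear L \<Longrightarrow> Ck_on m UNIV L"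
proof (cases m)
  case 0
  assume "bounded_linear L"
  then show ?thesis using 0 by (simp add: linear_continuous_on)
next
  case (Suc k)
  assume "bounded_linear L"
  then show ?thesis unfolding Suc
    by (intro Ck_on_SucI[of _ "\<lambda>_. L"] Ck_on_const) (rule bounded_linear_imp_has_derivative)
qed

lemma Ck_on_sum: "(\<And>i. i \<in> I \<Longrightarrow> Ck_on m UNIV (f i)) \<Longrightarrow> Ck_on m UNIV (\<lambda>x. \<Sum>i\<in>I. f i x)"
  by (induction I rule: infinite_finite_induct) (auto intro: Ck_on_const Ck_on_add)

lemma Ck_on_prod:
  fixes f :: "_ \<Rightarrow> _ \<Rightarrow> real"
  shows "(\<And>i. i \<in> I \<Longrightarrow> Ck_on m UNIV (f i)) \<Longrightarrow> Ck_on m UNIV (\<lambda>x. \<Prod>i\<in>I. f i x)"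
  by (induction I rule: infinite_finite_induct) (auto intro: Ck_on_const Ck_on_mult)

text \<open>The family \<open>h\<close> carries all successive derivatives of the outer function, so
  the induction on the order can pass from \<open>h k\<close> to \<open>h (Suc k)\<close>.\<close>

lemma Ck_on_compose_real:
  fixes h :: "nat \<Rightarrow> real \<Rightarrow> real"
  assumes h: "\<And>k x. (h k has_real_derivative h (Suc k) x) (at x)"
  shows "Ck_on m UNIV f \<Longrightarrow> Ck_on m UNIV (\<lambda>x. h k (f x))"
proof (induction m arbitrary: f k)
  case 0
  have "continuous_on UNIV (h k)"
    by (rule continuous_at_imp_continuous_on) (auto intro: DERIV_isCont[OF h])
  from continuous_on_compose2[OF this, of UNIV f] 0 show ?case by simp
next
  case (Suc m)
  show ?case
  proof (rule Ck_on_SucI)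
    fix x
    have f: "(f has_derivative frechet_derivative f (at x)) (at x)"
      using Suc.prems unfolding Ck_on_UNIV_Suc by (simp add: frechet_derivative_works)
    show "((\<lambda>x. h k (f x)) has_derivative (\<lambda>b. h (Suc k) (f x) * frechet_derivative f (at x) b)) (at x)"
      by (rule has_derivative_compose[OF f, of "h k" "\<lambda>d. h (Suc k) (f x) * d"])
        (use h[of k "f x"] in \<open>simp add: has_field_derivative_def\<close>)
  next
    fix b :: 'a assume "b \<in> Basis"
    then show "Ck_on m UNIV (\<lambda>x. h (Suc k) (f x) * frechet_derivative f (at x) b)"
      using Suc.prems unfolding Ck_on_UNIV_Suc
      by (intro Ck_on_mult Suc.IH Ck_on_Suc_imp[OF Suc.prems]) auto
  qed
qed

section \<open>Bump functions from exp(-1/t)\<close>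

text \<open>The k-th derivative of exp(-1/t) on t > 0 is P_k(1/t) exp(-1/t); with y = 1/t,
  differentiation gives P_(k+1)(y) = y^2 (P_k(y) - P_k'(y)).\<close>

fun bump_poly :: "nat \<Rightarrow> real poly" where
  "bump_poly 0 = 1"
| "bump_poly (Suc k) = [:0, 0, 1:] * (bump_poly k - pderiv (bump_poly k))"

definition bump :: "nat \<Rightarrow> real \<Rightarrow> real" where
  "bump k t = (if t > 0 then poly (bump_poly k) (1 / t) * exp (- (1 / t)) else 0)"

lemma tendsto_poly_mult_exp: "((\<lambda>y. poly p y * exp (- y)) \<longlongrightarrow> (0::real)) at_top"
proof -
  have "((\<lambda>y. \<Sum>i\<le>degree p. coeff p i * (y ^ i / exp y)) \<longlongrightarrow> (\<Sum>i\<le>degree p. coeff p i * 0)) at_top"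
    by (intro tendsto_intros tendsto_power_div_exp_0)
  then show ?thesis by (simp add: poly_altdef sum_distrib_right exp_minus divide_inverse mult.assoc)
qed

lemma bump_has_derivative: "(bump k has_real_derivative bump (Suc k) x) (at x)"
proof -
  consider "x > 0" | "x < 0" | "x = 0" by linarith
  then show ?thesis
  proof cases
    case 1
    have "((\<lambda>t. poly (bump_poly k) (1 / t) * exp (- (1 / t))) has_real_derivative bump (Suc k) x) (at x)"
    proof -
      have inv: "((\<lambda>t. 1 / t) has_real_derivative - ((1 / x) * (1 / x))) (at x)"
        using 1 by (auto intro!: derivative_eq_intros)
      have "((\<lambda>t. poly (bump_poly k) (1 / t)) has_real_derivative poly (pderiv (bump_poly k)) (1 / x) * - ((1 / x) * (1 / x))) (at x)"
        by (rule DERIV_chain2[OF poly_DERIV inv])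
      moreover have "((\<lambda>t. exp (- (1 / t))) has_real_derivative exp (- (1 / x)) * - (- ((1 / x) * (1 / x)))) (at x)"
        by (rule DERIV_chain2[OF DERIV_exp DERIV_minus[OF inv]])
      ultimately have "((\<lambda>t. poly (bump_poly k) (1 / t) * exp (- (1 / t))) has_real_derivative
          poly (pderiv (bump_poly k)) (1 / x) * - ((1 / x) * (1 / x)) * exp (- (1 / x))
          + exp (- (1 / x)) * - (- ((1 / x) * (1 / x))) * poly (bump_poly k) (1 / x)) (at x)"
        by (rule DERIV_mult)
      moreover have "bump (Suc k) x = poly (pderiv (bump_poly k)) (1 / x) * - ((1 / x) * (1 / x)) * exp (- (1 / x))
          + exp (- (1 / x)) * - (- ((1 / x) * (1 / x))) * poly (bump_poly k) (1 / x)"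
      proof -
        define y where "y = 1 / x"
        have "bump (Suc k) x = poly (bump_poly (Suc k)) y * exp (- y)" using 1 by (simp add: bump_def y_def)
        then show ?thesis unfolding y_def[symmetric] by (simp add: algebra_simps)
      qed
      ultimately show ?thesis by simp
    qed
    then show ?thesis
      by (rule has_field_derivative_transform_within_open[of _ _ _ "{0<..}"]) (use 1 in \<open>auto simp: bump_def\<close>)
  next
    case 2
    have "((\<lambda>t. 0) has_real_derivative bump (Suc k) x) (at x)" using 2 by (simp add: bump_def)
    then show ?thesis
      by (rule has_field_derivative_transform_within_open[of _ _ _ "{..<0}"]) (use 2 in \<open>auto simp: bump_def\<close>)
  next
    case 3
    \<comment> \<open>With y = 1/h the difference quotient at 0 is y P_k(y) exp(-y), which tends to
      0 as y grows.\<close>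
    have "((\<lambda>h. bump k h / h) \<longlongrightarrow> 0) (at_right 0)"
    proof -
      have "((\<lambda>y. poly ([:0, 1:] * bump_poly k) y * exp (- y)) \<longlongrightarrow> 0) at_top" by (rule tendsto_poly_mult_exp)
      from filterlim_compose[OF this filterlim_inverse_at_top_right]
      show ?thesis
      proof (rule Lim_transform_eventually)
        show "\<forall>\<^sub>F x in at_right 0. poly ([:0, 1:] * bump_poly k) (inverse x) * exp (- inverse x) = bump k x / x"
          using eventually_at_right_less[of "0::real"]
          by eventually_elim (simp add: bump_def divide_inverse mult_ac)
      qed
    qed
    moreover have "((\<lambda>h. bump k h / h) \<longlongrightarrow> 0) (at_left 0)"
    proof (rule tendsto_eventually)
      show "\<forall>\<^sub>F h in at_left 0. bump k h / h = 0"
        using eventually_at_left_field[of _ "0::real"] by (auto simp: bump_def intro!: exI[of _ "-1"])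
    qed
    ultimately have "((\<lambda>h. bump k h / h) \<longlongrightarrow> 0) (at 0)" by (simp add: filterlim_at_split)
    then show ?thesis using 3 by (simp add: DERIV_def bump_def)
  qed
qed

lemma bump_pos: "t > 0 \<Longrightarrow> bump 0 t > 0" and bump_zero: "t \<le> 0 \<Longrightarrow> bump 0 t = 0"
  by (auto simp: bump_def)

definition box_bump :: "'a::euclidean_space \<Rightarrow> 'a \<Rightarrow> 'a \<Rightarrow> real" where
  "box_bump a b x = (\<Prod>i\<in>Basis. bump 0 ((x - a) \<bullet> i) * bump 0 ((b - x) \<bullet> i))"

lemma box_bump_pos: "x \<in> box a b \<Longrightarrow> box_bump a b x > 0"
  by (auto simp: box_bump_def box_def inner_diff_left intro!: prod_pos mult_pos_pos bump_pos)

lemma box_bump_zero: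
  assumes "x \<notin> box a b" shows "box_bump a b x = 0"
proof -
  obtain i where "i \<in> Basis" "\<not> (a \<bullet> i < x \<bullet> i \<and> x \<bullet> i < b \<bullet> i)" using assms by (auto simp: box_def)
  then have "bump 0 ((x - a) \<bullet> i) * bump 0 ((b - x) \<bullet> i) = 0"
    using bump_zero[of "(x - a) \<bullet> i"] bump_zero[of "(b - x) \<bullet> i"] by (auto simp: inner_diff_left not_less)
  then show ?thesis unfolding box_bump_def using \<open>i \<in> Basis\<close> by (intro prod_zero) auto
qed

lemma box_bump_nonneg: "box_bump a b x \<ge> 0"
  using box_bump_pos[of x a b] box_bump_zero[of x a b] by (cases "x \<in> box a b") auto

lemma Ck_on_box_bump: "Ck_on m UNIV (box_bump a b)"
proof -
  have "Ck_on m UNIV (\<lambda>x::'a. bump 0 ((x - a) \<bullet> i) * bump 0 ((b - x) \<bullet> i))" for i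
  proof (intro Ck_on_mult Ck_on_compose_real[where h=bump] bump_has_derivative)
    have "Ck_on m UNIV (\<lambda>x. x \<bullet> i + - (a \<bullet> i))" "Ck_on m UNIV (\<lambda>x. b \<bullet> i + - (x \<bullet> i))"
      by (intro Ck_on_add Ck_on_const Ck_on_bounded_linear bounded_linear_inner_left bounded_linear_minus)+
    then show "Ck_on m UNIV (\<lambda>x. (x - a) \<bullet> i)" "Ck_on m UNIV (\<lambda>x. (b - x) \<bullet> i)"
      by (simp_all add: inner_diff_left)
  qed
  then show ?thesis unfolding box_bump_def[abs_def] by (intro Ck_on_prod)
qed

text \<open>Turns a smooth \<psi> \<ge> 0 into smooth functions between 0 and 1 that vanish where
  \<psi> does and tend to the indicator of {\<psi> > 0}. This replaces a plateau function:
  positivity of \<psi> is all that has to be arranged.\<close>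

definition cutoff :: "('a \<Rightarrow> real) \<Rightarrow> nat \<Rightarrow> 'a \<Rightarrow> real" where
  "cutoff \<psi> n x = 1 - exp (- (real n * \<psi> x))"

lemma Ck_on_cutoff:
  assumes "Ck_on m UNIV \<psi>" shows "Ck_on m UNIV (cutoff \<psi> n)"
proof -
  define h where "h k t = (if k = 0 then 1 - exp (- t) else (-1) ^ Suc k * exp (- t))" for k :: nat and t :: real
  have e: "((\<lambda>t. exp (- t)) has_real_derivative - exp (- x)) (at x)" for x :: real
    by (auto intro!: derivative_eq_intros)
  have "(h k has_real_derivative h (Suc k) x) (at x)" for k x
  proof (cases k)
    case 0
    have "h 0 = (\<lambda>t. 1 - exp (- t))" by (simp add: h_def fun_eq_iff)
    then show ?thesis using DERIV_diff[OF DERIV_const e, of 1 x] 0 by (simp add: h_def)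
  next
    case (Suc l)
    have "h (Suc l) = (\<lambda>t. (-1) ^ Suc (Suc l) * exp (- t))" by (simp add: h_def fun_eq_iff)
    then show ?thesis using DERIV_cmult[OF e, of "(-1) ^ Suc (Suc l)" x] Suc by (simp add: h_def)
  qed
  then have "Ck_on m UNIV (\<lambda>x. h 0 (real n * \<psi> x))"
    by (rule Ck_on_compose_real[of h]) (rule Ck_on_mult[OF Ck_on_const assms])
  then show ?thesis by (simp add: h_def cutoff_def[abs_def])
qed

lemma cutoff_bounds: "\<psi> x \<ge> 0 \<Longrightarrow> 0 \<le> cutoff \<psi> n x" "\<psi> x \<ge> 0 \<Longrightarrow> cutoff \<psi> n x \<le> 1"
  and cutoff_zero: "\<psi> x = 0 \<Longrightarrow> cutoff \<psi> n x = 0"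
  by (auto simp: cutoff_def)

lemma cutoff_tendsto: "\<psi> x > 0 \<Longrightarrow> (\<lambda>n. cutoff \<psi> n x) \<longlonglongrightarrow> 1"
proof -
  assume "\<psi> x > 0"
  then have "filterlim (\<lambda>n. real n * \<psi> x) at_top sequentially"
    by (intro filterlim_at_top_mult_tendsto_pos[OF tendsto_const] filterlim_real_sequentially)
  then have "(\<lambda>n. exp (- (real n * \<psi> x))) \<longlonglongrightarrow> 0"
    by (intro filterlim_compose[OF exp_at_bot] filterlim_compose[OF filterlim_uminus_at_bot_at_top])
  from tendsto_diff[OF tendsto_const[of 1] this] show ?thesis by (simp add: cutoff_def)
qed

lemma cutoff_Cc_inf:
  assumes "\<And>m. Ck_on m UNIV \<psi>" "compact K" "K \<subseteq> S" "\<And>x. x \<notin> K \<Longrightarrow> \<psi> x = 0"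
  shows "cutoff \<psi> n \<in> Cc_inf S"
  unfolding Cc_inf_def smooth_on_def using assms
  by (auto intro!: Ck_on_cutoff exI[of _ K] cutoff_zero)

section \<open>Partial derivatives\<close>

abbreviation pd :: "'a::euclidean_space \<Rightarrow> ('a \<Rightarrow> 'b::real_normed_vector) \<Rightarrow> 'a \<Rightarrow> 'b" where
  "pd b f x \<equiv> frechet_derivative f (at x) b"

lemma Ck_on_1D:
  assumes "Ck_on 1 UNIV f"
  shows "f differentiable at x" "b \<in> Basis \<Longrightarrow> continuous_on UNIV (pd b f)" "continuous_on UNIV f"
  using assms Ck_on_Suc_imp[of 0 UNIV f] unfolding One_nat_def Ck_on_UNIV_Suc by auto

lemma has_real_derivative_along:
  fixes f :: "'a::euclidean_space \<Rightarrow> real"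
  assumes "f differentiable at (x + s *\<^sub>R b)"
  shows "((\<lambda>s. f (x + s *\<^sub>R b)) has_real_derivative pd b f (x + s *\<^sub>R b)) (at s)"
proof -
  have f: "(f has_derivative frechet_derivative f (at (x + s *\<^sub>R b))) (at (x + s *\<^sub>R b))"
    using assms by (simp add: frechet_derivative_works)
  have "((\<lambda>s. x + s *\<^sub>R b) has_derivative (\<lambda>d. d *\<^sub>R b)) (at s)"
    by (auto intro!: derivative_eq_intros)
  from has_derivative_compose[OF this f]
  show ?thesis
    unfolding has_field_derivative_def
    by (rule has_derivative_eq_rhs) (simp add: fun_eq_iff linear_scale[OF has_derivative_linear[OF f]] mult.commute)
qed

lemma mixed_partials_MVT:
  fixes f :: "'a::euclidean_space \<Rightarrow> real"
  assumes f: "Ck_on 2 UNIV f" and a: "a \<in> Basis" and h: "h > 0"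
  obtains s t where "0 < s" "s < h" "0 < t" "t < h"
    "f (x + h *\<^sub>R a + h *\<^sub>R b) - f (x + h *\<^sub>R a) - f (x + h *\<^sub>R b) + f x = h * h * pd b (pd a f) (x + s *\<^sub>R a + t *\<^sub>R b)"
proof -
  have f': "\<And>x. f differentiable at x" "Ck_on 1 UNIV (pd a f)"
    using f a unfolding numeral_2_eq_2 Ck_on_UNIV_Suc One_nat_def by auto
  define G where "G s = f ((x + h *\<^sub>R b) + s *\<^sub>R a) - f (x + s *\<^sub>R a)" for s
  have "DERIV G s :> pd a f ((x + h *\<^sub>R b) + s *\<^sub>R a) - pd a f (x + s *\<^sub>R a)" for s
    unfolding G_def by (intro DERIV_diff has_real_derivative_along f')
  from MVT2[OF h this] obtain s where s: "0 < s" "s < h"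
    "G h - G 0 = h * (pd a f ((x + h *\<^sub>R b) + s *\<^sub>R a) - pd a f (x + s *\<^sub>R a))" by auto
  have "DERIV (\<lambda>t. pd a f ((x + s *\<^sub>R a) + t *\<^sub>R b)) t :> pd b (pd a f) ((x + s *\<^sub>R a) + t *\<^sub>R b)" for t
    by (intro has_real_derivative_along Ck_on_1D(1) f')
  from MVT2[OF h this] obtain t where t: "0 < t" "t < h"
    "pd a f ((x + s *\<^sub>R a) + h *\<^sub>R b) - pd a f (x + s *\<^sub>R a) = h * pd b (pd a f) ((x + s *\<^sub>R a) + t *\<^sub>R b)" by auto
  have "G h - G 0 = f (x + h *\<^sub>R a + h *\<^sub>R b) - f (x + h *\<^sub>R a) - f (x + h *\<^sub>R b) + f x"
    by (simp add: G_def algebra_simps)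
  then show thesis using s t that[of s t] by (simp add: algebra_simps)
qed

text \<open>The second difference over a square of side 1/(n+1) is symmetric in a and b. By the mean
  value theorem it is the squared side times either mixed derivative, at points tending to x, and
  both are continuous.\<close>

lemma mixed_partials_commute:
  fixes f :: "'a::euclidean_space \<Rightarrow> real"
  assumes f: "Ck_on 2 UNIV f" and a: "a \<in> Basis" and b: "b \<in> Basis"
  shows "pd b (pd a f) x = pd a (pd b f) x"
proof -
  have lim: "\<exists>\<xi>. \<xi> \<longlonglongrightarrow> x \<and> (\<forall>n. (f (x + (1 / Suc n) *\<^sub>R a + (1 / Suc n) *\<^sub>R b) - f (x + (1 / Suc n) *\<^sub>R a) - f (x + (1 / Suc n) *\<^sub>R b) + f x)
      = (1 / Suc n) * (1 / Suc n) * pd b (pd a f) (\<xi> n))" if ab: "a \<in> Basis" "b \<in> Basis" for a b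
  proof -
    define P where "P n s t \<longleftrightarrow> 0 < s \<and> s < 1 / real (Suc n) \<and> 0 < t \<and> t < 1 / real (Suc n) \<and>
      f (x + (1 / Suc n) *\<^sub>R a + (1 / Suc n) *\<^sub>R b) - f (x + (1 / Suc n) *\<^sub>R a) - f (x + (1 / Suc n) *\<^sub>R b) + f x
      = (1 / Suc n) * (1 / Suc n) * pd b (pd a f) (x + s *\<^sub>R a + t *\<^sub>R b)" for n s t
    have "\<exists>s t. P n s t" for n
    proof -
      have "1 / real (Suc n) > 0" by simp
      from mixed_partials_MVT[OF f ab(1) this, of x b] show ?thesis unfolding P_def by metis
    qed
    then obtain s t where "\<And>n. P n (s n) (t n)" by metis
    then have st: "\<And>n. 0 < s n" "\<And>n. s n < 1 / Suc n" "\<And>n. 0 < t n" "\<And>n. t n < 1 / Suc n"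
      "\<And>n. f (x + (1 / Suc n) *\<^sub>R a + (1 / Suc n) *\<^sub>R b) - f (x + (1 / Suc n) *\<^sub>R a) - f (x + (1 / Suc n) *\<^sub>R b) + f x
      = (1 / Suc n) * (1 / Suc n) * pd b (pd a f) (x + s n *\<^sub>R a + t n *\<^sub>R b)"
      unfolding P_def by blast+
    have lim0: "(\<lambda>n. 1 / real (Suc n)) \<longlonglongrightarrow> 0" using LIMSEQ_inverse_real_of_nat by (simp add: inverse_eq_divide)
    have "s \<longlonglongrightarrow> 0" "t \<longlonglongrightarrow> 0"
      by (rule tendsto_sandwich[OF _ _ tendsto_const lim0]; use st in \<open>auto intro!: always_eventually less_imp_le\<close>)+
    then have "(\<lambda>n. x + s n *\<^sub>R a + t n *\<^sub>R b) \<longlonglongrightarrow> x + 0 *\<^sub>R a + 0 *\<^sub>R b" by (intro tendsto_intros)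
    then show ?thesis using st(5) by (intro exI[of _ "\<lambda>n. x + s n *\<^sub>R a + t n *\<^sub>R b"]) simp
  qed
  obtain \<xi> where \<xi>: "\<xi> \<longlonglongrightarrow> x" "\<And>n. (f (x + (1 / Suc n) *\<^sub>R a + (1 / Suc n) *\<^sub>R b) - f (x + (1 / Suc n) *\<^sub>R a) - f (x + (1 / Suc n) *\<^sub>R b) + f x)
      = (1 / Suc n) * (1 / Suc n) * pd b (pd a f) (\<xi> n)" using lim[OF a b] by blast
  obtain \<zeta> where \<zeta>: "\<zeta> \<longlonglongrightarrow> x" "\<And>n. (f (x + (1 / Suc n) *\<^sub>R b + (1 / Suc n) *\<^sub>R a) - f (x + (1 / Suc n) *\<^sub>R b) - f (x + (1 / Suc n) *\<^sub>R a) + f x)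
      = (1 / Suc n) * (1 / Suc n) * pd a (pd b f) (\<zeta> n)" using lim[OF b a] by blast
  have eq: "pd b (pd a f) (\<xi> n) = pd a (pd b f) (\<zeta> n)" for n
  proof -
    have "(1 / Suc n) * (1 / Suc n) * pd b (pd a f) (\<xi> n) = (1 / Suc n) * (1 / Suc n) * pd a (pd b f) (\<zeta> n)"
      unfolding \<xi>(2)[symmetric] \<zeta>(2)[symmetric] by (simp add: algebra_simps)
    then show ?thesis by simp
  qed
  have c: "continuous_on UNIV (pd b (pd a f))" "continuous_on UNIV (pd a (pd b f))"
    using f a b unfolding numeral_2_eq_2 by (auto simp: One_nat_def)
  have "(\<lambda>n. pd b (pd a f) (\<xi> n)) \<longlonglongrightarrow> pd b (pd a f) x" "(\<lambda>n. pd a (pd b f) (\<zeta> n)) \<longlonglongrightarrow> pd a (pd b f) x"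
    using c \<xi>(1) \<zeta>(1) by (auto simp: continuous_on_sequentially o_def)
  then show ?thesis unfolding eq by (rule LIMSEQ_unique)
qed

section \<open>Integration by parts on the whole space\<close>

lemma integrable_continuous_compact_support:
  fixes f :: "'a::euclidean_space \<Rightarrow> 'b::euclidean_space"
  assumes "continuous_on UNIV f" "compact K" "\<And>x. x \<notin> K \<Longrightarrow> f x = 0"
  shows "integrable lborel f"
proof -
  have "integrable lborel (\<lambda>x. indicator K x *\<^sub>R f x)"
    using assms by (intro borel_integrable_compact) (auto intro: continuous_on_subset)
  also have "(\<lambda>x. indicator K x *\<^sub>R f x) = f" using assms(3) by (auto simp: indicator_def)
  finally show ?thesis .
qed

lemma frechet_derivative_off_support:
  assumes "closed K" "\<And>x. x \<notin> K \<Longrightarrow> f x = 0" "x \<notin> K"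
  shows "frechet_derivative f (at x) = (\<lambda>_. 0)"
proof (rule frechet_derivative_eq)
  show "(f has_derivative (\<lambda>_. 0)) (at x)"
    by (rule has_derivative_transform_within_open[of "\<lambda>_. 0" _ _ _ "- K"]) (use assms in auto)
qed

text \<open>Translation invariance of the integral: every difference quotient of g in direction b
  has integral 0, and the quotients converge to the derivative, uniformly bounded on a fixed
  ball.\<close>

lemma integral_pd_eq_0:
  fixes g :: "'a::euclidean_space \<Rightarrow> real"
  assumes g: "Ck_on 1 UNIV g" and K: "compact K" "\<And>x. x \<notin> K \<Longrightarrow> g x = 0" and b: "b \<in> Basis"
  shows "integral\<^sup>L lborel (pd b g) = 0"
proof -
  have c: "continuous_on UNIV (pd b g)" "continuous_on UNIV g" using Ck_on_1D[OF g] b by auto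
  have off: "pd b g x = 0" if "x \<notin> K" for x
    using frechet_derivative_off_support[OF compact_imp_closed[OF K(1)] K(2) that] by simp
  have "bounded (pd b g ` K)"
    by (intro compact_imp_bounded compact_continuous_image K continuous_on_subset[OF c(1)]) auto
  then obtain B0 where B0: "\<And>x. x \<in> K \<Longrightarrow> \<bar>pd b g x\<bar> \<le> B0" unfolding bounded_iff by auto
  define B where "B = max B0 0"
  have B: "\<bar>pd b g x\<bar> \<le> B" for x using B0[of x] off[of x] by (cases "x \<in> K") (auto simp: B_def)
  obtain R where R: "\<And>x. x \<in> K \<Longrightarrow> norm x \<le> R" using compact_imp_bounded[OF K(1)] unfolding bounded_iff by blast
  define h where "h n = 1 / real (Suc n)" for n
  have h: "0 < h n" "h n \<le> 1" for n by (auto simp: h_def)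
  have h0: "h \<longlonglongrightarrow> 0" unfolding h_def using LIMSEQ_inverse_real_of_nat by (simp add: inverse_eq_divide)
  define s where "s n x = (g (h n *\<^sub>R b + x) - g x) / h n" for n x
  have gi: "integrable lborel g" using c(2) K by (rule integrable_continuous_compact_support)
  have trans: "integrable lborel (\<lambda>x. g (y + x))" "integral\<^sup>L lborel (\<lambda>x. g (y + x)) = integral\<^sup>L lborel g" for y
  proof -
    have "integrable (distr lborel borel ((+) y)) g" "integral\<^sup>L (distr lborel borel ((+) y)) g = integral\<^sup>L lborel g"
      using gi by (simp_all add: lborel_distr_plus)
    moreover have "g \<in> borel_measurable borel" using c(2) by (rule borel_measurable_continuous_onI)
    ultimately show "integrable lborel (\<lambda>x. g (y + x))" "integral\<^sup>L lborel (\<lambda>x. g (y + x)) = integral\<^sup>L lborel g"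
      by (simp_all add: integrable_distr_eq integral_distr)
  qed
  have "(\<lambda>n. integral\<^sup>L lborel (s n)) \<longlonglongrightarrow> integral\<^sup>L lborel (pd b g)"
  proof (rule integral_dominated_convergence)
    \<comment> \<open>The radius R + 1 covers the supports of g and of all its translates, since the
      shifts have length at most 1.\<close>
    have "integrable lborel (\<lambda>x. indicator (cball 0 (R + 1)) x *\<^sub>R B)"
      by (rule borel_integrable_compact) auto
    then show "integrable lborel (\<lambda>x. B * indicator (cball 0 (R + 1)) x)" by (simp add: mult.commute)
    show "pd b g \<in> borel_measurable lborel" using c(1) by (simp add: borel_measurable_continuous_onI)
    show "s n \<in> borel_measurable lborel" for n
      unfolding s_def using trans(1)[of "h n *\<^sub>R b"] gi by (auto dest!: borel_measurable_integrable)
    show "AE x in lborel. (\<lambda>n. s n x) \<longlonglongrightarrow> pd b g x"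
    proof (rule AE_I2)
      fix x
      have "((\<lambda>s. g (x + s *\<^sub>R b)) has_real_derivative pd b g (x + 0 *\<^sub>R b)) (at 0)"
        by (intro has_real_derivative_along Ck_on_1D g)
      then have "((\<lambda>d. (g (x + d *\<^sub>R b) - g x) / d) \<longlongrightarrow> pd b g x) (at 0)" by (simp add: DERIV_def)
      moreover have "filterlim h (at 0) sequentially"
        using h0 h(1) by (auto simp: filterlim_at intro!: always_eventually) (metis less_irrefl)
      ultimately show "(\<lambda>n. s n x) \<longlonglongrightarrow> pd b g x"
        unfolding s_def by (subst add.commute) (rule filterlim_compose)
    qed
    show "AE x in lborel. norm (s n x) \<le> B * indicator (cball 0 (R + 1)) x" for n
    proof (rule AE_I2)
      fix x
      show "norm (s n x) \<le> B * indicator (cball 0 (R + 1)) x"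
      proof (cases "x \<in> cball 0 (R + 1)")
        case True
        have "DERIV (\<lambda>s. g (x + s *\<^sub>R b)) s :> pd b g (x + s *\<^sub>R b)" for s
          by (intro has_real_derivative_along Ck_on_1D g)
        from MVT2[OF h(1)[of n] this] obtain z where "g (x + h n *\<^sub>R b) - g x = h n * pd b g (x + z *\<^sub>R b)" by auto
        then have "s n x = pd b g (x + z *\<^sub>R b)" using h(1)[of n] by (simp add: s_def add.commute)
        then show ?thesis using B True by simp
      next
        case False
        then have "x \<notin> K" using R[of x] by auto
        moreover have "h n *\<^sub>R b + x \<notin> K"
        proof
          assume "h n *\<^sub>R b + x \<in> K"
          then have "norm (h n *\<^sub>R b + x) \<le> R" by (rule R)
          moreover have "norm (h n *\<^sub>R b) \<le> 1" using h[of n] b by simp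
          ultimately have "norm x \<le> R + 1" using norm_triangle_ineq4[of "h n *\<^sub>R b + x" "h n *\<^sub>R b"] by simp
          then show False using False by simp
        qed
        ultimately show ?thesis using K False by (simp add: s_def)
      qed
    qed
  qed
  moreover have "integral\<^sup>L lborel (s n) = 0" for n
    unfolding s_def using trans[of "h n *\<^sub>R b"] gi by simp
  ultimately show ?thesis by (simp add: LIMSEQ_const_iff)
qed

lemma integral_by_parts_pd:
  fixes f g :: "'a::euclidean_space \<Rightarrow> real"
  assumes f: "Ck_on 1 UNIV f" and g: "Ck_on 1 UNIV g" and K: "compact K" "\<And>x. x \<notin> K \<Longrightarrow> f x = 0" and b: "b \<in> Basis"
  shows "integral\<^sup>L lborel (\<lambda>x. pd b f x * g x) = - integral\<^sup>L lborel (\<lambda>x. f x * pd b g x)"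
proof -
  have off: "pd b f x = 0" if "x \<notin> K" for x
    using frechet_derivative_off_support[OF compact_imp_closed[OF K(1)] K(2) that] by simp
  have "pd b (\<lambda>x. f x * g x) x = f x * pd b g x + pd b f x * g x" for x
    using frechet_derivative_eq[OF has_derivative_mult[OF iffD1[OF frechet_derivative_works Ck_on_1D(1)[OF f]]
       iffD1[OF frechet_derivative_works Ck_on_1D(1)[OF g]]]] by simp
  then have "integral\<^sup>L lborel (\<lambda>x. f x * pd b g x + pd b f x * g x) = 0"
    using integral_pd_eq_0[OF Ck_on_mult[OF f g] K(1) _ b] K(2) by simp
  moreover have "integrable lborel (\<lambda>x. f x * pd b g x)" "integrable lborel (\<lambda>x. pd b f x * g x)"
    by (rule integrable_continuous_compact_support[OF _ K(1)];
        use K off Ck_on_1D[OF f] Ck_on_1D[OF g] b in \<open>auto intro!: continuous_intros\<close>)+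
  ultimately show ?thesis by simp
qed

section \<open>Density of test functions\<close>

lemma Cc_inf_D:
  fixes \<phi> :: "'a::euclidean_space \<Rightarrow> 'b::euclidean_space"
  assumes "\<phi> \<in> Cc_inf U"
  shows "Ck_on m UNIV \<phi>" "continuous_on UNIV \<phi>" "\<exists>B. \<forall>x. norm (\<phi> x) \<le> B" "\<phi> \<in> borel_measurable borel"
proof -
  show *: "Ck_on m UNIV \<phi>" for m using assms by (auto simp: Cc_inf_def smooth_on_def)
  show c: "continuous_on UNIV \<phi>" using *[of 0] by simp
  obtain K where K: "compact K" "\<And>x. x \<notin> K \<Longrightarrow> \<phi> x = 0" using assms by (auto simp: Cc_inf_def)
  have "bounded (\<phi> ` K)"
    by (intro compact_imp_bounded compact_continuous_image K continuous_on_subset[OF c]) auto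
  then obtain B where "\<And>x. x \<in> K \<Longrightarrow> norm (\<phi> x) \<le> B" unfolding bounded_iff by auto
  then have "norm (\<phi> x) \<le> max B 0" for x using K(2)[of x] by (cases "x \<in> K") fastforce+
  then show "\<exists>B. \<forall>x. norm (\<phi> x) \<le> B" by blast
  show "\<phi> \<in> borel_measurable borel" using c by (rule borel_measurable_continuous_onI)
qed

lemma Cc_inf_lincomb:
  fixes \<phi> \<psi> :: "'a::euclidean_space \<Rightarrow> real"
  assumes "\<phi> \<in> Cc_inf U" "\<psi> \<in> Cc_inf U"
  shows "(\<lambda>x. a * \<phi> x + b * \<psi> x) \<in> Cc_inf U"
proof -
  obtain K L where "compact K" "K \<subseteq> U" "\<And>x. x \<notin> K \<Longrightarrow> \<phi> x = 0" "compact L" "L \<subseteq> U" "\<And>x. x \<notin> L \<Longrightarrow> \<psi> x = 0"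
    using assms by (auto simp: Cc_inf_def)
  then have "\<exists>M. compact M \<and> M \<subseteq> U \<and> (\<forall>x. x \<notin> M \<longrightarrow> a * \<phi> x + b * \<psi> x = 0)"
    by (intro exI[of _ "K \<union> L"]) (auto intro: compact_Un)
  moreover have "Ck_on m UNIV (\<lambda>x. a * \<phi> x + b * \<psi> x)" for m
    by (intro Ck_on_add Ck_on_mult Ck_on_const Cc_inf_D[OF assms(1)] Cc_inf_D[OF assms(2)])
  ultimately show ?thesis by (simp add: Cc_inf_def smooth_on_def)
qed

lemma borel_measurable_lebesgue_onI:
  "f \<in> borel_measurable borel \<Longrightarrow> f \<in> borel_measurable (lebesgue_on S)"
  by (intro measurable_restrict_space1 measurable_completion) simp

text \<open>A sum of box bumps over a finite cover of K by boxes whose closures lie in U.\<close>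

lemma smooth_Urysohn:
  fixes K :: "'a::euclidean_space set"
  assumes "compact K" "open U" "K \<subseteq> U"
  obtains \<psi> where "\<And>n. cutoff \<psi> n \<in> Cc_inf U" "\<And>x. \<psi> x \<ge> 0" "\<And>x. x \<in> K \<Longrightarrow> \<psi> x > 0" "\<And>x. x \<notin> U \<Longrightarrow> \<psi> x = 0" "\<psi> \<in> borel_measurable borel"
proof -
  have "\<exists>a b. x \<in> box a b \<and> cbox a b \<subseteq> U" if "x \<in> K" for x
    using open_contains_cbox[OF \<open>open U\<close>] that assms(3) by (metis subsetD)
  then obtain a b where ab: "\<And>x. x \<in> K \<Longrightarrow> x \<in> box (a x) (b x)" "\<And>x. x \<in> K \<Longrightarrow> cbox (a x) (b x) \<subseteq> U" by metis
  have "K \<subseteq> (\<Union>x\<in>K. box (a x) (b x))" using ab by auto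
  then obtain I where I: "I \<subseteq> K" "finite I" "K \<subseteq> (\<Union>x\<in>I. box (a x) (b x))"
    using compactE_image[OF assms(1), of K "\<lambda>x. box (a x) (b x)"] by auto
  define \<psi> where "\<psi> x = (\<Sum>i\<in>I. box_bump (a i) (b i) x)" for x
  have sm: "Ck_on m UNIV \<psi>" for m unfolding \<psi>_def by (intro Ck_on_sum Ck_on_box_bump)
  define L where "L = (\<Union>i\<in>I. cbox (a i) (b i))"
  have L: "compact L" "L \<subseteq> U"
    using I(1) ab(2) unfolding L_def by (auto intro!: compact_UN I(2) compact_cbox)
  have off: "\<psi> x = 0" if "x \<notin> L" for x
    unfolding \<psi>_def using that by (intro sum.neutral ballI box_bump_zero) (auto simp: L_def box_subset_cbox[THEN subsetD])
  show thesis
  proof (rule that)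
    show "cutoff \<psi> n \<in> Cc_inf U" for n by (rule cutoff_Cc_inf[OF sm L off])
    show "\<psi> x \<ge> 0" for x unfolding \<psi>_def by (intro sum_nonneg box_bump_nonneg)
    show "\<psi> x > 0" if "x \<in> K" for x
    proof -
      from \<open>x \<in> K\<close> I(3) obtain i where "i \<in> I" "x \<in> box (a i) (b i)" by blast
      then show ?thesis unfolding \<psi>_def
        by (intro sum_pos2[OF I(2), of i] box_bump_pos box_bump_nonneg)
    qed
    show "\<psi> x = 0" if "x \<notin> U" for x using off that L by auto
    show "\<psi> \<in> borel_measurable borel" using sm[of 0] by (intro borel_measurable_continuous_onI) simp
  qed
qed

definition Cc_approx :: "'a::euclidean_space set \<Rightarrow> ('a \<Rightarrow> real) \<Rightarrow> bool" where
  "Cc_approx \<Omega> g \<longleftrightarrow> (\<forall>\<epsilon>>0. \<exists>\<phi>\<in>Cc_inf \<Omega>. integrable (lebesgue_on \<Omega>) (\<lambda>x. (g x - \<phi> x)\<^sup>2) \<and>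
     (\<integral>x. (g x - \<phi> x)\<^sup>2 \<partial>lebesgue_on \<Omega>) < \<epsilon>)"

lemma square_sum_le: "(a + b)\<^sup>2 \<le> 2 * a\<^sup>2 + 2 * (b::real)\<^sup>2"
  using sum_squares_bound[of a b] by (simp add: power2_sum)

lemma integrable_norm_square_add:
  fixes f g :: "'a \<Rightarrow> 'b::euclidean_space"
  assumes m: "f \<in> borel_measurable M" "g \<in> borel_measurable M"
    and i: "integrable M (\<lambda>x. (norm (f x))\<^sup>2)" "integrable M (\<lambda>x. (norm (g x))\<^sup>2)"
  shows "integrable M (\<lambda>x. (norm (f x + g x))\<^sup>2)"
proof (rule Bochner_Integration.integrable_bound)
  show "integrable M (\<lambda>x. 2 * (norm (f x))\<^sup>2 + 2 * (norm (g x))\<^sup>2)" using i by simp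
  show "(\<lambda>x. (norm (f x + g x))\<^sup>2) \<in> borel_measurable M" using m by measurable
  show "AE x in M. norm ((norm (f x + g x))\<^sup>2) \<le> norm (2 * (norm (f x))\<^sup>2 + 2 * (norm (g x))\<^sup>2)"
  proof (rule AE_I2)
    fix x
    have "(norm (f x + g x))\<^sup>2 \<le> (norm (f x) + norm (g x))\<^sup>2"
      by (intro power_mono norm_triangle_ineq) auto
    also have "\<dots> \<le> 2 * (norm (f x))\<^sup>2 + 2 * (norm (g x))\<^sup>2" by (rule square_sum_le)
    finally show "norm ((norm (f x + g x))\<^sup>2) \<le> norm (2 * (norm (f x))\<^sup>2 + 2 * (norm (g x))\<^sup>2)" by simp
  qed
qed

lemma integral_square_add_le:
  assumes f: "integrable M (\<lambda>x. (f x)\<^sup>2)" and g: "integrable M (\<lambda>x. (g x :: real)\<^sup>2)"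
    and m: "f \<in> borel_measurable M" "g \<in> borel_measurable M"
  shows "integrable M (\<lambda>x. (f x + g x)\<^sup>2)"
    "(\<integral>x. (f x + g x)\<^sup>2 \<partial>M) \<le> 2 * (\<integral>x. (f x)\<^sup>2 \<partial>M) + 2 * (\<integral>x. (g x)\<^sup>2 \<partial>M)"
proof -
  have i: "integrable M (\<lambda>x. 2 * (f x)\<^sup>2 + 2 * (g x)\<^sup>2)" using f g by auto
  show *: "integrable M (\<lambda>x. (f x + g x)\<^sup>2)"
    by (rule Bochner_Integration.integrable_bound[OF i]) (use m square_sum_le in auto)
  have "(\<integral>x. (f x + g x)\<^sup>2 \<partial>M) \<le> (\<integral>x. 2 * (f x)\<^sup>2 + 2 * (g x)\<^sup>2 \<partial>M)"
    by (rule integral_mono[OF * i]) (rule square_sum_le)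
  also have "\<dots> = 2 * (\<integral>x. (f x)\<^sup>2 \<partial>M) + 2 * (\<integral>x. (g x)\<^sup>2 \<partial>M)" using f g by simp
  finally show "(\<integral>x. (f x + g x)\<^sup>2 \<partial>M) \<le> 2 * (\<integral>x. (f x)\<^sup>2 \<partial>M) + 2 * (\<integral>x. (g x)\<^sup>2 \<partial>M)" .
qed

lemma Cc_approx_lincomb:
  assumes f: "Cc_approx \<Omega> f" "f \<in> borel_measurable (lebesgue_on \<Omega>)"
    and g: "Cc_approx \<Omega> g" "g \<in> borel_measurable (lebesgue_on \<Omega>)"
  shows "Cc_approx \<Omega> (\<lambda>x. a * f x + b * g x)"
  unfolding Cc_approx_def
proof (intro allI impI)
  let ?M = "lebesgue_on \<Omega>"
  fix \<epsilon> :: real assume "\<epsilon> > 0"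
  \<comment> \<open>The square of a sum costs a factor 2, the coefficients a^2 and b^2; the added 1
    keeps the denominator positive and the final inequality strict.\<close>
  define \<delta> where "\<delta> = \<epsilon> / (2 * (a\<^sup>2 + b\<^sup>2 + 1))"
  have c: "a\<^sup>2 + b\<^sup>2 + 1 > 0" by (simp add: add_nonneg_pos)
  have "\<delta> > 0" using \<open>\<epsilon> > 0\<close> c by (simp add: \<delta>_def)
  obtain \<phi> where \<phi>: "\<phi> \<in> Cc_inf \<Omega>" "integrable ?M (\<lambda>x. (f x - \<phi> x)\<^sup>2)" "(\<integral>x. (f x - \<phi> x)\<^sup>2 \<partial>?M) < \<delta>"
    using f(1) \<open>\<delta> > 0\<close> unfolding Cc_approx_def by blast
  obtain \<psi> where \<psi>: "\<psi> \<in> Cc_inf \<Omega>" "integrable ?M (\<lambda>x. (g x - \<psi> x)\<^sup>2)" "(\<integral>x. (g x - \<psi> x)\<^sup>2 \<partial>?M) < \<delta>"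
    using g(1) \<open>\<delta> > 0\<close> unfolding Cc_approx_def by blast
  have m: "\<phi> \<in> borel_measurable ?M" "\<psi> \<in> borel_measurable ?M"
    by (intro borel_measurable_lebesgue_onI Cc_inf_D[OF \<phi>(1)] Cc_inf_D[OF \<psi>(1)])+
  have i: "integrable ?M (\<lambda>x. (a * (f x - \<phi> x))\<^sup>2)" "integrable ?M (\<lambda>x. (b * (g x - \<psi> x))\<^sup>2)"
    using \<phi>(2) \<psi>(2) by (simp_all add: power_mult_distrib)
  have eq: "a * (f x - \<phi> x) + b * (g x - \<psi> x) = a * f x + b * g x - (a * \<phi> x + b * \<psi> x)" for x
    by (simp add: algebra_simps)
  have mm: "(\<lambda>x. a * (f x - \<phi> x)) \<in> borel_measurable ?M" "(\<lambda>x. b * (g x - \<psi> x)) \<in> borel_measurable ?M"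
    using m f g by measurable
  note r = integral_square_add_le[OF i mm, unfolded eq]
  have "2 * (\<integral>x. (a * (f x - \<phi> x))\<^sup>2 \<partial>?M) + 2 * (\<integral>x. (b * (g x - \<psi> x))\<^sup>2 \<partial>?M)
      = 2 * (a\<^sup>2 * (\<integral>x. (f x - \<phi> x)\<^sup>2 \<partial>?M)) + 2 * (b\<^sup>2 * (\<integral>x. (g x - \<psi> x)\<^sup>2 \<partial>?M))"
    by (simp add: power_mult_distrib)
  also have "\<dots> \<le> 2 * (a\<^sup>2 * \<delta>) + 2 * (b\<^sup>2 * \<delta>)"
    using \<phi>(3) \<psi>(3) by (intro add_mono mult_left_mono) auto
  also have "\<dots> < 2 * ((a\<^sup>2 + b\<^sup>2 + 1) * \<delta>)" using \<open>\<delta> > 0\<close> by (simp add: algebra_simps)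
  also have "\<dots> = \<epsilon>"
  proof -
    have "2 * (k * (\<epsilon> / (2 * k))) = \<epsilon>" if "k > 0" for k using that by simp
    from this[OF c] show ?thesis by (simp only: \<delta>_def)
  qed
  finally show "\<exists>\<phi>\<in>Cc_inf \<Omega>. integrable ?M (\<lambda>x. (a * f x + b * g x - \<phi> x)\<^sup>2) \<and> (\<integral>x. (a * f x + b * g x - \<phi> x)\<^sup>2 \<partial>?M) < \<epsilon>"
    using r by (intro bexI[OF _ Cc_inf_lincomb[OF \<phi>(1) \<psi>(1), of a b]]) auto
qed

lemma Cc_approx_limit:
  assumes \<open>\<And>\<epsilon>. \<epsilon> > 0 \<Longrightarrow> \<exists>h. Cc_approx \<Omega> h \<and> h \<in> borel_measurable (lebesgue_on \<Omega>) \<and>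
      integrable (lebesgue_on \<Omega>) (\<lambda>x. (g x - h x)\<^sup>2) \<and> (\<integral>x. (g x - h x)\<^sup>2 \<partial>lebesgue_on \<Omega>) < \<epsilon>\<close>
    and g: "g \<in> borel_measurable (lebesgue_on \<Omega>)"
  shows "Cc_approx \<Omega> g"
  unfolding Cc_approx_def
proof (intro allI impI)
  let ?M = "lebesgue_on \<Omega>"
  fix \<epsilon> :: real assume "\<epsilon> > 0"
  then obtain h where h: "Cc_approx \<Omega> h" "h \<in> borel_measurable ?M"
    "integrable ?M (\<lambda>x. (g x - h x)\<^sup>2)" "(\<integral>x. (g x - h x)\<^sup>2 \<partial>?M) < \<epsilon> / 4"
    using assms(1)[of "\<epsilon> / 4"] by auto
  obtain \<phi> where \<phi>: "\<phi> \<in> Cc_inf \<Omega>" "integrable ?M (\<lambda>x. (h x - \<phi> x)\<^sup>2)" "(\<integral>x. (h x - \<phi> x)\<^sup>2 \<partial>?M) < \<epsilon> / 4"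
    using h(1)[unfolded Cc_approx_def, rule_format, of "\<epsilon> / 4"] \<open>\<epsilon> > 0\<close> by auto
  have m: "\<phi> \<in> borel_measurable ?M" by (intro borel_measurable_lebesgue_onI Cc_inf_D[OF \<phi>(1)])
  have mm: "(\<lambda>x. g x - h x) \<in> borel_measurable ?M" "(\<lambda>x. h x - \<phi> x) \<in> borel_measurable ?M"
    using m h g by measurable
  show "\<exists>\<phi>\<in>Cc_inf \<Omega>. integrable ?M (\<lambda>x. (g x - \<phi> x)\<^sup>2) \<and> (\<integral>x. (g x - \<phi> x)\<^sup>2 \<partial>?M) < \<epsilon>"
    using integral_square_add_le[OF h(3) \<phi>(2) mm] h(4) \<phi>(3) by (intro bexI[OF _ \<phi>(1)]) auto
qed

lemma integral_square_sub_tendsto_0: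
  assumes "\<And>i. U i \<in> borel_measurable M" "u \<in> borel_measurable M" "integrable M (\<lambda>x. (w x)\<^sup>2)"
    and "\<And>i x. x \<in> space M \<Longrightarrow> \<bar>u x - U i x\<bar> \<le> \<bar>w x :: real\<bar>" "\<And>x. x \<in> space M \<Longrightarrow> (\<lambda>i. U i x) \<longlonglongrightarrow> u x"
  shows "integrable M (\<lambda>x. (u x - U i x)\<^sup>2)" "(\<lambda>i. \<integral>x. (u x - U i x)\<^sup>2 \<partial>M) \<longlonglongrightarrow> 0"
proof -
  have le: "(u x - U i x)\<^sup>2 \<le> (w x)\<^sup>2" if "x \<in> space M" for i x
    using assms(4)[OF that, of i] by (simp add: abs_le_square_iff)
  show "integrable M (\<lambda>x. (u x - U i x)\<^sup>2)" for i
    by (rule Bochner_Integration.integrable_bound[OF assms(3)]) (use assms le in auto)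
  have "(\<lambda>i. \<integral>x. (u x - U i x)\<^sup>2 \<partial>M) \<longlonglongrightarrow> (\<integral>x. 0 \<partial>M)"
  proof (rule integral_dominated_convergence[OF _ _ assms(3)])
    show "AE x in M. (\<lambda>i. (u x - U i x)\<^sup>2) \<longlonglongrightarrow> 0"
    proof (rule AE_I2)
      fix x assume "x \<in> space M"
      from tendsto_power[OF tendsto_diff[OF tendsto_const assms(5)[OF this]], of "u x" 2]
      show "(\<lambda>i. (u x - U i x)\<^sup>2) \<longlonglongrightarrow> 0" by simp
    qed
  qed (use assms le in auto)
  then show "(\<lambda>i. \<integral>x. (u x - U i x)\<^sup>2 \<partial>M) \<longlonglongrightarrow> 0" by simp
qed

text \<open>A lies between a closed K and an open V that differ from it by measure below
  \<epsilon>/8 each. The cutoffs tend to the indicator \<open>v\<close> of a set between K and V, so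
  \<open>v\<close> and the indicator of A differ only on \<open>B\<close>, of measure below
  \<epsilon>/4. With a second error \<epsilon>/4 from the convergence, (a + b)^2 \<le> 2 a^2 + 2 b^2
  gives \<epsilon>.\<close>

lemma Cc_approx_indicator:
  assumes \<Omega>: "open \<Omega>" "bounded \<Omega>" and A: "A \<in> sets (lebesgue_on \<Omega>)"
  shows "Cc_approx \<Omega> (indicator A)"
  unfolding Cc_approx_def
proof (intro allI impI)
  let ?M = "lebesgue_on \<Omega>"
  fix \<epsilon> :: real assume "\<epsilon> > 0"
  have \<Omega>m: "\<Omega> \<in> sets lebesgue" using \<Omega> by simp
  have A': "A \<in> sets lebesgue" "A \<subseteq> \<Omega>" using A by (auto simp: sets_restrict_space_iff[of _ lebesgue] \<Omega>m sets_restrict_space)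
  obtain V where V: "open V" "A \<subseteq> V" "V - A \<in> lmeasurable" "emeasure lebesgue (V - A) < ennreal (\<epsilon> / 8)"
    using sets_lebesgue_outer_open[OF A'(1), of "\<epsilon> / 8"] \<open>\<epsilon> > 0\<close> by auto
  obtain K where K: "closed K" "K \<subseteq> A" "A - K \<in> lmeasurable" "emeasure lebesgue (A - K) < ennreal (\<epsilon> / 8)"
    using sets_lebesgue_inner_closed[OF A'(1), of "\<epsilon> / 8"] \<open>\<epsilon> > 0\<close> by auto
  have "bounded K" using K A' \<Omega>(2) by (meson bounded_subset)
  then have cK: "compact K" using K by (simp add: compact_eq_bounded_closed)
  obtain \<psi> where \<psi>: "\<And>n. cutoff \<psi> n \<in> Cc_inf (V \<inter> \<Omega>)" "\<And>x. \<psi> x \<ge> 0" "\<And>x. x \<in> K \<Longrightarrow> \<psi> x > 0"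
      "\<And>x. x \<notin> V \<inter> \<Omega> \<Longrightarrow> \<psi> x = 0" "\<psi> \<in> borel_measurable borel"
  proof (rule smooth_Urysohn[OF cK])
    show "open (V \<inter> \<Omega>)" "K \<subseteq> V \<inter> \<Omega>" using V \<Omega> K A' by auto
  qed (rule that; assumption)
  define u where "u = (indicator A :: 'a \<Rightarrow> real)"
  define v where "v = (indicator {x. \<psi> x > 0} :: 'a \<Rightarrow> real)"
  have fin: "finite_measure ?M" using \<Omega> by (intro finite_measure_lebesgue_on lmeasurable_open)
  have um: "u \<in> borel_measurable ?M" unfolding u_def using A by simp
  have "{x. \<psi> x > 0} \<in> sets borel" using \<psi>(5) by measurable
  then have vm: "v \<in> borel_measurable ?M"
    unfolding v_def by (intro borel_measurable_lebesgue_onI) simp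
  have cm: "cutoff \<psi> n \<in> borel_measurable ?M" for n
    by (intro borel_measurable_lebesgue_onI Cc_inf_D[OF \<psi>(1)])
  have lim: "(\<lambda>n. cutoff \<psi> n x) \<longlonglongrightarrow> v x" for x
    using cutoff_tendsto[of \<psi> x] cutoff_zero[of \<psi> x] \<psi>(2)[of x] by (cases "\<psi> x > 0") (auto simp: v_def)
  have bd: "\<bar>v x - cutoff \<psi> n x\<bar> \<le> \<bar>1\<bar>" for n x
    using cutoff_bounds[of \<psi> x n] \<psi>(2)[of x] by (auto simp: v_def indicator_def)
  have i1: "integrable ?M (\<lambda>x. 1\<^sup>2 :: real)" using fin by (simp add: finite_measure.integrable_const)
  note conv = integral_square_sub_tendsto_0[of "cutoff \<psi>", OF cm vm i1 bd lim]
  have "\<forall>\<^sub>F n in sequentially. (\<integral>x. (v x - cutoff \<psi> n x)\<^sup>2 \<partial>?M) < \<epsilon> / 4"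
    using order_tendstoD(2)[OF conv(2), of "\<epsilon> / 4"] \<open>\<epsilon> > 0\<close> by simp
  then obtain n where n: "(\<integral>x. (v x - cutoff \<psi> n x)\<^sup>2 \<partial>?M) < \<epsilon> / 4" by (auto simp: eventually_sequentially)
  define B where "B = (V - A) \<union> (A - K)"
  have Bm: "B \<in> lmeasurable" using V K by (auto simp: B_def intro: fmeasurable.Un)
  have "emeasure lebesgue B \<le> emeasure lebesgue (V - A) + emeasure lebesgue (A - K)"
    unfolding B_def using V K by (intro emeasure_subadditive) auto
  also have "\<dots> < ennreal (\<epsilon> / 8) + ennreal (\<epsilon> / 8)"
    using V(4) K(4) by (rule add_strict_mono)
  finally have "emeasure lebesgue B < ennreal (\<epsilon> / 4)" using \<open>\<epsilon> > 0\<close> by (simp add: ennreal_plus[symmetric] del: ennreal_plus)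
  then have Bs: "measure lebesgue B < \<epsilon> / 4"
    using Bm \<open>\<epsilon> > 0\<close> by (simp add: emeasure_eq_measure2 ennreal_less_iff)
  have uvm: "(\<lambda>x. u x - v x) \<in> borel_measurable ?M" using um vm by measurable
  have "(u x - v x)\<^sup>2 \<le> 1" for x by (auto simp: u_def v_def indicator_def)
  then have i2: "integrable ?M (\<lambda>x. (u x - v x)\<^sup>2)"
    by (intro Bochner_Integration.integrable_bound[OF i1]) (use uvm in auto)
  have BO: "B \<inter> \<Omega> \<in> sets ?M" using Bm \<Omega>m by (auto simp: sets_restrict_space_iff fmeasurable_def)
  have "(u x - v x)\<^sup>2 \<le> indicator (B \<inter> \<Omega>) x" if "x \<in> space ?M" for x
    using \<psi>(3)[of x] \<psi>(4)[of x] K A' V that by (auto simp: u_def v_def B_def indicator_def)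
  then have "(\<integral>x. (u x - v x)\<^sup>2 \<partial>?M) \<le> (\<integral>x. indicator (B \<inter> \<Omega>) x \<partial>?M)"
    using BO finite_measure.emeasure_finite[OF fin, of "B \<inter> \<Omega>"]
    by (intro integral_mono i2 integrable_real_indicator) (auto simp: top.not_eq_extremum)
  also have "\<dots> = measure ?M (B \<inter> \<Omega>)" using BO by simp
  also have "\<dots> = measure lebesgue (B \<inter> \<Omega>)" using \<Omega>m by (intro measure_restrict_space) auto
  also have "\<dots> \<le> measure lebesgue B" using Bm \<Omega>m by (intro measure_mono_fmeasurable) auto
  also have "\<dots> < \<epsilon> / 4" by (rule Bs)
  finally have "(\<integral>x. (u x - v x)\<^sup>2 \<partial>?M) < \<epsilon> / 4" .
  moreover have "(\<lambda>x. v x - cutoff \<psi> n x) \<in> borel_measurable ?M" using vm cm by measurable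
  moreover have "cutoff \<psi> n \<in> Cc_inf \<Omega>" using \<psi>(1)[of n] by (auto simp: Cc_inf_def)
  ultimately show "\<exists>\<phi>\<in>Cc_inf \<Omega>. integrable ?M (\<lambda>x. (indicator A x - \<phi> x)\<^sup>2) \<and> (\<integral>x. (indicator A x - \<phi> x)\<^sup>2 \<partial>?M) < \<epsilon>"
    using integral_square_add_le[OF i2 conv(1)[of n] uvm] n
    by (intro bexI[of _ "cutoff \<psi> n"]) (auto simp: u_def)
qed

lemma Cc_approx_L2:
  assumes \<Omega>: "open \<Omega>" "bounded \<Omega>" and g: "g \<in> borel_measurable (lebesgue_on \<Omega>)"
    "integrable (lebesgue_on \<Omega>) (\<lambda>x. (g x)\<^sup>2)"
  shows "Cc_approx \<Omega> g"
proof -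
  let ?M = "lebesgue_on \<Omega>"
  \<comment> \<open>Induction over nonnegative measurable functions. Square integrability stands in
    the conclusion since it has to be handed down to summands and to the terms of an increasing
    sequence.\<close>
  have nonneg: "integrable ?M (\<lambda>x. (u x)\<^sup>2) \<longrightarrow> Cc_approx \<Omega> u"
    if "u \<in> borel_measurable ?M" "\<And>x. 0 \<le> u x" for u
    using that
  proof (induction u rule: borel_measurable_induct_real)
    case (set A)
    then show ?case using Cc_approx_indicator[OF \<Omega>] by simp
  next
    case (mult u c)
    have um: "u \<in> borel_measurable ?M" using mult by auto
    show ?case
    proof
      assume *: "integrable ?M (\<lambda>x. (c * u x)\<^sup>2)"
      show "Cc_approx \<Omega> (\<lambda>x. c * u x)"
      proof (cases "c = 0")
        case True
        have "Cc_approx \<Omega> (\<lambda>x. 0 * indicator {} x + 0 * indicator {} x)"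
          by (intro Cc_approx_lincomb Cc_approx_indicator[OF \<Omega>]) auto
        then show ?thesis using True by simp
      next
        case False
        then have "Cc_approx \<Omega> u" using * mult by (simp add: power_mult_distrib)
        from Cc_approx_lincomb[OF this um this um, of c 0] show ?thesis by simp
      qed
    qed
  next
    case (add u v)
    have m: "u \<in> borel_measurable ?M" "v \<in> borel_measurable ?M" using add by auto
    show ?case
    proof
      assume *: "integrable ?M (\<lambda>x. (v x + u x)\<^sup>2)"
      have "integrable ?M (\<lambda>x. (u x)\<^sup>2)" "integrable ?M (\<lambda>x. (v x)\<^sup>2)"
        by (rule Bochner_Integration.integrable_bound[OF *]; use add in \<open>auto intro!: power_mono\<close>)+
      then have "Cc_approx \<Omega> u" "Cc_approx \<Omega> v" using add by auto
      from Cc_approx_lincomb[OF this(2) m(2) this(1) m(1), of 1 1]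
      show "Cc_approx \<Omega> (\<lambda>x. v x + u x)" by simp
    qed
  next
    case (seq U)
    have s: "\<And>i. U i \<in> borel_measurable ?M" "\<And>i x. 0 \<le> U i x" "incseq U"
      "\<And>x. x \<in> space ?M \<Longrightarrow> (\<lambda>i. U i x) \<longlonglongrightarrow> u x"
      "\<And>i. integrable ?M (\<lambda>x. (U i x)\<^sup>2) \<Longrightarrow> Cc_approx \<Omega> (U i)"
      using seq by auto
    show ?case
    proof
      assume *: "integrable ?M (\<lambda>x. (u x)\<^sup>2)"
      have le: "U i x \<le> u x" if "x \<in> space ?M" for i x
        using s(3) s(4)[OF that] by (intro incseq_le) (auto simp: incseq_def le_fun_def)
      have um: "u \<in> borel_measurable ?M"
        by (rule borel_measurable_LIMSEQ_real[of ?M U]) (use s in auto)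
      have ui: "integrable ?M (\<lambda>x. (U i x)\<^sup>2)" for i
        by (rule Bochner_Integration.integrable_bound[OF *]) (use s le in \<open>auto intro!: power_mono\<close>)
      have bd: "\<bar>u x - U i x\<bar> \<le> \<bar>u x\<bar>" if "x \<in> space ?M" for i x
        using le[OF that, of i] s(2)[of i x] by auto
      note conv = integral_square_sub_tendsto_0[of U, OF s(1) um * bd s(4)]
      show "Cc_approx \<Omega> u"
      proof (rule Cc_approx_limit[OF _ um])
        fix \<epsilon> :: real assume "\<epsilon> > 0"
        then have "\<forall>\<^sub>F i in sequentially. (\<integral>x. (u x - U i x)\<^sup>2 \<partial>?M) < \<epsilon>"
          using order_tendstoD(2)[OF conv(2)] by simp
        then obtain i where "(\<integral>x. (u x - U i x)\<^sup>2 \<partial>?M) < \<epsilon>" by (auto simp: eventually_sequentially)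
        then show "\<exists>h. Cc_approx \<Omega> h \<and> h \<in> borel_measurable ?M \<and>
            integrable ?M (\<lambda>x. (u x - h x)\<^sup>2) \<and> (\<integral>x. (u x - h x)\<^sup>2 \<partial>?M) < \<epsilon>"
          using s(1) s(5)[OF ui] conv(1) by (intro exI[of _ "U i"]) auto
      qed
    qed
  qed
  define p q where "p x = max (g x) 0" and "q x = max (- g x) 0" for x
  have m: "p \<in> borel_measurable ?M" "q \<in> borel_measurable ?M"
    unfolding p_def q_def using g(1) by measurable
  have "(p x)\<^sup>2 \<le> (g x)\<^sup>2" "(q x)\<^sup>2 \<le> (g x)\<^sup>2" for x
    by (auto simp: p_def q_def max_def)
  then have "integrable ?M (\<lambda>x. (p x)\<^sup>2)" "integrable ?M (\<lambda>x. (q x)\<^sup>2)"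
    by (intro Bochner_Integration.integrable_bound[OF g(2)]; use m in auto)+
  then have "Cc_approx \<Omega> p" "Cc_approx \<Omega> q"
    using nonneg m by (auto simp: p_def q_def)
  from Cc_approx_lincomb[OF this(1) m(1) this(2) m(2), of 1 "-1"]
  have "Cc_approx \<Omega> (\<lambda>x. p x - q x)" by simp
  also have "(\<lambda>x. p x - q x) = g" by (auto simp: p_def q_def)
  finally show ?thesis .
qed

section \<open>Weak derivatives in time\<close>

text \<open>Links the almost everywhere statements of the definitions with the negligible sets of
  the gauge integral, in which the abstract estimates are phrased.\<close>

lemma AE_lebesgue_on_negligible:
  assumes "S \<in> sets lebesgue"
  shows "(AE x in lebesgue_on S. P x) \<longleftrightarrow> (\<exists>N. negligible N \<and> (\<forall>x\<in>S - N. P x))"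
proof -
  have "(AE x in lebesgue_on S. P x) \<longleftrightarrow> (AE x in lebesgue. x \<in> S \<longrightarrow> P x)"
    using assms by (intro AE_restrict_space_iff) simp
  also have "\<dots> \<longleftrightarrow> (\<exists>N. negligible N \<and> (\<forall>x\<in>S - N. P x))"
  proof
    assume *: "AE x in lebesgue. x \<in> S \<longrightarrow> P x"
    then obtain N where "{x \<in> space lebesgue. \<not> (x \<in> S \<longrightarrow> P x)} \<subseteq> N" "N \<in> null_sets lebesgue"
      by (auto elim!: AE_E simp: null_sets_def)
    then show "\<exists>N. negligible N \<and> (\<forall>x\<in>S - N. P x)"
      by (intro exI[of _ N]) (auto simp: negligible_iff_null_sets)
  next
    assume "\<exists>N. negligible N \<and> (\<forall>x\<in>S - N. P x)"
    then obtain N where "negligible N" "\<forall>x\<in>S - N. P x" by blast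
    then show "AE x in lebesgue. x \<in> S \<longrightarrow> P x"
      by (intro AE_I'[of N]) (auto simp: negligible_iff_null_sets)
  qed
  finally show ?thesis .
qed

text \<open>Cutoffs of boxes show that P has integral 0 over each closed box inside \<Omega>, and
  almost every value of P is the limit of averages over small cubes.\<close>

lemma fundamental_lemma:
  fixes P :: "'a::euclidean_space \<Rightarrow> real"
  assumes \<Omega>: "open \<Omega>" and P: "integrable (lebesgue_on \<Omega>) P"
    and 0: "\<And>\<phi>. \<phi> \<in> Cc_inf \<Omega> \<Longrightarrow> (\<integral>x. \<phi> x * P x \<partial>lebesgue_on \<Omega>) = 0"
  shows "\<exists>N. negligible N \<and> (\<forall>x\<in>\<Omega> - N. P x = 0)"
proof -
  let ?M = "lebesgue_on \<Omega>"
  have \<Omega>m: "\<Omega> \<in> sets lebesgue" using \<Omega> by simp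
  define P0 where "P0 x = (if x \<in> \<Omega> then P x else 0)" for x
  have P0: "integrable lebesgue P0"
  proof -
    have "P0 = (\<lambda>x. indicator \<Omega> x *\<^sub>R P x)" by (auto simp: P0_def)
    then show ?thesis using P \<Omega>m by (simp add: integrable_restrict_space)
  qed
  then have hk: "P0 absolutely_integrable_on S" if "S \<in> sets lebesgue" for S
    unfolding set_integrable_def using that by (intro integrable_mult_indicator)
  have box0: "integral (cbox a b) P0 = 0" if ab: "cbox a b \<subseteq> \<Omega>" for a b
  proof -
    have "(\<lambda>n. \<integral>x. cutoff (box_bump a b) n x * P x \<partial>?M) \<longlonglongrightarrow> (\<integral>x. indicator (box a b) x * P x \<partial>?M)"
    proof (rule integral_dominated_convergence)
      show "integrable ?M (\<lambda>x. \<bar>P x\<bar>)" using P by simp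
      have [measurable]: "P \<in> borel_measurable ?M" using P by simp
      have [measurable]: "cutoff (box_bump a b) n \<in> borel_measurable ?M" for n
        using Ck_on_cutoff[OF Ck_on_box_bump, of 0 a b n]
        by (intro borel_measurable_lebesgue_onI borel_measurable_continuous_onI) simp
      have [measurable]: "(indicator (box a b) :: 'a \<Rightarrow> real) \<in> borel_measurable ?M"
        by (intro borel_measurable_lebesgue_onI) simp
      show "(\<lambda>x. indicator (box a b) x * P x) \<in> borel_measurable ?M" by measurable
      show "(\<lambda>x. cutoff (box_bump a b) n x * P x) \<in> borel_measurable ?M" for n by measurable
      show "AE x in ?M. norm (cutoff (box_bump a b) n x * P x) \<le> \<bar>P x\<bar>" for n
        using cutoff_bounds[of "box_bump a b" _ n, OF box_bump_nonneg] by (auto simp: abs_mult intro!: mult_left_le_one_le)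
      show "AE x in ?M. (\<lambda>n. cutoff (box_bump a b) n x * P x) \<longlonglongrightarrow> indicator (box a b) x * P x"
      proof (intro AE_I2 tendsto_mult tendsto_const)
        fix x show "(\<lambda>n. cutoff (box_bump a b) n x) \<longlonglongrightarrow> indicator (box a b) x"
          using cutoff_tendsto[of "box_bump a b" x] box_bump_pos[of x a b] cutoff_zero[of "box_bump a b" x] box_bump_zero[of x a b]
          by (cases "x \<in> box a b") auto
      qed
    qed
    moreover have "(\<integral>x. cutoff (box_bump a b) n x * P x \<partial>?M) = 0" for n
      by (intro 0 cutoff_Cc_inf[of _ "cbox a b"] Ck_on_box_bump ab compact_cbox box_bump_zero)
        (use box_subset_cbox in blast)
    ultimately have "(\<integral>x. indicator (box a b) x * P x \<partial>?M) = 0" by (simp add: LIMSEQ_const_iff)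
    also have "(\<integral>x. indicator (box a b) x * P x \<partial>?M) = (\<integral>x. indicator \<Omega> x *\<^sub>R (indicator (box a b) x * P x) \<partial>lebesgue)"
      using \<Omega>m by (intro integral_restrict_space) auto
    also have "\<dots> = (\<integral>x. indicator (box a b) x *\<^sub>R P0 x \<partial>lebesgue)"
      using ab box_subset_cbox[of a b] by (intro Bochner_Integration.integral_cong) (auto simp: P0_def indicator_def)
    also have "\<dots> = integral (box a b) P0"
      using set_lebesgue_integral_eq_integral(2)[OF hk[of "box a b"]] by (simp add: set_lebesgue_integral_def)
    also have "\<dots> = integral (cbox a b) P0" by (rule integral_open_interval)
    finally show ?thesis .
  qed
  have "P0 integrable_on cbox a b" for a b
    by (intro set_lebesgue_integral_eq_integral(1) hk) auto
  then obtain N where N: "negligible N"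
    "\<And>x e. x \<notin> N \<Longrightarrow> 0 < e \<Longrightarrow> \<exists>d>0. \<forall>h. 0 < h \<and> h < d \<longrightarrow> norm (integral (cbox x (x + h *\<^sub>R One)) P0 /\<^sub>R h ^ DIM('a) - P0 x) < e"
    using integrable_ccontinuous_explicit by blast
  have "P x = 0" if x: "x \<in> \<Omega> - N" for x
  proof (rule ccontr)
    assume "P x \<noteq> 0"
    then obtain d where d: "d > 0" "\<And>h. 0 < h \<Longrightarrow> h < d \<Longrightarrow> norm (integral (cbox x (x + h *\<^sub>R One)) P0 /\<^sub>R h ^ DIM('a) - P0 x) < \<bar>P x\<bar>"
      using N(2)[of x "\<bar>P x\<bar>"] x by auto
    obtain r where r: "r > 0" "cball x r \<subseteq> \<Omega>" using \<Omega> x open_contains_cball by blast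
    \<comment> \<open>In a cube of side h the l1 distance from the corner x is at most h times the
      dimension, so this cube stays in the ball of radius r.\<close>
    define h where "h = min (d / 2) (r / (2 * real DIM('a)))"
    have h: "0 < h" "h < d" "h * real DIM('a) \<le> r" using d r by (auto simp: h_def min_def field_simps)
    have "cbox x (x + h *\<^sub>R One) \<subseteq> cball x r"
    proof
      fix y assume y: "y \<in> cbox x (x + h *\<^sub>R One)"
      have "dist x y \<le> (\<Sum>i\<in>Basis. \<bar>(y - x) \<bullet> i\<bar>)"
        by (metis dist_commute dist_norm norm_le_l1)
      also have "\<dots> \<le> (\<Sum>i\<in>(Basis::'a set). h)"
        using y by (intro sum_mono) (auto simp: mem_box inner_diff_left inner_add_left)
      also have "\<dots> \<le> r" using h by (simp add: mult.commute)
      finally show "y \<in> cball x r" by simp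
    qed
    then have "integral (cbox x (x + h *\<^sub>R One)) P0 = 0" using r by (intro box0) auto
    then show False using d(2)[OF h(1,2)] x by (simp add: P0_def)
  qed
  then show ?thesis using N(1) by blast
qed

section \<open>The du Bois-Reymond lemma\<close>

text \<open>Mean zero makes the primitive vanish again to the right of the support.\<close>

lemma Cc_inf_primitive:
  fixes \<rho> :: "real \<Rightarrow> real"
  assumes \<rho>: "\<rho> \<in> Cc_inf {0<..<T}" and "T > 0" and zero: "integral {0..T} \<rho> = 0"
  obtains \<phi> where "\<phi> \<in> Cc_inf {0<..<T}" "\<And>t. (\<phi> has_real_derivative \<rho> t) (at t)"
proof -
  obtain K where K: "compact K" "K \<subseteq> {0<..<T}" "\<And>x. x \<notin> K \<Longrightarrow> \<rho> x = 0" using \<rho> by (auto simp: Cc_inf_def)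
  have c: "continuous_on UNIV \<rho>" using Cc_inf_D[OF \<rho>] by blast
  have i: "\<rho> integrable_on {a..b}" for a b
    by (rule integrable_continuous_interval) (use c continuous_on_subset in blast)
  obtain \<alpha> \<beta> where ab: "0 < \<alpha>" "\<beta> < T" "K \<subseteq> {\<alpha>..\<beta>}"
  proof (cases "K = {}")
    case True then show ?thesis using that[of 1 "T - 1"] by auto
  next
    case False
    then obtain x y where "x \<in> K" "\<And>t. t \<in> K \<Longrightarrow> x \<le> t" "y \<in> K" "\<And>t. t \<in> K \<Longrightarrow> t \<le> y"
      using compact_attains_inf[OF K(1)] compact_attains_sup[OF K(1)] by metis
    then show ?thesis using K by (intro that[of x y]) auto
  qed
  define \<phi> where "\<phi> t = integral {0..t} \<rho>" for t
  have low: "\<phi> t = 0" if "t < \<alpha>" for t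
    unfolding \<phi>_def by (rule integral_unique, rule has_integral_is_0) (use that ab K in force)
  have high: "\<phi> t = 0" if "t > \<beta>" for t
  proof (cases "t \<ge> 0")
    case True
    have z: "integral {x..y} \<rho> = 0" if "x > \<beta>" for x y
      by (rule integral_unique, rule has_integral_is_0) (use that ab K in force)
    show ?thesis
    proof (cases "t \<le> T")
      case True
      then have "integral {0..t} \<rho> + integral {t..T} \<rho> = integral {0..T} \<rho>"
        using \<open>t \<ge> 0\<close> by (intro Henstock_Kurzweil_Integration.integral_combine i) auto
      then show ?thesis using z[OF that, of T] zero by (simp add: \<phi>_def)
    next
      case False
      then have "integral {0..T} \<rho> + integral {T..t} \<rho> = integral {0..t} \<rho>"
        using \<open>T > 0\<close> by (intro Henstock_Kurzweil_Integration.integral_combine i) auto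
      then show ?thesis using z[OF ab(2), of t] zero by (simp add: \<phi>_def)
    qed
  qed (simp add: \<phi>_def)
  have der: "(\<phi> has_real_derivative \<rho> t) (at t)" for t
  proof (cases "t > 0")
    case True
    have "((\<lambda>u. integral {0..u} \<rho>) has_vector_derivative \<rho> t) (at t within {0..t + 1})"
      using True by (intro integral_has_vector_derivative continuous_on_subset[OF c]) auto
    then show ?thesis using True
      by (simp add: has_real_derivative_iff_has_vector_derivative \<phi>_def[abs_def] at_within_Icc_at)
  next
    case False
    have "\<rho> t = 0" using False ab K by force
    moreover have "((\<lambda>_. 0) has_real_derivative 0) (at t)" by simp
    then have "(\<phi> has_real_derivative 0) (at t)"
      by (rule has_field_derivative_transform_within_open[of _ _ _ "{..<\<alpha>}"]) (use False ab low in auto)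
    ultimately show ?thesis by simp
  qed
  have "Ck_on m UNIV \<phi>" for m
  proof (cases m)
    case 0
    then show ?thesis using der by (auto intro!: continuous_at_imp_continuous_on DERIV_isCont)
  next
    case (Suc k)
    show ?thesis unfolding Suc
    proof (rule Ck_on_SucI)
      show "(\<phi> has_derivative (\<lambda>d. \<rho> x * d)) (at x)" for x using der by (simp add: has_field_derivative_def)
      show "Ck_on k UNIV (\<lambda>x. \<rho> x * b)" for b by (intro Ck_on_mult Ck_on_const Cc_inf_D[OF \<rho>])
    qed
  qed
  moreover have "compact {\<alpha>..\<beta>}" "{\<alpha>..\<beta>} \<subseteq> {0<..<T}" "\<And>x. x \<notin> {\<alpha>..\<beta>} \<Longrightarrow> \<phi> x = 0"
    using ab low high by (auto simp: not_le)
  ultimately have "\<phi> \<in> Cc_inf {0<..<T}" unfolding Cc_inf_def smooth_on_def mem_Collect_eq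
    by (intro conjI allI impI exI[of _ "{\<alpha>..\<beta>}"])
  then show thesis using der by (rule that)
qed

lemma time_integral:
  fixes F :: "real \<Rightarrow> real"
  assumes "integrable (lebesgue_on {0<..<T}) F"
  shows "F absolutely_integrable_on {0..T}" "F integrable_on {0..T}" "integral\<^sup>L (lebesgue_on {0<..<T}) F = integral {0..T} F"
proof -
  have "F absolutely_integrable_on {0<..<T}"
    using assms by (simp add: integrable_restrict_space set_integrable_def)
  then show *: "F absolutely_integrable_on {0..T}"
    by (rule absolutely_integrable_spike_set) (auto intro: negligible_subset[of "{0,T}"])
  then show "F integrable_on {0..T}" by (rule set_lebesgue_integral_eq_integral)
  show "integral\<^sup>L (lebesgue_on {0<..<T}) F = integral {0..T} F"
    using lebesgue_integral_eq_integral[OF assms] integral_open_interval_real[of 0 T F] by simp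
qed

text \<open>A test function of mean zero is the derivative of a test function, so the weak equation
  and the product rule for a primitive G of g make F - G orthogonal to it. A function orthogonal to
  all of these is constant almost everywhere.\<close>

lemma du_Bois_Reymond:
  fixes F g :: "real \<Rightarrow> real"
  assumes "T > 0" and F: "integrable (lebesgue_on {0<..<T}) F" and g: "integrable (lebesgue_on {0<..<T}) g"
    and weak: "\<And>\<phi>. \<phi> \<in> Cc_inf {0<..<T} \<Longrightarrow>
      (\<integral>t. deriv \<phi> t * F t \<partial>lebesgue_on {0<..<T}) = - (\<integral>t. \<phi> t * g t \<partial>lebesgue_on {0<..<T})"
  shows "\<exists>c N. negligible N \<and> (\<forall>t\<in>{0..T} - N. (g has_integral (F t - c)) {0..t})"
proof -
  let ?M = "lebesgue_on {0<..<T}"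
  define G where "G t = integral {0..t} g" for t
  have Gw: "weak_deriv 0 T G g"
    using weak_deriv_integral[OF time_integral(1)[OF g], of 0] by (simp add: G_def[abs_def])
  note Gc = weak_deriv_continuous[OF Gw]
  have Gi: "integrable ?M G"
  proof -
    have "G absolutely_integrable_on {0<..<T}"
      by (rule set_integrable_subset[OF absolutely_integrable_continuous_real[OF Gc]]) auto
    then show ?thesis by (simp add: integrable_restrict_space set_integrable_def)
  qed
  define P where "P t = F t - G t" for t
  have Pi: "integrable ?M P" unfolding P_def using F Gi by simp
  have mult: "integrable ?M (\<lambda>t. \<phi> t * h t)" if \<phi>: "\<phi> \<in> Cc_inf {0<..<T}" and h: "integrable ?M h" for \<phi> h :: "real \<Rightarrow> real"
  proof -
    obtain B where B: "\<And>x. norm (\<phi> x) \<le> B" using Cc_inf_D(3)[OF \<phi>] by blast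
    show ?thesis
    proof (rule Bochner_Integration.integrable_bound)
      show "integrable ?M (\<lambda>t. B * h t)" using h by simp
      show "(\<lambda>t. \<phi> t * h t) \<in> borel_measurable ?M"
        using borel_measurable_integrable[OF h] borel_measurable_lebesgue_onI[OF Cc_inf_D(4)[OF \<phi>]]
        by (rule borel_measurable_times[rotated])
      show "AE x in ?M. norm (\<phi> x * h x) \<le> norm (B * h x)"
      proof (rule AE_I2)
        fix x
        have "\<bar>\<phi> x\<bar> * \<bar>h x\<bar> \<le> \<bar>B\<bar> * \<bar>h x\<bar>" using B[of x] by (intro mult_right_mono) auto
        then show "norm (\<phi> x * h x) \<le> norm (B * h x)" by (simp add: abs_mult)
      qed
    qed
  qed
  have zero: "(\<integral>t. \<rho> t * P t \<partial>?M) = 0" if \<rho>: "\<rho> \<in> Cc_inf {0<..<T}" "integral {0..T} \<rho> = 0" for \<rho>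
  proof -
    obtain \<phi> where \<phi>: "\<phi> \<in> Cc_inf {0<..<T}" "\<And>t. (\<phi> has_real_derivative \<rho> t) (at t)"
      using Cc_inf_primitive[OF \<rho>(1) \<open>T > 0\<close> \<rho>(2)] by blast
    have ends: "\<phi> 0 = 0" "\<phi> T = 0" using \<phi>(1) by (auto simp: Cc_inf_def)
    have c: "continuous_on UNIV \<rho>" using Cc_inf_D[OF \<rho>(1)] by blast
    have "weak_deriv 0 T \<phi> \<rho>"
      unfolding weak_deriv_def
    proof (intro conjI allI impI)
      show "continuous_on {0..T} \<phi>" using Cc_inf_D(2)[OF \<phi>(1)] continuous_on_subset by blast
      have "(\<lambda>r. norm (\<rho> r)) integrable_on {0..T}"
        by (intro integrable_continuous_interval continuous_intros continuous_on_subset[OF c]) auto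
      then show "\<exists>m N. m integrable_on {0..T} \<and> negligible N \<and> (\<forall>r\<in>{0..T} - N. norm (\<rho> r) \<le> m r)"
        by (intro exI[of _ "\<lambda>r. norm (\<rho> r)"] exI[of _ "{}"]) auto
      fix v s t :: real assume st: "0 \<le> s" "s \<le> t" "t \<le> T"
      have "(\<rho> has_integral (\<phi> t - \<phi> s)) {s..t}"
        using \<phi>(2) st by (intro fundamental_theorem_of_calculus)
          (auto simp: has_real_derivative_iff_has_vector_derivative intro: has_vector_derivative_at_within)
      then show "((\<lambda>r. \<rho> r \<bullet> v) has_integral (\<phi> t - \<phi> s) \<bullet> v) {s..t}"
        by (simp add: has_integral_mult_left)
    qed
    from weak_deriv_product[OF this Gw] \<open>T > 0\<close> ends
    have "((\<lambda>r. \<rho> r * G r + \<phi> r * g r) has_integral 0) {0..T}" by simp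
    moreover have "(\<integral>r. \<rho> r * G r + \<phi> r * g r \<partial>?M) = integral {0..T} (\<lambda>r. \<rho> r * G r + \<phi> r * g r)"
      by (intro time_integral Bochner_Integration.integrable_add mult \<phi> \<rho> g Gi)
    ultimately have "(\<integral>r. \<rho> r * G r + \<phi> r * g r \<partial>?M) = 0" by (simp add: integral_unique)
    then have "(\<integral>r. \<rho> r * G r \<partial>?M) + (\<integral>r. \<phi> r * g r \<partial>?M) = 0"
      using mult[OF \<rho>(1) Gi] mult[OF \<phi>(1) g] by simp
    moreover have "deriv \<phi> t = \<rho> t" for t using \<phi>(2) by (rule DERIV_imp_deriv)
    then have "(\<integral>t. \<rho> t * F t \<partial>?M) = - (\<integral>t. \<phi> t * g t \<partial>?M)" using weak[OF \<phi>(1)] by simp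
    ultimately show ?thesis
      using mult[OF \<rho>(1) Gi] mult[OF \<rho>(1) F] by (simp add: P_def right_diff_distrib)
  qed
  \<comment> \<open>A fixed test function with positive integral; a suitable multiple of it,
    subtracted from any \<rho>, leaves mean zero.\<close>
  define r0 where "r0 = cutoff (box_bump (T / 3) (2 * T / 3)) 1"
  have r0: "r0 \<in> Cc_inf {0<..<T}" unfolding r0_def
    by (rule cutoff_Cc_inf[of _ "{T / 3..2 * T / 3}"]) (use \<open>T > 0\<close> in \<open>auto intro!: Ck_on_box_bump box_bump_zero\<close>)
  have contI: "continuous_on {0..T} \<rho>" if "\<rho> \<in> Cc_inf {0<..<T}" for \<rho> :: "real \<Rightarrow> real"
    using Cc_inf_D(2)[OF that] continuous_on_subset by blast
  define I where "I = integral {0..T} r0"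
  have "I > 0"
  proof -
    have "I \<ge> 0" unfolding I_def r0_def
      by (intro integral_nonneg integrable_continuous_interval contI[OF r0, unfolded r0_def] cutoff_bounds box_bump_nonneg)
    moreover have "I \<noteq> 0"
    proof
      assume "I = 0"
      then have "(r0 has_integral 0) {0..T}"
        unfolding I_def using integrable_continuous_interval[OF contI[OF r0]] by (metis integrable_integral)
      then have "r0 (T / 2) = 0"
        using \<open>T > 0\<close> contI[OF r0] has_integral_0_cbox_imp_0[of 0 T r0 "T / 2"]
        by (auto simp: r0_def intro!: cutoff_bounds box_bump_nonneg)
      moreover have "box_bump (T / 3) (2 * T / 3) (T / 2) > 0" using \<open>T > 0\<close> by (intro box_bump_pos) auto
      ultimately show False by (auto simp: r0_def cutoff_def)
    qed
    ultimately show ?thesis by simp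
  qed
  \<comment> \<open>The only possible constant: P - c has to be orthogonal to
    \<open>r0\<close>.\<close>
  define c where "c = (\<integral>t. r0 t * P t \<partial>?M) / I"
  have ci: "integrable ?M (\<lambda>t. c)"
    by (intro finite_measure.integrable_const finite_measure_lebesgue_on) auto
  have "(\<integral>t. \<rho> t * (P t - c) \<partial>?M) = 0" if \<rho>: "\<rho> \<in> Cc_inf {0<..<T}" for \<rho>
  proof -
    define J where "J = integral {0..T} \<rho>"
    define k where "k = J / I"
    have int: "\<rho> integrable_on {0..T}" "r0 integrable_on {0..T}"
      by (intro integrable_continuous_interval contI \<rho> r0)+
    have "(\<lambda>t. 1 * \<rho> t + (- k) * r0 t) \<in> Cc_inf {0<..<T}" by (rule Cc_inf_lincomb[OF \<rho> r0])
    moreover have "integral {0..T} (\<lambda>t. 1 * \<rho> t + (- k) * r0 t) = J - k * I"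
      using int by (simp add: Henstock_Kurzweil_Integration.integral_diff integrable_on_mult_right J_def I_def)
    moreover have "J - k * I = 0" using \<open>I > 0\<close> by (simp add: k_def)
    ultimately have "(\<integral>t. (1 * \<rho> t + (- k) * r0 t) * P t \<partial>?M) = 0" by (intro zero) auto
    then have "(\<integral>t. \<rho> t * P t \<partial>?M) = k * (\<integral>t. r0 t * P t \<partial>?M)"
      using mult[OF \<rho> Pi] mult[OF r0 Pi] by (simp add: left_diff_distrib mult.assoc)
    also have "\<dots> = c * J" using \<open>I > 0\<close> by (simp add: k_def c_def)
    also have "J = (\<integral>t. \<rho> t \<partial>?M)"
    proof -
      have "integrable ?M (\<lambda>t. \<rho> t * 1)"
        by (intro mult \<rho> finite_measure.integrable_const finite_measure_lebesgue_on) auto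
      then show ?thesis using time_integral(3)[of T \<rho>] by (simp add: J_def)
    qed
    finally show ?thesis
      using mult[OF \<rho> Pi] mult[OF \<rho> ci] by (simp add: right_diff_distrib mult.commute)
  qed
  then obtain N where N: "negligible N" "\<And>t. t \<in> {0<..<T} - N \<Longrightarrow> P t - c = 0"
    using fundamental_lemma[of "{0<..<T}" "\<lambda>t. P t - c"] Pi ci by auto
  have "(g has_integral (F t - c)) {0..t}" if "t \<in> {0..T} - (N \<union> {0, T})" for t
  proof -
    have "t \<in> {0<..<T} - N" using that by auto
    then have "F t - c = G t" using N(2)[of t] by (simp add: P_def)
    moreover have "g integrable_on {0..t}"
      using time_integral(2)[OF g] by (rule integrable_on_subinterval) (use that in auto)
    ultimately show ?thesis by (simp add: G_def has_integral_integral)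
  qed
  then show ?thesis using N(1) by (intro exI[of _ c] exI[of _ "N \<union> {0, T}"]) auto
qed

section \<open>The Hilbert space of square integrable functions\<close>

definition sq_integrable :: "('a::euclidean_space \<Rightarrow> 'b::euclidean_space) \<Rightarrow> bool" where
  "sq_integrable f \<longleftrightarrow> f \<in> borel_measurable lebesgue \<and> integrable lebesgue (\<lambda>x. (norm (f x))\<^sup>2)"

lemma sq_integrable_zero: "sq_integrable (\<lambda>x. 0)"
  by (simp add: sq_integrable_def)

lemma sq_integrable_add:
  assumes "sq_integrable f" "sq_integrable g"
  shows "sq_integrable (\<lambda>x. f x + g x)"
proof -
  have m: "f \<in> borel_measurable lebesgue" "g \<in> borel_measurable lebesgue" using assms by (auto simp: sq_integrable_def)
  have "integrable lebesgue (\<lambda>x. (norm (f x + g x))\<^sup>2)"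
    using assms by (intro integrable_norm_square_add m) (auto simp: sq_integrable_def)
  then show ?thesis using m by (simp add: sq_integrable_def)
qed

lemma sq_integrable_scaleR: "sq_integrable f \<Longrightarrow> sq_integrable (\<lambda>x. c *\<^sub>R f x)"
  by (auto simp: sq_integrable_def power_mult_distrib)

lemma sq_integrable_uminus: "sq_integrable f \<Longrightarrow> sq_integrable (\<lambda>x. - f x)"
  by (simp add: sq_integrable_def)

lemma sq_integrable_diff:
  assumes "sq_integrable f" "sq_integrable g"
  shows "sq_integrable (\<lambda>x. f x - g x)"
  using sq_integrable_add[OF assms(1) sq_integrable_uminus[OF assms(2)]] by simp

lemma sq_integrable_inner:
  assumes "sq_integrable f" "sq_integrable g"
  shows "integrable lebesgue (\<lambda>x. f x \<bullet> g x)"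
proof (rule Bochner_Integration.integrable_bound)
  have m: "f \<in> borel_measurable lebesgue" "g \<in> borel_measurable lebesgue" using assms by (auto simp: sq_integrable_def)
  then show "(\<lambda>x. f x \<bullet> g x) \<in> borel_measurable lebesgue" by measurable
  show "integrable lebesgue (\<lambda>x. (norm (f x))\<^sup>2 + (norm (g x))\<^sup>2)"
    using assms by (simp add: sq_integrable_def)
  show "AE x in lebesgue. norm (f x \<bullet> g x) \<le> norm ((norm (f x))\<^sup>2 + (norm (g x))\<^sup>2)"
  proof (rule AE_I2)
    fix x
    have "\<bar>f x \<bullet> g x\<bar> \<le> norm (f x) * norm (g x)" by (rule Cauchy_Schwarz_ineq2)
    also have "\<dots> \<le> (norm (f x))\<^sup>2 + (norm (g x))\<^sup>2"
      using sum_squares_bound[of "norm (f x)" "norm (g x)"] mult_nonneg_nonneg[of "norm (f x)" "norm (g x)"] norm_ge_zero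
      by (simp add: mult.assoc) (smt (verit) mult_nonneg_nonneg norm_ge_zero)
    finally show "norm (f x \<bullet> g x) \<le> norm ((norm (f x))\<^sup>2 + (norm (g x))\<^sup>2)" by simp
  qed
qed

definition l2_rel :: "('a::euclidean_space \<Rightarrow> 'b::euclidean_space) \<Rightarrow> ('a \<Rightarrow> 'b) \<Rightarrow> bool" where
  "l2_rel f g \<longleftrightarrow> sq_integrable f \<and> sq_integrable g \<and> (AE x in lebesgue. f x = g x)"

\<comment> \<open>Identification almost everywhere makes the norm definite, as the class
  \<open>real_inner\<close> demands. The equivalence is partial: it relates square integrable
  functions only.\<close>
quotient_type (overloaded) ('a, 'b) l2 = "'a::euclidean_space \<Rightarrow> 'b::euclidean_space" / partial: l2_rel
proof (rule part_equivpI)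
  show "\<exists>f. l2_rel f f" by (auto simp: l2_rel_def intro!: exI[of _ "\<lambda>_. 0"] sq_integrable_zero)
  show "symp l2_rel" by (auto simp: symp_def l2_rel_def)
  show "transp l2_rel" by (auto simp: transp_def l2_rel_def elim!: eventually_elim2)
qed

instantiation l2 :: (euclidean_space, euclidean_space) real_inner
begin

lift_definition zero_l2 :: "('a, 'b) l2" is "\<lambda>x. 0"
  by (simp add: l2_rel_def sq_integrable_zero)

lift_definition plus_l2 :: "('a, 'b) l2 \<Rightarrow> ('a, 'b) l2 \<Rightarrow> ('a, 'b) l2" is "\<lambda>f g x. f x + g x"
  by (auto simp: l2_rel_def intro!: sq_integrable_add elim!: eventually_elim2)

lift_definition minus_l2 :: "('a, 'b) l2 \<Rightarrow> ('a, 'b) l2 \<Rightarrow> ('a, 'b) l2" is "\<lambda>f g x. f x - g x"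
  by (auto simp: l2_rel_def intro!: sq_integrable_diff elim!: eventually_elim2)

lift_definition uminus_l2 :: "('a, 'b) l2 \<Rightarrow> ('a, 'b) l2" is "\<lambda>f x. - f x"
  by (auto simp: l2_rel_def intro!: sq_integrable_uminus)

lift_definition scaleR_l2 :: "real \<Rightarrow> ('a, 'b) l2 \<Rightarrow> ('a, 'b) l2" is "\<lambda>c f x. c *\<^sub>R f x"
  by (auto simp: l2_rel_def intro!: sq_integrable_scaleR)

lift_definition inner_l2 :: "('a, 'b) l2 \<Rightarrow> ('a, 'b) l2 \<Rightarrow> real" is "\<lambda>f g. \<integral>x. f x \<bullet> g x \<partial>lebesgue"
proof -
  fix f f' g g' :: "'a \<Rightarrow> 'b" assume *: "l2_rel f f'" "l2_rel g g'"
  then have "AE x in lebesgue. f x \<bullet> g x = f' x \<bullet> g' x"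
    by (auto simp: l2_rel_def elim!: eventually_elim2)
  then show "(\<integral>x. f x \<bullet> g x \<partial>lebesgue) = (\<integral>x. f' x \<bullet> g' x \<partial>lebesgue)"
    using * by (intro integral_cong_AE borel_measurable_integrable sq_integrable_inner) (auto simp: l2_rel_def)
qed

definition norm_l2 :: "('a, 'b) l2 \<Rightarrow> real" where "norm_l2 f = sqrt (inner f f)"
definition dist_l2 :: "('a, 'b) l2 \<Rightarrow> ('a, 'b) l2 \<Rightarrow> real" where "dist_l2 f g = norm (f - g)"
definition sgn_l2 :: "('a, 'b) l2 \<Rightarrow> ('a, 'b) l2" where "sgn_l2 f = inverse (norm f) *\<^sub>R f"
definition uniformity_l2 :: "(('a, 'b) l2 \<times> ('a, 'b) l2) filter" where
  "uniformity_l2 = (INF e\<in>{0<..}. principal {(x, y). dist x y < e})"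
definition open_l2 :: "('a, 'b) l2 set \<Rightarrow> bool" where
  "open_l2 U \<longleftrightarrow> (\<forall>x\<in>U. eventually (\<lambda>(x', y). x' = x \<longrightarrow> y \<in> U) uniformity)"

instance
proof
  fix x y z :: "('a, 'b) l2" and a b :: real
  show "x + y + z = x + (y + z)"
    by transfer (auto simp: l2_rel_def add.assoc intro!: sq_integrable_add)
  show "x + y = y + x"
    by transfer (auto simp: l2_rel_def add.commute intro!: sq_integrable_add)
  show "0 + x = x" by transfer (auto simp: l2_rel_def)
  show "- x + x = 0" by transfer (auto simp: l2_rel_def sq_integrable_zero)
  show "x - y = x + - y"
    by transfer (auto simp: l2_rel_def intro!: sq_integrable_diff)
  show "a *\<^sub>R (x + y) = a *\<^sub>R x + a *\<^sub>R y"
    by transfer (auto simp: l2_rel_def scaleR_add_right intro!: sq_integrable_add sq_integrable_scaleR)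
  show "(a + b) *\<^sub>R x = a *\<^sub>R x + b *\<^sub>R x"
    by transfer (auto simp: l2_rel_def scaleR_add_left intro!: sq_integrable_add sq_integrable_scaleR)
  show "a *\<^sub>R b *\<^sub>R x = (a * b) *\<^sub>R x"
    by transfer (auto simp: l2_rel_def intro!: sq_integrable_scaleR)
  show "1 *\<^sub>R x = x" by transfer (auto simp: l2_rel_def)
  show "dist x y = norm (x - y)" by (simp add: dist_l2_def)
  show "sgn x = inverse (norm x) *\<^sub>R x" by (simp add: sgn_l2_def)
  show "uniformity = (INF e\<in>{0<..}. principal {(x :: ('a, 'b) l2, y). dist x y < e})" by (simp add: uniformity_l2_def)
  show "open U \<longleftrightarrow> (\<forall>x\<in>U. eventually (\<lambda>(x', y). x' = x \<longrightarrow> y \<in> U) uniformity)" for U :: "('a, 'b) l2 set"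
    by (simp add: open_l2_def)
  show "inner x y = inner y x" by transfer (simp add: inner_commute)
  show "inner (x + y) z = inner x z + inner y z"
    by transfer (auto simp: l2_rel_def inner_add_left intro!: Bochner_Integration.integral_add sq_integrable_inner)
  show "inner (a *\<^sub>R x) y = a * inner x y" by transfer simp
  show "0 \<le> inner x x" by transfer (auto intro!: integral_nonneg_AE)
  show "(inner x x = 0) = (x = 0)"
  proof transfer
    fix f :: "'a \<Rightarrow> 'b" assume f: "l2_rel f f"
    have "(\<integral>x. f x \<bullet> f x \<partial>lebesgue) = 0 \<longleftrightarrow> (AE x in lebesgue. f x \<bullet> f x = 0)"
      using f by (intro integral_nonneg_eq_0_iff_AE sq_integrable_inner) (auto simp: l2_rel_def)
    then show "(\<integral>x. f x \<bullet> f x \<partial>lebesgue) = 0 \<longleftrightarrow> l2_rel f (\<lambda>x. 0)"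
      using f by (simp add: l2_rel_def sq_integrable_zero)
  qed
  show "norm x = sqrt (inner x x)" by (simp add: norm_l2_def)
qed

end

lemma abs_l2_inner: "sq_integrable f \<Longrightarrow> sq_integrable g \<Longrightarrow> abs_l2 f \<bullet> abs_l2 g = (\<integral>x. f x \<bullet> g x \<partial>lebesgue)"
  by (simp add: inner_l2.abs_eq l2_rel_def)

lemma abs_l2_linear:
  assumes "sq_integrable f" "sq_integrable g"
  shows "abs_l2 (\<lambda>x. f x + g x) = abs_l2 f + abs_l2 g" "abs_l2 (\<lambda>x. f x - g x) = abs_l2 f - abs_l2 g"
    "abs_l2 (\<lambda>x. c *\<^sub>R f x) = c *\<^sub>R abs_l2 f" "abs_l2 (\<lambda>x. 0) = 0"
  using assms by (simp_all add: plus_l2.abs_eq minus_l2.abs_eq scaleR_l2.abs_eq zero_l2.abs_eq l2_rel_def)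

lemma l2_exhaust: obtains f where "x = abs_l2 f" "sq_integrable f"
proof
  show "x = abs_l2 (rep_l2 x)" by (simp add: Quotient3_abs_rep[OF Quotient3_l2])
  show "sq_integrable (rep_l2 x)" using Quotient3_rep_reflp[OF Quotient3_l2, of x] by (simp add: l2_rel_def)
qed

section \<open>Test forms\<close>

lemma Ck_on_vec:
  fixes f :: "'a::euclidean_space \<Rightarrow> real^'i"
  assumes "\<And>J. Ck_on m UNIV (\<lambda>x. f x $ J)"
  shows "Ck_on m UNIV f"
proof -
  have "Ck_on m UNIV (\<lambda>x. \<Sum>J\<in>UNIV. (f x $ J) *\<^sub>R axis J 1)"
    by (intro Ck_on_sum Ck_on_linear[OF bounded_linear_scaleR_left] assms)
  also have "(\<lambda>x. \<Sum>J\<in>UNIV. (f x $ J) *\<^sub>R axis J 1) = f"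
    by (simp add: fun_eq_iff vec_eq_iff axis_def if_distrib[of "\<lambda>c. _ * c"] cong: if_cong)
  finally show ?thesis .
qed

lemma Ck_on_component: "Ck_on m UNIV f \<Longrightarrow> Ck_on m UNIV (\<lambda>x. f x $ I)"
  by (rule Ck_on_linear[OF bounded_linear_vec_nth])

lemma pd_component:
  assumes "f differentiable at x"
  shows "pd b f x $ I = pd b (\<lambda>x. f x $ I) x"
proof -
  have "((\<lambda>x. f x $ I) has_derivative (\<lambda>d. frechet_derivative f (at x) d $ I)) (at x)"
    using assms unfolding frechet_derivative_works
    by (rule bounded_linear.has_derivative[OF bounded_linear_vec_nth])
  then show ?thesis by (simp add: frechet_derivative_eq)
qed

lemma test_formsD:
  assumes "\<phi> \<in> test_forms U j"
  shows "Ck_on m UNIV \<phi>" "\<phi> \<in> Cc_inf U" "\<phi> x \<in> Alt j" "\<phi> differentiable at x" "continuous_on UNIV \<phi>"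
  using assms Cc_inf_D[of \<phi> U] Ck_on_1D[of \<phi>] by (auto simp: test_forms_def)

lemma test_forms_mono: "U \<subseteq> V \<Longrightarrow> \<phi> \<in> test_forms U j \<Longrightarrow> \<phi> \<in> test_forms V j"
  unfolding test_forms_def Cc_inf_def by blast

lemma partial_deriv_Ck:
  fixes \<phi> :: "'n::{finite,linorder} form"
  assumes "\<And>m. Ck_on m UNIV \<phi>"
  shows "Ck_on m UNIV (partial_deriv i \<phi>)"
proof -
  have "axis i 1 \<in> (Basis :: (real^'n::{finite,linorder}) set)" by (simp add: axis_in_Basis_iff)
  moreover have "partial_deriv i \<phi> = pd (axis i 1) \<phi>" by (simp add: fun_eq_iff partial_deriv_def)
  ultimately show ?thesis using assms[of "Suc m"] unfolding Ck_on_UNIV_Suc by simp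
qed

lemma partial_deriv_component:
  assumes "\<phi> \<in> test_forms U j"
  shows "partial_deriv i \<phi> x $ I = pd (axis i 1) (\<lambda>x. \<phi> x $ I) x"
  unfolding partial_deriv_def using test_formsD(4)[OF assms] by (rule pd_component)

lemma partial_deriv_Alt:
  assumes "\<phi> \<in> test_forms U j" "int (card I) \<noteq> j"
  shows "partial_deriv i \<phi> x $ I = 0"
proof -
  have "(\<lambda>x. \<phi> x $ I) = (\<lambda>x. 0)" using test_formsD(3)[OF assms(1)] assms(2) by (auto simp: Alt_def)
  then show ?thesis by (simp add: partial_deriv_component[OF assms(1)] frechet_derivative_const)
qed

lemma smooth_d_test_forms:
  assumes \<phi>: "\<phi> \<in> test_forms U j"
  shows "smooth_d \<phi> \<in> test_forms U (j + 1)"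
proof -
  obtain K where K: "compact K" "K \<subseteq> U" "\<And>x. x \<notin> K \<Longrightarrow> \<phi> x = 0"
    using test_formsD(2)[OF \<phi>] by (auto simp: Cc_inf_def)
  have "partial_deriv i \<phi> x = 0" if "x \<notin> K" for i x
    using frechet_derivative_off_support[OF compact_imp_closed[OF K(1)] K(3) that] by (simp add: partial_deriv_def)
  then have off: "smooth_d \<phi> x = 0" if "x \<notin> K" for x
    using that by (simp add: smooth_d_def vec_eq_iff)
  have "Ck_on m UNIV (smooth_d \<phi>)" for m
    by (rule Ck_on_vec) (auto simp: smooth_d_def intro!: Ck_on_sum Ck_on_mult Ck_on_const Ck_on_component partial_deriv_Ck test_formsD(1)[OF \<phi>])
  moreover have "smooth_d \<phi> x \<in> Alt (j + 1)" for x
    unfolding Alt_def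
  proof safe
    fix J :: "'a set" assume J: "int (card J) \<noteq> j + 1"
    have "partial_deriv i \<phi> x $ (J - {i}) = 0" if "i \<in> J" for i
    proof -
      have "card J = Suc (card (J - {i}))" using that by (metis card_Suc_Diff1 finite)
      then show ?thesis using J by (intro partial_deriv_Alt[OF \<phi>]) auto
    qed
    then show "smooth_d \<phi> x $ J = 0" by (simp add: smooth_d_def)
  qed
  ultimately show ?thesis using K off by (auto simp: test_forms_def Cc_inf_def smooth_on_def)
qed

lemma smooth_\<delta>_test_forms:
  assumes \<phi>: "\<phi> \<in> test_forms U j"
  shows "smooth_\<delta> \<phi> \<in> test_forms U (j - 1)"
proof -
  obtain K where K: "compact K" "K \<subseteq> U" "\<And>x. x \<notin> K \<Longrightarrow> \<phi> x = 0"
    using test_formsD(2)[OF \<phi>] by (auto simp: Cc_inf_def)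
  have "partial_deriv i \<phi> x = 0" if "x \<notin> K" for i x
    using frechet_derivative_off_support[OF compact_imp_closed[OF K(1)] K(3) that] by (simp add: partial_deriv_def)
  then have off: "smooth_\<delta> \<phi> x = 0" if "x \<notin> K" for x
    using that by (simp add: smooth_\<delta>_def vec_eq_iff)
  have "Ck_on m UNIV (smooth_\<delta> \<phi>)" for m
    by (rule Ck_on_vec) (auto simp: smooth_\<delta>_def
      intro!: Ck_on_linear[OF bounded_linear_minus[OF bounded_linear_ident]] Ck_on_sum Ck_on_mult Ck_on_const Ck_on_component partial_deriv_Ck test_formsD(1)[OF \<phi>])
  moreover have "smooth_\<delta> \<phi> x \<in> Alt (j - 1)" for x
    unfolding Alt_def
  proof safe
    fix I :: "'a set" assume "int (card I) \<noteq> j - 1"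
    then have "partial_deriv i \<phi> x $ insert i I = 0" if "i \<in> - I" for i
      using that by (intro partial_deriv_Alt[OF \<phi>]) auto
    then show "smooth_\<delta> \<phi> x $ I = 0" by (simp add: smooth_\<delta>_def)
  qed
  ultimately show ?thesis using K off by (auto simp: test_forms_def Cc_inf_def smooth_on_def)
qed

section \<open>The identity \<delta> \<delta> = 0 and the formal adjoint of d\<close>

text \<open>Inserting b flips the sign of a exactly when b < a, and exactly one of i < l and l < i
  holds.\<close>

lemma wedge_sign_swap:
  assumes "i \<notin> I" "l \<notin> I" "i \<noteq> l"
  shows "wedge_sign i I * wedge_sign l (insert i I) = - (wedge_sign l I * wedge_sign i (insert l I))"
proof -
  have *: "wedge_sign a (insert b I) = (if b < a then - wedge_sign a I else wedge_sign a I)"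
    if "b \<notin> I" for a b :: 'a
  proof -
    have "{m \<in> insert b I. m < a} = (if b < a then insert b {m \<in> I. m < a} else {m \<in> I. m < a})" by auto
    then show ?thesis using that by (simp add: wedge_sign_def)
  qed
  show ?thesis using assms *[of i l] *[of l i] by (auto simp: not_less)
qed

text \<open>In the double sum the signs are antisymmetric and the second derivatives symmetric in
  (i, l). This is the smooth source of d d = 0 on H_0, which follows by duality in
  \<open>d0_graph_complex\<close>.\<close>

lemma smooth_\<delta>_smooth_\<delta>:
  assumes \<phi>: "\<phi> \<in> test_forms U j"
  shows "smooth_\<delta> (smooth_\<delta> \<phi>) x = 0"
proof -
  have "smooth_\<delta> (smooth_\<delta> \<phi>) x $ I = 0" for I
  proof -
    define Tm where "Tm i l = wedge_sign i I * wedge_sign l (insert i I) * pd (axis i 1) (pd (axis l 1) (\<lambda>x. \<phi> x $ insert l (insert i I))) x" for i l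
    have diff: "pd (axis l 1) (\<lambda>x. \<phi> x $ J) differentiable at x" for l J x
      using Ck_on_component[OF test_formsD(1)[OF \<phi>, of 2], of J]
      unfolding numeral_2_eq_2 Ck_on_UNIV_Suc by (simp add: axis_in_Basis_iff)
    have 1: "partial_deriv i (smooth_\<delta> \<phi>) x $ insert i I
        = - (\<Sum>l\<in>- insert i I. wedge_sign l (insert i I) * pd (axis i 1) (pd (axis l 1) (\<lambda>x. \<phi> x $ insert l (insert i I))) x)" for i
    proof -
      have "((\<lambda>x. - (\<Sum>l\<in>- insert i I. wedge_sign l (insert i I) * pd (axis l 1) (\<lambda>x. \<phi> x $ insert l (insert i I)) x)) has_derivative
          (\<lambda>d. - (\<Sum>l\<in>- insert i I. wedge_sign l (insert i I) * pd d (pd (axis l 1) (\<lambda>x. \<phi> x $ insert l (insert i I))) x))) (at x)"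
        by (intro has_derivative_minus has_derivative_sum has_derivative_mult_right) (simp add: diff frechet_derivative_works[symmetric])
      moreover have "(\<lambda>x. smooth_\<delta> \<phi> x $ insert i I)
          = (\<lambda>x. - (\<Sum>l\<in>- insert i I. wedge_sign l (insert i I) * pd (axis l 1) (\<lambda>x. \<phi> x $ insert l (insert i I)) x))"
        by (simp add: smooth_\<delta>_def partial_deriv_component[OF \<phi>])
      ultimately show ?thesis
        unfolding partial_deriv_component[OF smooth_\<delta>_test_forms[OF \<phi>]] by (simp only: frechet_derivative_eq)
    qed
    have "smooth_\<delta> (smooth_\<delta> \<phi>) x $ I = (\<Sum>i\<in>- I. \<Sum>l\<in>- insert i I. Tm i l)"
      by (simp add: smooth_\<delta>_def[of "smooth_\<delta> \<phi>"] 1 Tm_def sum_negf sum_distrib_left mult.assoc)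
    also have "\<dots> = (\<Sum>(i, l)\<in>(SIGMA i:- I. - insert i I). Tm i l)" by (rule sum.Sigma) auto
    finally have S: "smooth_\<delta> (smooth_\<delta> \<phi>) x $ I = (\<Sum>(i, l)\<in>(SIGMA i:- I. - insert i I). Tm i l)" .
    have anti: "Tm i l = - Tm l i" if "(i, l) \<in> (SIGMA i:- I. - insert i I)" for i l
    proof -
      have "pd (axis i 1) (pd (axis l 1) (\<lambda>x. \<phi> x $ insert l (insert i I))) x
          = pd (axis l 1) (pd (axis i 1) (\<lambda>x. \<phi> x $ insert l (insert i I))) x"
        by (rule mixed_partials_commute[OF Ck_on_component[OF test_formsD(1)[OF \<phi>]]]) (simp_all add: axis_in_Basis_iff)
      then show ?thesis using that wedge_sign_swap[of i I l] by (auto simp: Tm_def insert_commute)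
    qed
    have "(\<Sum>(i, l)\<in>(SIGMA i:- I. - insert i I). Tm i l) = (\<Sum>(i, l)\<in>(SIGMA i:- I. - insert i I). Tm l i)"
      by (rule sum.reindex_bij_witness[of _ prod.swap prod.swap]) auto
    also have "\<dots> = (\<Sum>(i, l)\<in>(SIGMA i:- I. - insert i I). - Tm i l)"
      by (rule sum.cong[OF refl]) (use anti in force)
    also have "\<dots> = - (\<Sum>(i, l)\<in>(SIGMA i:- I. - insert i I). Tm i l)"
      by (simp add: sum_negf[symmetric] case_prod_beta)
    finally show ?thesis using S by simp
  qed
  then show ?thesis by (simp add: vec_eq_iff)
qed

lemma ip_eq_lborel:
  assumes "open \<Omega>" "continuous_on UNIV a" "continuous_on UNIV b" "\<And>x. x \<notin> \<Omega> \<Longrightarrow> a x = 0 \<or> b x = 0"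
  shows "ip \<Omega> a b = (\<integral>x. a x \<bullet> b x \<partial>lborel)"
proof -
  have "ip \<Omega> a b = (\<integral>x. indicator \<Omega> x *\<^sub>R (a x \<bullet> b x) \<partial>lebesgue)"
    unfolding ip_def using assms(1) by (intro integral_restrict_space) auto
  also have "\<dots> = (\<integral>x. a x \<bullet> b x \<partial>lebesgue)"
    by (intro Bochner_Integration.integral_cong) (use assms(4) in \<open>force simp: indicator_def\<close>)+
  also have "\<dots> = (\<integral>x. a x \<bullet> b x \<partial>lborel)"
    using assms by (intro integral_completion) (auto intro!: borel_measurable_continuous_onI continuous_intros)
  finally show ?thesis .
qed

text \<open>The compact support of \<phi> in \<Omega> alone removes the boundary terms, while \<mu>
  may reach the boundary. This is why compactly supported forms have zero trace in the sense of
  \<open>H0\<close>.\<close>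

lemma smooth_d_adjoint:
  assumes \<Omega>: "open \<Omega>" and \<phi>: "\<phi> \<in> test_forms \<Omega> j" and \<mu>: "\<mu> \<in> test_forms UNIV (j + 1)"
  shows "ip \<Omega> (smooth_d \<phi>) \<mu> = ip \<Omega> \<phi> (smooth_\<delta> \<mu>)"
proof -
  obtain K where K: "compact K" "K \<subseteq> \<Omega>" "\<And>x. x \<notin> K \<Longrightarrow> \<phi> x = 0"
    using test_formsD(2)[OF \<phi>] by (auto simp: Cc_inf_def)
  obtain K' where K': "K' \<subseteq> \<Omega>" "\<And>x. x \<notin> K' \<Longrightarrow> smooth_d \<phi> x = 0"
    using test_formsD(2)[OF smooth_d_test_forms[OF \<phi>]] by (auto simp: Cc_inf_def)
  define A where "A i I = (\<integral>x. pd (axis i 1) (\<lambda>x. \<phi> x $ I) x * \<mu> x $ insert i I \<partial>lborel)" for i I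
  have A: "A i I = - (\<integral>x. \<phi> x $ I * pd (axis i 1) (\<lambda>x. \<mu> x $ insert i I) x \<partial>lborel)" for i I
    unfolding A_def using K
    by (intro integral_by_parts_pd[OF _ _ K(1)] Ck_on_component test_formsD(1)[OF \<phi>] test_formsD(1)[OF \<mu>])
      (auto simp: axis_in_Basis_iff)
  have pdc: "continuous_on UNIV (pd (axis i 1) (\<lambda>x. \<psi> x $ I))" if "\<psi> \<in> test_forms V l" for \<psi> :: "'a form" and i I V l
    using Ck_on_1D(2)[OF Ck_on_component[OF test_formsD(1)[OF that]]] by (simp add: axis_in_Basis_iff)
  have cc: "continuous_on UNIV (\<lambda>x. \<psi> x $ I)" if "\<psi> \<in> test_forms V l" for \<psi> :: "'a form" and I V l
    using Ck_on_component[OF test_formsD(1)[OF that, of 0], of I] by simp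
  have pdoff: "pd (axis i 1) (\<lambda>x. \<phi> x $ I) x = 0" if "x \<notin> K" for i I x
    using frechet_derivative_off_support[OF compact_imp_closed[OF K(1)] _ that, of "\<lambda>x. \<phi> x $ I"] K(3) by simp
  have i1: "integrable lborel (\<lambda>x. pd (axis i 1) (\<lambda>x. \<phi> x $ I) x * \<mu> x $ J)" for i I J
    by (rule integrable_continuous_compact_support[OF _ K(1)])
      (auto intro!: continuous_intros pdc[OF \<phi>] cc[OF \<mu>] simp: pdoff)
  have i2: "integrable lborel (\<lambda>x. \<phi> x $ I * pd (axis i 1) (\<lambda>x. \<mu> x $ J) x)" for i I J
    by (rule integrable_continuous_compact_support[OF _ K(1)])
      (auto intro!: continuous_intros pdc[OF \<mu>] cc[OF \<phi>] simp: K(3))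
  have "ip \<Omega> (smooth_d \<phi>) \<mu> = (\<integral>x. smooth_d \<phi> x \<bullet> \<mu> x \<partial>lborel)"
    using K' by (intro ip_eq_lborel \<Omega> test_formsD(5)[OF \<mu>] test_formsD(5)[OF smooth_d_test_forms[OF \<phi>]]) auto
  also have "\<dots> = (\<integral>x. (\<Sum>J\<in>UNIV. \<Sum>i\<in>J. wedge_sign i (J - {i}) * (pd (axis i 1) (\<lambda>x. \<phi> x $ (J - {i})) x * \<mu> x $ J)) \<partial>lborel)"
    by (simp add: inner_vec_def smooth_d_def partial_deriv_component[OF \<phi>] sum_distrib_right mult.assoc)
  also have "\<dots> = (\<Sum>J\<in>UNIV. \<Sum>i\<in>J. wedge_sign i (J - {i}) * (\<integral>x. pd (axis i 1) (\<lambda>x. \<phi> x $ (J - {i})) x * \<mu> x $ J \<partial>lborel))"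
    using i1 by (simp add: Bochner_Integration.integral_sum Bochner_Integration.integrable_sum)
  also have "\<dots> = (\<Sum>J\<in>UNIV. \<Sum>i\<in>J. wedge_sign i (J - {i}) * A i (J - {i}))"
    by (intro sum.cong refl) (auto simp: A_def insert_absorb)
  also have "\<dots> = (\<Sum>(J, i)\<in>(SIGMA J:UNIV. J). wedge_sign i (J - {i}) * A i (J - {i}))" by (rule sum.Sigma) auto
  \<comment> \<open>Change of index: J with a marked element i corresponds to I = J - {i} with a
    marked non-element i.\<close>
  also have "\<dots> = (\<Sum>(I, i)\<in>(SIGMA I:UNIV. - I). wedge_sign i I * A i I)"
    by (rule sum.reindex_bij_witness[of _ "\<lambda>(I, i). (insert i I, i)" "\<lambda>(J, i). (J - {i}, i)"]) auto
  also have "\<dots> = (\<Sum>I\<in>UNIV. \<Sum>i\<in>- I. wedge_sign i I * A i I)" by (rule sum.Sigma[symmetric]) auto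
  also have "\<dots> = (\<Sum>I\<in>UNIV. \<Sum>i\<in>- I. - (wedge_sign i I * (\<integral>x. \<phi> x $ I * pd (axis i 1) (\<lambda>x. \<mu> x $ insert i I) x \<partial>lborel)))"
    by (simp add: A)
  also have "\<dots> = (\<integral>x. (\<Sum>I\<in>UNIV. \<Sum>i\<in>- I. - (wedge_sign i I * (\<phi> x $ I * pd (axis i 1) (\<lambda>x. \<mu> x $ insert i I) x))) \<partial>lborel)"
    using i2 by (simp add: Bochner_Integration.integral_sum Bochner_Integration.integrable_sum)
  also have "\<dots> = (\<integral>x. \<phi> x \<bullet> smooth_\<delta> \<mu> x \<partial>lborel)"
    by (simp add: inner_vec_def smooth_\<delta>_def partial_deriv_component[OF \<mu>] sum_distrib_left sum_negf mult_ac)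
  also have "\<dots> = ip \<Omega> \<phi> (smooth_\<delta> \<mu>)"
    using K by (intro ip_eq_lborel[symmetric] \<Omega> test_formsD(5)[OF \<phi>] test_formsD(5)[OF smooth_\<delta>_test_forms[OF \<mu>]]) auto
  finally show ?thesis .
qed

section \<open>Square integrable forms as elements of a Hilbert space\<close>

lemma integrable_lebesgue_onI:
  fixes f :: "_ \<Rightarrow> real"
  assumes "\<Omega> \<in> sets lebesgue" "integrable lebesgue f"
  shows "integrable (lebesgue_on \<Omega>) f"
  using integrable_mult_indicator[OF assms] assms(1) by (simp add: integrable_restrict_space)

lemma L2_sq_integrable:
  assumes "open \<Omega>" "\<omega> \<in> L2 \<Omega> j"
  shows "sq_integrable (\<lambda>x. indicator \<Omega> x *\<^sub>R \<omega> x)"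
proof -
  have "(\<lambda>x. (norm (indicator \<Omega> x *\<^sub>R \<omega> x))\<^sup>2) = (\<lambda>x. indicator \<Omega> x *\<^sub>R (norm (\<omega> x))\<^sup>2)"
    by (auto simp: indicator_def fun_eq_iff)
  then show ?thesis
    using assms unfolding sq_integrable_def L2_def
    by (simp add: borel_measurable_restrict_space_iff integrable_restrict_space)
qed

text \<open>Extension by zero puts forms of all degrees into one inner product space, because the
  components of the abstract equation share a type; degrees survive as subspaces.\<close>

definition cls :: "(real^'n::{finite,linorder}) set \<Rightarrow> 'n::{finite,linorder} form \<Rightarrow> (real^'n::{finite,linorder}, real^('n::{finite,linorder} set)) l2" where
  "cls \<Omega> \<omega> = abs_l2 (\<lambda>x. indicator \<Omega> x *\<^sub>R \<omega> x)"

lemma Alt_subspace: "subspace (Alt j)"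
  by (auto simp: Alt_def subspace_def)

lemma L2_zero: "(\<lambda>x. 0) \<in> L2 \<Omega> j"
  by (simp add: L2_def subspace_0[OF Alt_subspace])

lemma L2_scaleR: "\<omega> \<in> L2 \<Omega> j \<Longrightarrow> (\<lambda>x. c *\<^sub>R \<omega> x) \<in> L2 \<Omega> j"
  by (auto simp: L2_def power_mult_distrib elim!: eventually_mono intro: subspace_scale[OF Alt_subspace])

lemma L2_add:
  assumes "\<omega> \<in> L2 \<Omega> j" "\<eta> \<in> L2 \<Omega> j"
  shows "(\<lambda>x. \<omega> x + \<eta> x) \<in> L2 \<Omega> j"
proof -
  have m: "\<omega> \<in> borel_measurable (lebesgue_on \<Omega>)" "\<eta> \<in> borel_measurable (lebesgue_on \<Omega>)"
    using assms by (auto simp: L2_def)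
  have "integrable (lebesgue_on \<Omega>) (\<lambda>x. (norm (\<omega> x + \<eta> x))\<^sup>2)"
    using assms by (intro integrable_norm_square_add m) (auto simp: L2_def)
  moreover have "AE x in lebesgue_on \<Omega>. \<omega> x + \<eta> x \<in> Alt j"
    using assms by (auto simp: L2_def elim!: eventually_elim2 intro: subspace_add[OF Alt_subspace])
  ultimately show ?thesis using m by (simp add: L2_def)
qed

lemma L2_diff:
  assumes "\<omega> \<in> L2 \<Omega> j" "\<eta> \<in> L2 \<Omega> j"
  shows "(\<lambda>x. \<omega> x - \<eta> x) \<in> L2 \<Omega> j"
  using L2_add[OF assms(1) L2_scaleR[OF assms(2), of "-1"]] by simp

lemma test_forms_L2:
  assumes "open \<Omega>" "\<phi> \<in> test_forms UNIV j"
  shows "\<phi> \<in> L2 \<Omega> j"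
proof -
  obtain K where K: "compact K" "\<And>x. x \<notin> K \<Longrightarrow> \<phi> x = 0"
    using test_formsD(2)[OF assms(2)] by (auto simp: Cc_inf_def)
  have "integrable lborel (\<lambda>x. (norm (\<phi> x))\<^sup>2)"
    by (rule integrable_continuous_compact_support[OF _ K(1)])
      (auto intro!: continuous_intros test_formsD(5)[OF assms(2)] simp: K(2))
  then have "integrable lebesgue (\<lambda>x. (norm (\<phi> x))\<^sup>2)"
    using test_formsD(5)[OF assms(2)]
    by (subst integrable_completion) (auto intro!: borel_measurable_continuous_onI continuous_intros)
  then have "integrable (lebesgue_on \<Omega>) (\<lambda>x. (norm (\<phi> x))\<^sup>2)"
    using assms(1) by (intro integrable_lebesgue_onI) auto
  then show ?thesis
    using test_formsD(3)[OF assms(2)] Cc_inf_D(4)[OF test_formsD(2)[OF assms(2)]]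
    by (auto simp: L2_def intro: borel_measurable_lebesgue_onI)
qed

context
  fixes \<Omega> :: "(real^'n::{finite,linorder}) set"
  assumes \<Omega>: "open \<Omega>"
begin

lemma inner_cls:
  assumes "\<omega> \<in> L2 \<Omega> i" "\<eta> \<in> L2 \<Omega> j"
  shows "cls \<Omega> \<omega> \<bullet> cls \<Omega> \<eta> = ip \<Omega> \<omega> \<eta>"
proof -
  have "cls \<Omega> \<omega> \<bullet> cls \<Omega> \<eta> = (\<integral>x. (indicator \<Omega> x *\<^sub>R \<omega> x) \<bullet> (indicator \<Omega> x *\<^sub>R \<eta> x) \<partial>lebesgue)"
    unfolding cls_def using assms by (intro abs_l2_inner L2_sq_integrable \<Omega>)
  also have "\<dots> = (\<integral>x. indicator \<Omega> x *\<^sub>R (\<omega> x \<bullet> \<eta> x) \<partial>lebesgue)"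
    by (intro Bochner_Integration.integral_cong) (auto simp: indicator_def)
  also have "\<dots> = ip \<Omega> \<omega> \<eta>"
    unfolding ip_def using \<Omega> by (intro integral_restrict_space[symmetric]) auto
  finally show ?thesis .
qed

lemma norm_cls: "\<omega> \<in> L2 \<Omega> i \<Longrightarrow> norm (cls \<Omega> \<omega>) = L2norm \<Omega> \<omega>"
  by (simp add: norm_eq_sqrt_inner inner_cls L2norm_def)

lemma cls_add: "\<omega> \<in> L2 \<Omega> i \<Longrightarrow> \<eta> \<in> L2 \<Omega> j \<Longrightarrow> cls \<Omega> (\<lambda>x. \<omega> x + \<eta> x) = cls \<Omega> \<omega> + cls \<Omega> \<eta>"
  unfolding cls_def by (simp add: scaleR_add_right abs_l2_linear(1) L2_sq_integrable[OF \<Omega>])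

lemma cls_diff: "\<omega> \<in> L2 \<Omega> i \<Longrightarrow> \<eta> \<in> L2 \<Omega> j \<Longrightarrow> cls \<Omega> (\<lambda>x. \<omega> x - \<eta> x) = cls \<Omega> \<omega> - cls \<Omega> \<eta>"
  unfolding cls_def by (simp add: scaleR_diff_right abs_l2_linear(2) L2_sq_integrable[OF \<Omega>])

lemma cls_scaleR: "\<omega> \<in> L2 \<Omega> i \<Longrightarrow> cls \<Omega> (\<lambda>x. c *\<^sub>R \<omega> x) = c *\<^sub>R cls \<Omega> \<omega>"
  unfolding cls_def
  by (subst abs_l2_linear(3)[OF L2_sq_integrable[OF \<Omega>] L2_sq_integrable[OF \<Omega>], symmetric]) (auto simp: mult.commute)

lemma cls_zero: "cls \<Omega> (\<lambda>x. 0) = 0"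
  unfolding cls_def using abs_l2_linear(4) sq_integrable_zero by auto

lemma subspace_cls_L2: "subspace (cls \<Omega> ` L2 \<Omega> j)"
  unfolding subspace_def
  by (auto simp: cls_zero[symmetric] cls_add[symmetric] cls_scaleR[symmetric] intro!: imageI L2_zero L2_add L2_scaleR)

lemma L2_component_integrable:
  assumes "\<omega> \<in> L2 \<Omega> j"
  shows "(\<lambda>x. \<omega> x $ I) \<in> borel_measurable (lebesgue_on \<Omega>)" "integrable (lebesgue_on \<Omega>) (\<lambda>x. (\<omega> x $ I)\<^sup>2)"
proof -
  have m: "\<omega> \<in> borel_measurable (lebesgue_on \<Omega>)" "integrable (lebesgue_on \<Omega>) (\<lambda>x. (norm (\<omega> x))\<^sup>2)"
    using assms by (auto simp: L2_def)
  show *: "(\<lambda>x. \<omega> x $ I) \<in> borel_measurable (lebesgue_on \<Omega>)"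
    by (rule measurable_compose[OF m(1)]) (auto intro!: borel_measurable_continuous_onI continuous_intros)
  show "integrable (lebesgue_on \<Omega>) (\<lambda>x. (\<omega> x $ I)\<^sup>2)"
    by (rule Bochner_Integration.integrable_bound[OF m(2)])
      (use * component_le_norm_cart in \<open>auto intro!: AE_I2 power_mono simp flip: abs_le_square_iff\<close>)
qed

lemma test_forms_dense:
  assumes "bounded \<Omega>"
  shows "cls \<Omega> ` L2 \<Omega> j \<subseteq> closure (cls \<Omega> ` test_forms \<Omega> j)"
proof
  let ?M = "lebesgue_on \<Omega>"
  fix y assume "y \<in> cls \<Omega> ` L2 \<Omega> j"
  then obtain \<omega> where \<omega>: "\<omega> \<in> L2 \<Omega> j" "y = cls \<Omega> \<omega>" by blast
  show "y \<in> closure (cls \<Omega> ` test_forms \<Omega> j)"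
    unfolding closure_approachable
  proof (intro allI impI)
    fix e :: real assume "e > 0"
    \<comment> \<open>The number of components of a form; an error of e^2 / N in each of them adds
      up to e^2.\<close>
    define N where "N = real CARD('n set)"
    have "N > 0" by (simp add: N_def)
    define Q where "Q I \<phi> \<longleftrightarrow> \<phi> \<in> Cc_inf \<Omega> \<and> integrable ?M (\<lambda>x. (\<omega> x $ I - \<phi> x)\<^sup>2) \<and>
      (\<integral>x. (\<omega> x $ I - \<phi> x)\<^sup>2 \<partial>?M) < e\<^sup>2 / N" for I \<phi>
    have "\<exists>\<phi>. Q I \<phi>" for I
      using Cc_approx_L2[OF \<Omega> assms L2_component_integrable[OF \<omega>(1)], of I] \<open>e > 0\<close> \<open>N > 0\<close>
      unfolding Cc_approx_def Q_def by (simp add: Bex_def)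
    then obtain p where "\<And>I. Q I (p I)" by metis
    then have p: "\<And>I. p I \<in> Cc_inf \<Omega>" "\<And>I. integrable ?M (\<lambda>x. (\<omega> x $ I - p I x)\<^sup>2)"
      "\<And>I. (\<integral>x. (\<omega> x $ I - p I x)\<^sup>2 \<partial>?M) < e\<^sup>2 / N" unfolding Q_def by blast+
    define \<phi> :: "'n form" where "\<phi> x = (\<chi> I. if int (card I) = j then p I x else 0)" for x
    have "\<forall>I. \<exists>K. compact K \<and> K \<subseteq> \<Omega> \<and> (\<forall>x. x \<notin> K \<longrightarrow> p I x = 0)"
      using p(1) by (simp add: Cc_inf_def)
    then obtain K where K: "\<And>I. compact (K I)" "\<And>I. K I \<subseteq> \<Omega>" "\<And>I x. x \<notin> K I \<Longrightarrow> p I x = 0" by metis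
    have "compact (\<Union>I. K I)" by (intro compact_UN K) auto
    moreover have "\<phi> x = 0" if "x \<notin> (\<Union>I. K I)" for x using that K(3) by (auto simp: \<phi>_def vec_eq_iff)
    moreover have "Ck_on m UNIV \<phi>" for m
    proof (rule Ck_on_vec)
      fix J show "Ck_on m UNIV (\<lambda>x. \<phi> x $ J)"
        by (cases "int (card J) = j") (auto simp: \<phi>_def intro!: Ck_on_const Cc_inf_D[OF p(1)])
    qed
    moreover have "\<phi> x \<in> Alt j" for x by (simp add: Alt_def \<phi>_def)
    moreover have "(\<Union>I. K I) \<subseteq> \<Omega>" using K(2) by blast
    ultimately have \<phi>: "\<phi> \<in> test_forms \<Omega> j"
      unfolding test_forms_def Cc_inf_def smooth_on_def mem_Collect_eq
      by (intro conjI allI exI[of _ "\<Union>I. K I"]) auto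
    have \<phi>L: "\<phi> \<in> L2 \<Omega> j" by (rule test_forms_L2[OF \<Omega> test_forms_mono[OF subset_UNIV \<phi>]])
    define \<eta> where "\<eta> x = \<omega> x - \<phi> x" for x
    have \<eta>: "\<eta> \<in> L2 \<Omega> j" unfolding \<eta>_def by (rule L2_diff[OF \<omega>(1) \<phi>L])
    have "(norm (cls \<Omega> \<eta>))\<^sup>2 = (\<integral>x. (\<Sum>I\<in>UNIV. (\<eta> x $ I)\<^sup>2) \<partial>?M)"
      unfolding power2_norm_eq_inner inner_cls[OF \<eta> \<eta>] ip_def by (simp add: inner_vec_def power2_eq_square)
    also have "\<dots> = (\<Sum>I\<in>UNIV. \<integral>x. (\<eta> x $ I)\<^sup>2 \<partial>?M)"
      by (intro Bochner_Integration.integral_sum L2_component_integrable(2)[OF \<eta>])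
    also have "\<dots> < (\<Sum>I\<in>(UNIV :: 'n set set). e\<^sup>2 / N)"
    proof (rule sum_strict_mono)
      fix I :: "'n set"
      show "(\<integral>x. (\<eta> x $ I)\<^sup>2 \<partial>?M) < e\<^sup>2 / N"
      proof (cases "int (card I) = j")
        case True
        then show ?thesis using p(3)[of I] by (simp add: \<eta>_def \<phi>_def)
      next
        case False
        have "AE x in ?M. (\<eta> x $ I)\<^sup>2 = 0"
          using \<eta> False by (auto simp: L2_def Alt_def elim!: eventually_mono)
        then have "(\<integral>x. (\<eta> x $ I)\<^sup>2 \<partial>?M) = 0" by (rule integral_eq_zero_AE)
        then show ?thesis using \<open>e > 0\<close> \<open>N > 0\<close> by simp
      qed
    qed auto
    also have "\<dots> = e\<^sup>2" using \<open>N > 0\<close> by (simp add: N_def)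
    finally have "norm (cls \<Omega> \<eta>) < e" using \<open>e > 0\<close> by (simp add: power_less_imp_less_base)
    moreover have "cls \<Omega> \<eta> = y - cls \<Omega> \<phi>" unfolding \<eta>_def \<omega>(2) by (rule cls_diff[OF \<omega>(1) \<phi>L])
    ultimately show "\<exists>z\<in>cls \<Omega> ` test_forms \<Omega> j. dist z y < e"
      using \<phi> by (intro bexI[of _ "cls \<Omega> \<phi>"]) (auto simp: dist_norm norm_minus_commute)
  qed
qed

text \<open>Projection onto degree j. It mediates between \<open>weak_deriv\<close>, which tests
  with every vector of the space, and \<open>W11_time\<close>, which tests with j-forms.\<close>

lemma inner_projection:
  obtains \<eta> where "\<eta> \<in> L2 \<Omega> j" "\<And>\<omega>. \<omega> \<in> L2 \<Omega> j \<Longrightarrow> cls \<Omega> \<omega> \<bullet> v = ip \<Omega> \<omega> \<eta>"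
proof -
  obtain h where h: "v = abs_l2 h" "sq_integrable h" by (rule l2_exhaust)
  define \<eta> :: "'n form" where "\<eta> x = (\<chi> I. if int (card I) = j then h x $ I else 0)" for x
  have hm: "h \<in> borel_measurable lebesgue" "integrable lebesgue (\<lambda>x. (norm (h x))\<^sup>2)"
    using h(2) by (auto simp: sq_integrable_def)
  have "linear (\<lambda>a :: real^('n set). (\<chi> I. if int (card I) = j then a $ I else 0) :: real^('n set))"
    by (rule linearI) (auto simp: vec_eq_iff)
  then have c: "continuous_on UNIV (\<lambda>a :: real^('n set). (\<chi> I. if int (card I) = j then a $ I else 0) :: real^('n set))"
    by (rule linear_continuous_on_compose[OF continuous_on_id])
  have m: "\<eta> \<in> borel_measurable lebesgue" unfolding \<eta>_def
    by (rule measurable_compose[OF hm(1) borel_measurable_continuous_onI[OF c]])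
  have le: "norm (\<eta> x) \<le> norm (h x)" for x
    by (rule norm_le_componentwise_cart) (simp add: \<eta>_def)
  have "integrable lebesgue (\<lambda>x. (norm (\<eta> x))\<^sup>2)"
    by (rule Bochner_Integration.integrable_bound[OF hm(2)]) (use m le in \<open>auto intro!: power_mono\<close>)
  then have "integrable (lebesgue_on \<Omega>) (\<lambda>x. (norm (\<eta> x))\<^sup>2)"
    using \<Omega> by (intro integrable_lebesgue_onI) auto
  moreover have "\<eta> \<in> borel_measurable (lebesgue_on \<Omega>)" using m by (rule measurable_restrict_space1)
  ultimately have \<eta>: "\<eta> \<in> L2 \<Omega> j" by (simp add: L2_def Alt_def \<eta>_def)
  moreover have "cls \<Omega> \<omega> \<bullet> v = ip \<Omega> \<omega> \<eta>" if \<omega>: "\<omega> \<in> L2 \<Omega> j" for \<omega>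
  proof -
    have "AE x in lebesgue. x \<in> \<Omega> \<longrightarrow> \<omega> x \<in> Alt j"
      using \<omega> \<Omega> by (simp add: L2_def AE_restrict_space_iff)
    then have ae: "AE x in lebesgue. (indicator \<Omega> x *\<^sub>R \<omega> x) \<bullet> h x = (indicator \<Omega> x *\<^sub>R \<omega> x) \<bullet> (indicator \<Omega> x *\<^sub>R \<eta> x)"
    proof eventually_elim
      case (elim x)
      show ?case
      proof (cases "x \<in> \<Omega>")
        case True
        then have "\<omega> x $ I * h x $ I = \<omega> x $ I * \<eta> x $ I" for I using elim by (auto simp: Alt_def \<eta>_def)
        then have "(\<Sum>I\<in>UNIV. \<omega> x $ I * h x $ I) = (\<Sum>I\<in>UNIV. \<omega> x $ I * \<eta> x $ I)" by (rule sum.cong[OF refl])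
        then show ?thesis using True by (simp add: inner_vec_def)
      qed simp
    qed
    have "cls \<Omega> \<omega> \<bullet> v = (\<integral>x. (indicator \<Omega> x *\<^sub>R \<omega> x) \<bullet> h x \<partial>lebesgue)"
      unfolding cls_def h(1) by (rule abs_l2_inner[OF L2_sq_integrable[OF \<Omega> \<omega>] h(2)])
    also have "\<dots> = (\<integral>x. (indicator \<Omega> x *\<^sub>R \<omega> x) \<bullet> (indicator \<Omega> x *\<^sub>R \<eta> x) \<partial>lebesgue)"
      by (intro integral_cong_AE ae borel_measurable_integrable sq_integrable_inner L2_sq_integrable[OF \<Omega> \<omega>] h(2)
          L2_sq_integrable[OF \<Omega> \<eta>])
    also have "\<dots> = cls \<Omega> \<omega> \<bullet> cls \<Omega> \<eta>"
      unfolding cls_def by (rule abs_l2_inner[symmetric, OF L2_sq_integrable[OF \<Omega> \<omega>] L2_sq_integrable[OF \<Omega> \<eta>]])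
    finally show ?thesis by (simp add: inner_cls[OF \<omega> \<eta>])
  qed
  ultimately show thesis by (rule that)
qed

section \<open>The graph of d on forms with zero trace\<close>

text \<open>A relation between classes, as \<open>ext_d\<close> is a choice of representative.
  Testing with forms smooth up to the boundary expresses the derivative and the zero trace in a
  single condition; \<open>H0_d0_graph\<close> and \<open>d0_graph_H0\<close> translate to and from
  \<open>H0\<close>.\<close>

definition d0_graph :: "int \<Rightarrow> ((real^'n::{finite,linorder}, real^('n::{finite,linorder} set)) l2 \<times> (real^'n::{finite,linorder}, real^('n::{finite,linorder} set)) l2) set" where
  "d0_graph j = {(cls \<Omega> \<omega>, cls \<Omega> \<eta>) | \<omega> \<eta>. \<omega> \<in> L2 \<Omega> j \<and> \<eta> \<in> L2 \<Omega> (j + 1) \<and>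
     (\<forall>\<mu>\<in>test_forms UNIV (j + 1). ip \<Omega> \<eta> \<mu> = ip \<Omega> \<omega> (smooth_\<delta> \<mu>))}"

lemma test_L2: "\<phi> \<in> test_forms UNIV j \<Longrightarrow> \<phi> \<in> L2 \<Omega> j"
  by (rule test_forms_L2[OF \<Omega>])

lemma test_\<delta>_L2: "\<phi> \<in> test_forms UNIV (j + 1) \<Longrightarrow> smooth_\<delta> \<phi> \<in> L2 \<Omega> j"
  using smooth_\<delta>_test_forms[of \<phi> UNIV "j + 1"] by (simp add: test_L2)

lemma d0_graph_iff:
  "(x, y) \<in> d0_graph j \<longleftrightarrow> x \<in> cls \<Omega> ` L2 \<Omega> j \<and> y \<in> cls \<Omega> ` L2 \<Omega> (j + 1) \<and>
     (\<forall>\<mu>\<in>test_forms UNIV (j + 1). y \<bullet> cls \<Omega> \<mu> = x \<bullet> cls \<Omega> (smooth_\<delta> \<mu>))"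
proof -
  have "(\<forall>\<mu>\<in>test_forms UNIV (j + 1). ip \<Omega> \<eta> \<mu> = ip \<Omega> \<omega> (smooth_\<delta> \<mu>)) \<longleftrightarrow>
    (\<forall>\<mu>\<in>test_forms UNIV (j + 1). cls \<Omega> \<eta> \<bullet> cls \<Omega> \<mu> = cls \<Omega> \<omega> \<bullet> cls \<Omega> (smooth_\<delta> \<mu>))"
    if "\<omega> \<in> L2 \<Omega> j" "\<eta> \<in> L2 \<Omega> (j + 1)" for \<omega> \<eta>
    by (intro ball_cong refl) (simp add: inner_cls[OF that(2) test_L2] inner_cls[OF that(1) test_\<delta>_L2])
  then show ?thesis unfolding d0_graph_def by blast
qed

lemma subspace_d0_graph: "subspace (d0_graph j)"
  unfolding subspace_def
proof (intro conjI ballI allI)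
  show "0 \<in> d0_graph j"
    unfolding zero_prod_def d0_graph_iff using subspace_0[OF subspace_cls_L2] by simp
next
  fix p q assume "p \<in> d0_graph j" "q \<in> d0_graph j"
  then show "p + q \<in> d0_graph j"
    by (cases p; cases q) (auto simp: d0_graph_iff inner_add_left intro: subspace_add[OF subspace_cls_L2])
next
  fix c p assume "p \<in> d0_graph j"
  then show "c *\<^sub>R p \<in> d0_graph j"
    by (cases p) (auto simp: d0_graph_iff intro: subspace_scale[OF subspace_cls_L2])
qed

text \<open>By duality with \<delta> \<delta> = 0. The zero trace of the derivative comes along,
  because the test forms may reach the boundary.\<close>

lemma d0_graph_complex:
  assumes "(x, y) \<in> d0_graph j" shows "(y, 0) \<in> d0_graph (j + 1)"
  unfolding d0_graph_iff
proof (intro conjI ballI)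
  show "y \<in> cls \<Omega> ` L2 \<Omega> (j + 1)" using assms by (simp add: d0_graph_iff)
  show "0 \<in> cls \<Omega> ` L2 \<Omega> (j + 1 + 1)" by (rule subspace_0[OF subspace_cls_L2])
  fix \<mu> :: "'n form" assume \<mu>: "\<mu> \<in> test_forms UNIV (j + 1 + 1)"
  have "smooth_\<delta> \<mu> \<in> test_forms UNIV (j + 1)" using smooth_\<delta>_test_forms[OF \<mu>] by (simp add: add.commute)
  then have "y \<bullet> cls \<Omega> (smooth_\<delta> \<mu>) = x \<bullet> cls \<Omega> (smooth_\<delta> (smooth_\<delta> \<mu>))"
    using assms by (simp add: d0_graph_iff)
  also have "smooth_\<delta> (smooth_\<delta> \<mu>) = (\<lambda>x. 0)" using smooth_\<delta>_smooth_\<delta>[OF \<mu>] by (simp add: fun_eq_iff)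
  finally show "0 \<bullet> cls \<Omega> \<mu> = y \<bullet> cls \<Omega> (smooth_\<delta> \<mu>)" by (simp add: cls_zero)
qed

lemma test_d0_graph:
  assumes \<phi>: "\<phi> \<in> test_forms \<Omega> j"
  shows "(cls \<Omega> \<phi>, cls \<Omega> (smooth_d \<phi>)) \<in> d0_graph j"
proof -
  have "\<phi> \<in> L2 \<Omega> j" "smooth_d \<phi> \<in> L2 \<Omega> (j + 1)"
    using \<phi> smooth_d_test_forms[OF \<phi>] by (auto intro!: test_L2 intro: test_forms_mono[OF subset_UNIV])
  then show ?thesis using smooth_d_adjoint[OF \<Omega> \<phi>] unfolding d0_graph_def by blast
qed

lemma has_d_ext_d: "has_d \<Omega> j \<omega> \<eta> \<Longrightarrow> has_d \<Omega> j \<omega> (ext_d \<Omega> j \<omega>)"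
  unfolding ext_d_def by (rule someI[of "\<lambda>\<eta>. has_d \<Omega> j \<omega> \<eta>"])

lemma H0_d0_graph:
  assumes \<omega>: "\<omega> \<in> H0 \<Omega> j"
  shows "(cls \<Omega> \<omega>, cls \<Omega> (ext_d \<Omega> j \<omega>)) \<in> d0_graph j" "\<omega> \<in> L2 \<Omega> j" "ext_d \<Omega> j \<omega> \<in> L2 \<Omega> (j + 1)"
proof -
  have "has_d \<Omega> j \<omega> (ext_d \<Omega> j \<omega>)"
    using \<omega> has_d_ext_d by (auto simp: H0_def Hd_def)
  then show *: "\<omega> \<in> L2 \<Omega> j" "ext_d \<Omega> j \<omega> \<in> L2 \<Omega> (j + 1)" by (auto simp: has_d_def)
  show "(cls \<Omega> \<omega>, cls \<Omega> (ext_d \<Omega> j \<omega>)) \<in> d0_graph j"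
    using \<omega> * unfolding d0_graph_def H0_def trace_pairing_def by auto
qed

lemma cls_eq_0I:
  assumes "bounded \<Omega>" "x \<in> cls \<Omega> ` L2 \<Omega> j" "\<And>\<phi>. \<phi> \<in> test_forms \<Omega> j \<Longrightarrow> x \<bullet> cls \<Omega> \<phi> = 0"
  shows "x = 0"
proof -
  have "closed {c. x \<bullet> c = 0}" by (intro closed_Collect_eq continuous_intros)
  then have "closure (cls \<Omega> ` test_forms \<Omega> j) \<subseteq> {c. x \<bullet> c = 0}" using assms(3) by (intro closure_minimal) auto
  then have "x \<bullet> x = 0" using test_forms_dense[OF assms(1)] assms(2) by blast
  then show ?thesis by simp
qed

lemma d0_graph_H0:
  assumes "bounded \<Omega>" and xy: "(x, y) \<in> d0_graph j"
  obtains \<omega> where "\<omega> \<in> H0 \<Omega> j" "x = cls \<Omega> \<omega>" "y = cls \<Omega> (ext_d \<Omega> j \<omega>)"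
proof -
  obtain \<omega> \<eta> where \<omega>: "\<omega> \<in> L2 \<Omega> j" "\<eta> \<in> L2 \<Omega> (j + 1)" "x = cls \<Omega> \<omega>" "y = cls \<Omega> \<eta>"
    "\<And>\<mu>. \<mu> \<in> test_forms UNIV (j + 1) \<Longrightarrow> ip \<Omega> \<eta> \<mu> = ip \<Omega> \<omega> (smooth_\<delta> \<mu>)"
    using xy unfolding d0_graph_def by blast
  have d: "has_d \<Omega> j \<omega> \<eta>"
    unfolding has_d_def using \<omega> test_forms_mono[OF subset_UNIV] by blast
  then have e: "has_d \<Omega> j \<omega> (ext_d \<Omega> j \<omega>)" by (rule has_d_ext_d)
  then have eL: "ext_d \<Omega> j \<omega> \<in> L2 \<Omega> (j + 1)" by (simp add: has_d_def)
  \<comment> \<open>The chosen derivative and \<eta> agree against compactly supported forms, hence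
    as classes by density; this carries the boundary condition from \<eta> over to the chosen
    one.\<close>
  have "cls \<Omega> (ext_d \<Omega> j \<omega>) - cls \<Omega> \<eta> = 0"
  proof (rule cls_eq_0I[OF assms(1)])
    show "cls \<Omega> (ext_d \<Omega> j \<omega>) - cls \<Omega> \<eta> \<in> cls \<Omega> ` L2 \<Omega> (j + 1)"
      using eL \<omega>(2) by (intro subspace_diff[OF subspace_cls_L2]) auto
    fix \<phi> :: "'n form" assume \<phi>: "\<phi> \<in> test_forms \<Omega> (j + 1)"
    then have "ip \<Omega> (ext_d \<Omega> j \<omega>) \<phi> = ip \<Omega> \<eta> \<phi>" using d e by (simp add: has_d_def)
    then show "(cls \<Omega> (ext_d \<Omega> j \<omega>) - cls \<Omega> \<eta>) \<bullet> cls \<Omega> \<phi> = 0"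
      using eL \<omega>(2) test_L2[OF test_forms_mono[OF subset_UNIV \<phi>]] by (simp add: inner_diff_left inner_cls)
  qed
  then have eq: "cls \<Omega> (ext_d \<Omega> j \<omega>) = cls \<Omega> \<eta>" by simp
  have "trace_pairing \<Omega> j \<omega> \<mu> = 0" if \<mu>: "\<mu> \<in> test_forms UNIV (j + 1)" for \<mu>
  proof -
    have "ip \<Omega> (ext_d \<Omega> j \<omega>) \<mu> = ip \<Omega> \<eta> \<mu>"
      using eq inner_cls[OF eL test_L2[OF \<mu>]] inner_cls[OF \<omega>(2) test_L2[OF \<mu>]] by simp
    then show ?thesis using \<omega>(5)[OF \<mu>] by (simp add: trace_pairing_def)
  qed
  then have "\<omega> \<in> H0 \<Omega> j" using d by (auto simp: H0_def Hd_def)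
  then show thesis using \<omega> eq by (intro that[of \<omega>]) auto
qed

lemma Hstar_codiff:
  assumes "\<mu> \<in> Hstar \<Omega> j"
  shows "\<mu> \<in> L2 \<Omega> j" "codiff \<Omega> j \<mu> \<in> L2 \<Omega> (j - 1)"
    "\<phi> \<in> test_forms \<Omega> (j - 1) \<Longrightarrow> cls \<Omega> (codiff \<Omega> j \<mu>) \<bullet> cls \<Omega> \<phi> = cls \<Omega> \<mu> \<bullet> cls \<Omega> (smooth_d \<phi>)"
proof -
  have h: "has_\<delta> \<Omega> j \<mu> (codiff \<Omega> j \<mu>)"
    using assms someI_ex[of "\<lambda>\<rho>. has_\<delta> \<Omega> j \<mu> \<rho>"] unfolding codiff_def Hstar_def by blast
  then show *: "\<mu> \<in> L2 \<Omega> j" "codiff \<Omega> j \<mu> \<in> L2 \<Omega> (j - 1)" by (auto simp: has_\<delta>_def)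
  assume \<phi>: "\<phi> \<in> test_forms \<Omega> (j - 1)"
  have "smooth_d \<phi> \<in> test_forms UNIV j"
    using test_forms_mono[OF subset_UNIV smooth_d_test_forms[OF \<phi>]] by simp
  then have "smooth_d \<phi> \<in> L2 \<Omega> j" by (rule test_L2)
  then show "cls \<Omega> (codiff \<Omega> j \<mu>) \<bullet> cls \<Omega> \<phi> = cls \<Omega> \<mu> \<bullet> cls \<Omega> (smooth_d \<phi>)"
    using h \<phi> * test_L2[OF test_forms_mono[OF subset_UNIV \<phi>]] by (simp add: has_\<delta>_def inner_cls)
qed

end

section \<open>Time-dependent forms\<close>

text \<open>Completeness of Lebesgue measure: every subset of \<open>N\<close> is measurable,
  whatever the values of \<open>u\<close> there.\<close>

lemma borel_measurable_lebesgue_on_spike: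
  fixes u :: "'a::euclidean_space \<Rightarrow> real"
  assumes S: "S \<in> sets lebesgue" and u': "u' \<in> borel_measurable (lebesgue_on S)"
    and N: "negligible N" "\<And>x. x \<in> S - N \<Longrightarrow> u x = u' x"
  shows "u \<in> borel_measurable (lebesgue_on S)"
proof (rule measurableI)
  fix A :: "real set" assume A: "A \<in> sets borel"
  have "u' -` A \<inter> space (lebesgue_on S) \<in> sets (lebesgue_on S)" using u' A by (rule measurable_sets)
  then have 1: "u' -` A \<inter> S \<in> sets lebesgue" using S by (auto simp: sets_restrict_space_iff)
  have 2: "B \<in> sets lebesgue" if "B \<subseteq> N" for B
    using negligible_subset[OF N(1) that] by (rule negligible_imp_sets)
  have "u -` A \<inter> S = (u' -` A \<inter> S - N) \<union> (u -` A \<inter> S \<inter> N)" using N(2) by auto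
  also have "\<dots> \<in> sets lebesgue" using 1 2[of N] 2[of "u -` A \<inter> S \<inter> N"] by auto
  finally show "u -` A \<inter> space (lebesgue_on S) \<in> sets (lebesgue_on S)"
    using S by (auto simp: sets_restrict_space_iff)
qed auto

lemma borel_measurable_AE_LIMSEQ:
  fixes u :: "'a::euclidean_space \<Rightarrow> real"
  assumes S: "S \<in> sets lebesgue" and U: "\<And>i. U i \<in> borel_measurable (lebesgue_on S)"
    and lim: "AE x in lebesgue_on S. (\<lambda>i. U i x) \<longlonglongrightarrow> u x"
  shows "u \<in> borel_measurable (lebesgue_on S)"
proof -
  obtain N where N: "negligible N" "\<And>x. x \<in> S - N \<Longrightarrow> (\<lambda>i. U i x) \<longlonglongrightarrow> u x"
    using lim unfolding AE_lebesgue_on_negligible[OF S] by blast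
  define U' where "U' i x = (if x \<in> N then 0 else U i x)" for i x
  define u' where "u' x = (if x \<in> N then 0 else u x)" for x
  have U': "U' i \<in> borel_measurable (lebesgue_on S)" for i
    by (rule borel_measurable_lebesgue_on_spike[OF S U N(1)]) (simp add: U'_def)
  have "u' \<in> borel_measurable (lebesgue_on S)"
    by (rule borel_measurable_LIMSEQ_real[of "lebesgue_on S" U' u', OF _ U']) (use N(2) in \<open>auto simp: U'_def u'_def\<close>)
  then show ?thesis
    by (rule borel_measurable_lebesgue_on_spike[OF S _ N(1)]) (simp add: u'_def)
qed

lemma time_AE: "(AE t in time T. P t) \<longleftrightarrow> (\<exists>N. negligible N \<and> (\<forall>t\<in>{0..T} - N. P t))"
proof -
  have "(AE t in time T. P t) \<longleftrightarrow> (\<exists>N. negligible N \<and> (\<forall>t\<in>{0<..<T} - N. P t))"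
    by (rule AE_lebesgue_on_negligible) simp
  also have "\<dots> \<longleftrightarrow> (\<exists>N. negligible N \<and> (\<forall>t\<in>{0..T} - N. P t))"
  proof
    assume "\<exists>N. negligible N \<and> (\<forall>t\<in>{0<..<T} - N. P t)"
    then obtain N where "negligible N" "\<forall>t\<in>{0<..<T} - N. P t" by blast
    then show "\<exists>N. negligible N \<and> (\<forall>t\<in>{0..T} - N. P t)"
      by (intro exI[of _ "N \<union> {0, T}"]) auto
  next
    assume "\<exists>N. negligible N \<and> (\<forall>t\<in>{0..T} - N. P t)"
    then show "\<exists>N. negligible N \<and> (\<forall>t\<in>{0<..<T} - N. P t)" by force
  qed
  finally show ?thesis .
qed

lemma time_AE_point:
  assumes "T > 0" "AE t in time T. P t"
  obtains t where "t \<in> {0..T}" "P t"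
proof -
  obtain N where N: "negligible N" "\<forall>t\<in>{0..T} - N. P t" using assms(2) unfolding time_AE by blast
  have "\<not> negligible {0..T}" using assms(1) negligible_interval(1)[of 0 T] by simp
  then have "\<not> {0..T} \<subseteq> N" using N(1) negligible_subset by blast
  then show thesis using N(2) that by blast
qed

lemma ip_self_nonneg: "0 \<le> ip \<Omega> \<omega> \<omega>"
  unfolding ip_def by (rule integral_nonneg_AE) simp

lemma L2norm_nonneg: "0 \<le> L2norm \<Omega> \<omega>"
  unfolding L2norm_def using ip_self_nonneg by simp

lemma eq_L2_zero:
  assumes "eq_L2 \<Omega> \<omega> (\<lambda>_. 0)"
  shows "ip \<Omega> \<omega> \<eta> = 0" "L2norm \<Omega> \<omega> = 0"
proof -
  show *: "ip \<Omega> \<omega> \<eta> = 0" for \<eta>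
    unfolding ip_def by (rule integral_eq_zero_AE) (use assms in \<open>auto simp: eq_L2_def elim!: eventually_mono\<close>)
  show "L2norm \<Omega> \<omega> = 0" by (simp add: L2norm_def *)
qed

context
  fixes \<Omega> :: "(real^'n::{finite,linorder}) set"
  assumes \<Omega>: "open \<Omega>"
begin

lemma L1_time_AE: "f \<in> L1_time \<Omega> j T \<Longrightarrow> AE t in time T. f t \<in> L2 \<Omega> j"
  by (simp add: L1_time_def)

text \<open>Cauchy-Schwarz bounds the pairing by an integrable function; it is measurable as the
  limit almost everywhere of its values along the simple approximants.\<close>

lemma L1_time_inner:
  assumes f: "f \<in> L1_time \<Omega> j T" and v: "v \<in> L2 \<Omega> j"
  shows "integrable (time T) (\<lambda>t. ip \<Omega> (f t) v)"
proof (rule Bochner_Integration.integrable_bound)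
  show "integrable (time T) (\<lambda>t. L2norm \<Omega> (f t) * L2norm \<Omega> v)" using f by (simp add: L1_time_def)
  have fL: "AE t in time T. f t \<in> L2 \<Omega> j" using f by (simp add: L1_time_def)
  then show "AE t in time T. norm (ip \<Omega> (f t) v) \<le> norm (L2norm \<Omega> (f t) * L2norm \<Omega> v)"
  proof eventually_elim
    case (elim t)
    then show ?case
      using Cauchy_Schwarz_ineq2[of "cls \<Omega> (f t)" "cls \<Omega> v"] v
      by (simp add: inner_cls[OF \<Omega>] norm_cls[OF \<Omega>] abs_mult L2norm_nonneg)
  qed
  obtain s where s: "\<And>i. simple_function (time T) (s i)" "\<And>i t. s i t \<in> L2 \<Omega> j"
    "AE t in time T. (\<lambda>i. L2norm \<Omega> (\<lambda>x. s i t x - f t x)) \<longlonglongrightarrow> 0"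
    using f unfolding L1_time_def by blast
  have lim: "AE t in time T. (\<lambda>i. ip \<Omega> (s i t) v) \<longlonglongrightarrow> ip \<Omega> (f t) v"
    using s(3) fL
  proof eventually_elim
    case (elim t)
    have *: "L2norm \<Omega> (\<lambda>x. s i t x - f t x) = norm (cls \<Omega> (s i t) - cls \<Omega> (f t))" for i
      using norm_cls[OF \<Omega> L2_diff[OF s(2) elim(2)]] cls_diff[OF \<Omega> s(2) elim(2)] by simp
    have "(\<lambda>i. cls \<Omega> (s i t)) \<longlonglongrightarrow> cls \<Omega> (f t)"
      using elim(1) unfolding * by (rule tendsto_norm_zero_cancel[THEN LIM_zero_cancel])
    then have "(\<lambda>i. cls \<Omega> (s i t) \<bullet> cls \<Omega> v) \<longlonglongrightarrow> cls \<Omega> (f t) \<bullet> cls \<Omega> v" by (intro tendsto_intros)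
    then show ?case by (simp add: inner_cls[OF \<Omega> s(2) v] inner_cls[OF \<Omega> elim(2) v])
  qed
  show "(\<lambda>t. ip \<Omega> (f t) v) \<in> borel_measurable (time T)"
  proof (rule borel_measurable_AE_LIMSEQ[OF _ _ lim])
    show "(\<lambda>t. ip \<Omega> (s i t) v) \<in> borel_measurable (time T)" for i
      using simple_function_compose1[OF s(1), of "\<lambda>h. ip \<Omega> h v" i] by (rule borel_measurable_simple_function)
  qed simp
qed

lemma W11_time_weak:
  assumes w: "W11_time \<Omega> j T f g" and "T > 0"
  shows "\<exists>c M. negligible M \<and> (\<forall>r\<in>{0..T} - M. ((\<lambda>x. cls \<Omega> (g x) \<bullet> v) has_integral (cls \<Omega> (f r) \<bullet> v - c)) {0..r})"
proof -
  obtain \<eta> where \<eta>: "\<eta> \<in> L2 \<Omega> j" "\<And>\<omega>. \<omega> \<in> L2 \<Omega> j \<Longrightarrow> cls \<Omega> \<omega> \<bullet> v = ip \<Omega> \<omega> \<eta>"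
    using inner_projection[OF \<Omega>, of j v] by blast
  have f: "f \<in> L1_time \<Omega> j T" and g: "g \<in> L1_time \<Omega> j T" using w by (auto simp: W11_time_def)
  obtain N1 where N1: "negligible N1" "\<And>t. t \<in> {0..T} - N1 \<Longrightarrow> f t \<in> L2 \<Omega> j"
    using L1_time_AE[OF f, unfolded time_AE] by blast
  obtain N2 where N2: "negligible N2" "\<And>t. t \<in> {0..T} - N2 \<Longrightarrow> g t \<in> L2 \<Omega> j"
    using L1_time_AE[OF g, unfolded time_AE] by blast
  have "\<exists>c N. negligible N \<and> (\<forall>t\<in>{0..T} - N. ((\<lambda>t. ip \<Omega> (g t) \<eta>) has_integral (ip \<Omega> (f t) \<eta> - c)) {0..t})"
    by (rule du_Bois_Reymond[OF \<open>T > 0\<close> L1_time_inner[OF f \<eta>(1)] L1_time_inner[OF g \<eta>(1)]])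
      (use w \<eta>(1) in \<open>simp add: W11_time_def\<close>)
  then obtain c N where N: "negligible N"
    "\<And>t. t \<in> {0..T} - N \<Longrightarrow> ((\<lambda>t. ip \<Omega> (g t) \<eta>) has_integral (ip \<Omega> (f t) \<eta> - c)) {0..t}" by blast
  have "((\<lambda>x. cls \<Omega> (g x) \<bullet> v) has_integral (cls \<Omega> (f r) \<bullet> v - c)) {0..r}" if r: "r \<in> {0..T} - (N \<union> N1)" for r
  proof -
    have "((\<lambda>t. ip \<Omega> (g t) \<eta>) has_integral (cls \<Omega> (f r) \<bullet> v - c)) {0..r}"
      using N(2)[of r] \<eta>(2)[OF N1(2), of r] r by auto
    then show ?thesis
      by (rule has_integral_spike[OF N2(1), rotated]) (use N2(2) \<eta>(2) r in auto)
  qed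
  then show ?thesis using N(1) N1(1) by (intro exI[of _ c] exI[of _ "N \<union> N1"]) auto
qed

lemma L1_time_norm:
  assumes g: "g \<in> L1_time \<Omega> j T"
  obtains N where "negligible N" "\<And>t. t \<in> {0..T} - N \<Longrightarrow> g t \<in> L2 \<Omega> j"
    "\<And>t. t \<in> {0..T} - N \<Longrightarrow> norm (cls \<Omega> (g t)) = L2norm \<Omega> (g t)"
    "(\<lambda>t. L2norm \<Omega> (g t)) integrable_on {0..T}"
    "integral\<^sup>L (time T) (\<lambda>t. L2norm \<Omega> (g t)) = integral {0..T} (\<lambda>t. L2norm \<Omega> (g t))"
proof -
  obtain N where N: "negligible N" "\<And>t. t \<in> {0..T} - N \<Longrightarrow> g t \<in> L2 \<Omega> j"
    using L1_time_AE[OF g, unfolded time_AE] by blast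
  have i: "integrable (time T) (\<lambda>t. L2norm \<Omega> (g t))" using g by (simp add: L1_time_def)
  show thesis by (rule that[OF N norm_cls[OF \<Omega> N(2)] time_integral(2,3)[OF i]])
qed

lemma W11_time_weak_deriv:
  assumes w: "W11_time \<Omega> j T u g" and "T > 0" and c: "continuous_time \<Omega> T u"
    and L: "\<And>t. t \<in> {0..T} \<Longrightarrow> u t \<in> L2 \<Omega> j"
  shows "weak_deriv 0 T (\<lambda>t. cls \<Omega> (u t)) (\<lambda>t. cls \<Omega> (g t))"
proof -
  have cont: "continuous_on {0..T} (\<lambda>t. cls \<Omega> (u t))"
    unfolding continuous_on_def
  proof
    fix t assume t: "t \<in> {0..T}"
    have "((\<lambda>s. L2norm \<Omega> (\<lambda>x. u s x - u t x)) \<longlongrightarrow> 0) (at t within {0..T})"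
      using c t by (simp add: continuous_time_def)
    moreover have "\<forall>\<^sub>F s in at t within {0..T}. L2norm \<Omega> (\<lambda>x. u s x - u t x) = norm (cls \<Omega> (u s) - cls \<Omega> (u t))"
      unfolding eventually_at_filter
      by (intro always_eventually allI impI) (simp add: norm_cls[OF \<Omega> L2_diff[OF L L[OF t]], symmetric] cls_diff[OF \<Omega> L L[OF t]])
    ultimately have "((\<lambda>s. norm (cls \<Omega> (u s) - cls \<Omega> (u t))) \<longlongrightarrow> 0) (at t within {0..T})"
      by (rule Lim_transform_eventually)
    then show "((\<lambda>t. cls \<Omega> (u t)) \<longlongrightarrow> cls \<Omega> (u t)) (at t within {0..T})"
      by (rule tendsto_norm_zero_cancel[THEN LIM_zero_cancel])
  qed
  have g: "g \<in> L1_time \<Omega> j T" using w by (simp add: W11_time_def)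
  obtain N where N: "negligible N" "\<And>t. t \<in> {0..T} - N \<Longrightarrow> norm (cls \<Omega> (g t)) = L2norm \<Omega> (g t)"
    "(\<lambda>t. L2norm \<Omega> (g t)) integrable_on {0..T}"
    by (rule L1_time_norm[OF g]) (rule that; assumption)
  have "((\<lambda>r. cls \<Omega> (g r) \<bullet> v) has_integral (cls \<Omega> (u t) - cls \<Omega> (u s)) \<bullet> v) {s..t}"
    if st: "0 \<le> s" "s \<le> t" "t \<le> T" for v s t
  proof -
    define h where "h r = cls \<Omega> (g r) \<bullet> v" for r
    define F where "F r = cls \<Omega> (u r) \<bullet> v" for r
    obtain c M where M: "negligible M" "\<And>r. r \<in> {0..T} - M \<Longrightarrow> (h has_integral (F r - c)) {0..r}"
      using W11_time_weak[OF w \<open>T > 0\<close>, of v] unfolding h_def F_def by blast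
    have hi: "h integrable_on {0..T}"
    proof -
      obtain \<eta> where \<eta>: "\<eta> \<in> L2 \<Omega> j" "\<And>\<omega>. \<omega> \<in> L2 \<Omega> j \<Longrightarrow> cls \<Omega> \<omega> \<bullet> v = ip \<Omega> \<omega> \<eta>"
        using inner_projection[OF \<Omega>, of j v] by blast
      obtain N2 where N2: "negligible N2" "\<And>t. t \<in> {0..T} - N2 \<Longrightarrow> g t \<in> L2 \<Omega> j"
        using L1_time_AE[OF g, unfolded time_AE] by blast
      show ?thesis
        by (rule integrable_spike[OF time_integral(2)[OF L1_time_inner[OF g \<eta>(1)]] N2(1)])
          (use N2(2) \<eta>(2) in \<open>auto simp: h_def\<close>)
    qed
    \<comment> \<open>Continuous and zero off a null set, so zero on [0, T]. This is where the
      continuous representative enters: the integral formula then holds for all pairs of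
      times.\<close>
    define D where "D r = F r - c - integral {0..r} h" for r
    have Dc: "continuous_on {0..T} D"
      unfolding D_def F_def by (intro continuous_intros cont indefinite_integral_continuous_1 hi)
    have "D r = 0" if r: "r \<in> {0..T}" for r
    proof (rule continuous_constant_on_closure[where f = D and S = "{0..T} - M"])
      show "continuous_on (closure ({0..T} - M)) D" "r \<in> closure ({0..T} - M)"
        using Dc r closure_minus_negligible[OF M(1) \<open>T > 0\<close>] by simp_all
      show "D x = 0" if "x \<in> {0..T} - M" for x using M(2)[OF that] by (simp add: D_def integral_unique)
    qed
    then have "D t - D s = 0" using st by simp
    moreover have "integral {0..s} h + integral {s..t} h = integral {0..t} h"
      by (intro Henstock_Kurzweil_Integration.integral_combine integrable_on_subinterval[OF hi]) (use st in auto)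
    ultimately have "F t - F s = integral {s..t} h" by (simp add: D_def)
    moreover have "h integrable_on {s..t}" by (rule integrable_on_subinterval[OF hi]) (use st in auto)
    ultimately have "(h has_integral (F t - F s)) {s..t}" by (simp add: has_integral_integral)
    then show ?thesis by (simp add: h_def[abs_def] F_def inner_diff_left)
  qed
  then show ?thesis unfolding weak_deriv_def
    using cont N by (intro conjI exI[of _ "\<lambda>t. L2norm \<Omega> (g t)"] exI[of _ N]) auto
qed

text \<open>The null set on which the pairing with \<open>v\<close> may fail to vanish depends on
  \<open>v\<close>. The values of the approximating simple functions form a countable family for
  which one null set serves, and <g, g> is the limit of <g, s_i>.\<close>

lemma L1_time_eq_0:
  assumes g: "g \<in> L1_time \<Omega> j T" and 0: "\<And>v. v \<in> L2 \<Omega> j \<Longrightarrow> AE t in time T. ip \<Omega> (g t) v = 0"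
  shows "AE t in time T. L2norm \<Omega> (g t) = 0"
proof -
  obtain s where s: "\<And>i. simple_function (time T) (s i)" "\<And>i t. s i t \<in> L2 \<Omega> j"
    "AE t in time T. (\<lambda>i. L2norm \<Omega> (\<lambda>x. s i t x - g t x)) \<longlonglongrightarrow> 0"
    using g unfolding L1_time_def by blast
  have gL: "AE t in time T. g t \<in> L2 \<Omega> j" using g by (simp add: L1_time_def)
  have "AE t in time T. \<forall>i. \<forall>v\<in>s i ` space (time T). ip \<Omega> (g t) v = 0"
    unfolding AE_all_countable
  proof
    fix i show "AE t in time T. \<forall>v\<in>s i ` space (time T). ip \<Omega> (g t) v = 0"
      using s(1)[of i] s(2) by (intro AE_finite_allI) (auto simp: simple_function_def intro: 0)
  qed
  with gL s(3) AE_space show ?thesis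
  proof eventually_elim
    case (elim t)
    have *: "L2norm \<Omega> (\<lambda>x. s i t x - g t x) = norm (cls \<Omega> (s i t) - cls \<Omega> (g t))" for i
      using norm_cls[OF \<Omega> L2_diff[OF s(2) elim(1)]] cls_diff[OF \<Omega> s(2) elim(1)] by simp
    have "(\<lambda>i. cls \<Omega> (s i t)) \<longlonglongrightarrow> cls \<Omega> (g t)"
      using elim(2) unfolding * by (rule tendsto_norm_zero_cancel[THEN LIM_zero_cancel])
    then have "(\<lambda>i. cls \<Omega> (g t) \<bullet> cls \<Omega> (s i t)) \<longlonglongrightarrow> cls \<Omega> (g t) \<bullet> cls \<Omega> (g t)" by (intro tendsto_intros)
    moreover have "cls \<Omega> (g t) \<bullet> cls \<Omega> (s i t) = 0" for i
      using elim(3,4) inner_cls[OF \<Omega> elim(1) s(2)] by auto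
    ultimately have "cls \<Omega> (g t) \<bullet> cls \<Omega> (g t) = 0" by (simp add: LIMSEQ_const_iff)
    then show ?case using norm_cls[OF \<Omega> elim(1)] by simp
  qed
qed

text \<open>Needed for the equality in the case f = 0: the time derivative must vanish too, so that
  the right-hand side reduces to H(0).\<close>

lemma W11_time_deriv_zero:
  assumes w: "W11_time \<Omega> j T f g" and 0: "AE t in time T. eq_L2 \<Omega> (f t) (\<lambda>_. 0)"
  shows "AE t in time T. L2norm \<Omega> (g t) = 0"
proof (rule L1_time_eq_0)
  show g: "g \<in> L1_time \<Omega> j T" using w by (simp add: W11_time_def)
  fix v assume v: "v \<in> L2 \<Omega> j"
  have "\<exists>N. negligible N \<and> (\<forall>t\<in>{0<..<T} - N. ip \<Omega> (g t) v = 0)"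
  proof (rule fundamental_lemma[OF _ L1_time_inner[OF g v]])
    fix \<phi> :: "real \<Rightarrow> real" assume \<phi>: "\<phi> \<in> Cc_inf {0<..<T}"
    have "(\<integral>t. deriv \<phi> t * ip \<Omega> (f t) v \<partial>time T) = 0"
      by (rule integral_eq_zero_AE) (use 0 in \<open>auto elim!: eventually_mono simp: eq_L2_zero\<close>)
    then show "(\<integral>t. \<phi> t * ip \<Omega> (g t) v \<partial>time T) = 0" using w \<phi> v by (simp add: W11_time_def)
  qed simp
  then show "AE t in time T. ip \<Omega> (g t) v = 0" by (simp add: AE_lebesgue_on_negligible)
qed

end

section \<open>The Hodge wave equation\<close>

text \<open>The third test space is the domain of d on (k+1)-forms with zero trace, taken as the
  first projection of its graph.\<close>

abbreviation hodge_mixed_wave where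
  "hodge_mixed_wave \<Omega> k T \<sigma> \<mu> \<omega> \<equiv> mixed_wave T (d0_graph \<Omega> (k - 1)) (d0_graph \<Omega> k) (fst ` d0_graph \<Omega> (k + 1))
      (cls \<Omega> ` L2 \<Omega> (k - 1)) (cls \<Omega> ` L2 \<Omega> k) (cls \<Omega> ` L2 \<Omega> (k + 1))
      (cls \<Omega> ` test_forms \<Omega> (k - 1)) (cls \<Omega> ` test_forms \<Omega> k) (cls \<Omega> ` test_forms \<Omega> (k + 1))
      (\<lambda>t. cls \<Omega> (\<sigma> t)) (\<lambda>t. cls \<Omega> (\<mu> t)) (\<lambda>t. cls \<Omega> (\<omega> t))
      (\<lambda>t. cls \<Omega> (ext_d \<Omega> (k - 1) (\<sigma> t))) (\<lambda>t. cls \<Omega> (ext_d \<Omega> k (\<mu> t)))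
      (\<lambda>t. cls \<Omega> (codiff \<Omega> k (\<mu> t))) (\<lambda>t. cls \<Omega> (codiff \<Omega> (k + 1) (\<omega> t)))"

text \<open>\<open>F\<close> represents f(t) as a functional on k-forms. Kept apart from
  \<open>f\<close>, it can be the constant 0 when f vanishes almost everywhere, which proves
  conservation with no time derivative of f at hand.\<close>

lemma hodge_wave_mixed_wave:
  fixes \<Omega> :: "(real^'n::{finite,linorder}) set"
  assumes \<Omega>: "open \<Omega>" "bounded \<Omega>" and T: "T > 0"
    and sol: "hodge_wave_solution \<Omega> k T f u0 u1 \<sigma> \<mu> \<omega>"
    and F: "AE t in time T. \<forall>v\<in>L2 \<Omega> k. ip \<Omega> (f t) v = F t \<bullet> cls \<Omega> v"
  shows "\<exists>s' m' w' N. hodge_mixed_wave \<Omega> k T \<sigma> \<mu> \<omega> s' m' w' F N"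
proof -
  have dom: "\<sigma> t \<in> H0 \<Omega> (k - 1)" "\<mu> t \<in> H0 \<Omega> k" "\<mu> t \<in> Hstar \<Omega> k" "\<omega> t \<in> H0 \<Omega> (k + 1)" "\<omega> t \<in> Hstar \<Omega> (k + 1)"
    if "t \<in> {0..T}" for t
    using sol that by (auto simp: hodge_wave_solution_def)
  have ct: "continuous_time \<Omega> T \<sigma>" "continuous_time \<Omega> T \<mu>" "continuous_time \<Omega> T \<omega>"
    using sol by (auto simp: hodge_wave_solution_def)
  obtain s' m' w' where w: "W11_time \<Omega> (k - 1) T \<sigma> s'" "W11_time \<Omega> k T \<mu> m'" "W11_time \<Omega> (k + 1) T \<omega> w'"
    and eqs: "AE t in time T.
           (\<forall>\<tau>\<in>H0 \<Omega> (k - 1). ip \<Omega> (s' t) \<tau> - ip \<Omega> (ext_d \<Omega> (k - 1) \<tau>) (\<mu> t) = 0) \<and>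
           (\<forall>v\<in>H0 \<Omega> k. ip \<Omega> (m' t) v + ip \<Omega> (ext_d \<Omega> (k - 1) (\<sigma> t)) v
                          + ip \<Omega> (\<omega> t) (ext_d \<Omega> k v) = ip \<Omega> (f t) v) \<and>
           (\<forall>\<phi>\<in>H0 \<Omega> (k + 1). ip \<Omega> (w' t) \<phi> - ip \<Omega> (ext_d \<Omega> k (\<mu> t)) \<phi> = 0)"
    using sol unfolding hodge_wave_solution_def by blast
  have "AE t in time T. s' t \<in> L2 \<Omega> (k - 1)" "AE t in time T. m' t \<in> L2 \<Omega> k" "AE t in time T. w' t \<in> L2 \<Omega> (k + 1)"
    using w by (auto simp: W11_time_def L1_time_def)
  with eqs F have "AE t in time T.
      ((\<forall>\<tau>\<in>H0 \<Omega> (k - 1). ip \<Omega> (s' t) \<tau> - ip \<Omega> (ext_d \<Omega> (k - 1) \<tau>) (\<mu> t) = 0) \<and>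
           (\<forall>v\<in>H0 \<Omega> k. ip \<Omega> (m' t) v + ip \<Omega> (ext_d \<Omega> (k - 1) (\<sigma> t)) v
                          + ip \<Omega> (\<omega> t) (ext_d \<Omega> k v) = ip \<Omega> (f t) v) \<and>
           (\<forall>\<phi>\<in>H0 \<Omega> (k + 1). ip \<Omega> (w' t) \<phi> - ip \<Omega> (ext_d \<Omega> k (\<mu> t)) \<phi> = 0)) \<and>
      (\<forall>v\<in>L2 \<Omega> k. ip \<Omega> (f t) v = F t \<bullet> cls \<Omega> v) \<and>
      s' t \<in> L2 \<Omega> (k - 1) \<and> m' t \<in> L2 \<Omega> k \<and> w' t \<in> L2 \<Omega> (k + 1)"
    by eventually_elim blast
  then obtain N where N: "negligible N"
    and eq: "\<And>t. t \<in> {0..T} - N \<Longrightarrow>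
      ((\<forall>\<tau>\<in>H0 \<Omega> (k - 1). ip \<Omega> (s' t) \<tau> - ip \<Omega> (ext_d \<Omega> (k - 1) \<tau>) (\<mu> t) = 0) \<and>
           (\<forall>v\<in>H0 \<Omega> k. ip \<Omega> (m' t) v + ip \<Omega> (ext_d \<Omega> (k - 1) (\<sigma> t)) v
                          + ip \<Omega> (\<omega> t) (ext_d \<Omega> k v) = ip \<Omega> (f t) v) \<and>
           (\<forall>\<phi>\<in>H0 \<Omega> (k + 1). ip \<Omega> (w' t) \<phi> - ip \<Omega> (ext_d \<Omega> k (\<mu> t)) \<phi> = 0)) \<and>
      (\<forall>v\<in>L2 \<Omega> k. ip \<Omega> (f t) v = F t \<bullet> cls \<Omega> v) \<and>
      s' t \<in> L2 \<Omega> (k - 1) \<and> m' t \<in> L2 \<Omega> k \<and> w' t \<in> L2 \<Omega> (k + 1)"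
    unfolding time_AE by blast
  have dL: "ext_d \<Omega> (k - 1) \<tau> \<in> L2 \<Omega> k" if "\<tau> \<in> H0 \<Omega> (k - 1)" for \<tau>
    using H0_d0_graph(3)[OF \<Omega>(1) that] by simp
  have sub: "test_forms \<Omega> j \<subseteq> test_forms UNIV j" for j :: int using test_forms_mono[OF subset_UNIV] by blast
  have "hodge_mixed_wave \<Omega> k T \<sigma> \<mu> \<omega>
    (\<lambda>t. cls \<Omega> (s' t)) (\<lambda>t. cls \<Omega> (m' t)) (\<lambda>t. cls \<Omega> (w' t)) F N"
  proof (unfold_locales, goal_cases)
    case 1 show ?case by (rule T)
  next
    case 2 show ?case by (rule subspace_d0_graph[OF \<Omega>(1)])
  next
    case 3 show ?case by (rule subspace_d0_graph[OF \<Omega>(1)])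
  next
    case 4 show ?case by (rule linear_subspace_image[OF linear_fst subspace_d0_graph[OF \<Omega>(1)]])
  next
    case 5 show ?case by (rule subspace_cls_L2[OF \<Omega>(1)])
  next
    case (6 x y) then show ?case by (simp add: d0_graph_iff[OF \<Omega>(1)])
  next
    case (7 x y) then show ?case by (simp add: d0_graph_iff[OF \<Omega>(1)])
  next
    case (8 x y) then show ?case using d0_graph_complex[OF \<Omega>(1), of x y "k - 1"] by simp
  next
    case 9 show ?case using test_d0_graph[OF \<Omega>(1)] by force
  next
    case 10 show ?case by (rule test_forms_dense[OF \<Omega>])
  next
    case 11 show ?case by (rule test_forms_dense[OF \<Omega>])
  next
    case 12 show ?case by (rule test_forms_dense[OF \<Omega>])
  next
    case (13 c)
    then obtain \<phi> where \<phi>: "\<phi> \<in> test_forms \<Omega> (k - 1)" "c = cls \<Omega> \<phi>" by blast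
    show ?case unfolding \<phi>(2)
      by (intro exI[of _ "cls \<Omega> (smooth_d \<phi>)"] conjI ballI test_d0_graph[OF \<Omega>(1) \<phi>(1)] Hstar_codiff(3)[OF \<Omega>(1) dom(3) \<phi>(1)])
  next
    case (14 c)
    then obtain \<phi> where \<phi>: "\<phi> \<in> test_forms \<Omega> k" "c = cls \<Omega> \<phi>" by blast
    then have \<phi>': "\<phi> \<in> test_forms \<Omega> (k + 1 - 1)" by simp
    show ?case unfolding \<phi>(2)
      by (intro exI[of _ "cls \<Omega> (smooth_d \<phi>)"] conjI ballI test_d0_graph[OF \<Omega>(1) \<phi>(1)] Hstar_codiff(3)[OF \<Omega>(1) dom(5) \<phi>'])
  next
    case (15 c)
    then obtain \<phi> where \<phi>: "\<phi> \<in> test_forms \<Omega> k" "c = cls \<Omega> \<phi>" by blast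
    then have "\<phi> \<in> test_forms UNIV (k - 1 + 1)" using sub by auto
    then show ?case unfolding \<phi>(2)
      by (intro exI[of _ "cls \<Omega> (smooth_\<delta> \<phi>)"] allI impI) (simp add: d0_graph_iff[OF \<Omega>(1)])
  next
    case (16 c)
    then obtain \<phi> where \<phi>: "\<phi> \<in> test_forms \<Omega> (k + 1)" "c = cls \<Omega> \<phi>" by blast
    then have "\<phi> \<in> test_forms UNIV (k + 1)" using sub by auto
    then show ?case unfolding \<phi>(2)
      by (intro exI[of _ "cls \<Omega> (smooth_\<delta> \<phi>)"] allI impI) (simp add: d0_graph_iff[OF \<Omega>(1)])
  next
    case (17 t) show ?case by (rule H0_d0_graph(1)[OF \<Omega>(1) dom(1)[OF 17]])
  next
    case (18 t) show ?case by (rule H0_d0_graph(1)[OF \<Omega>(1) dom(2)[OF 18]])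
  next
    case (19 t) show ?case using H0_d0_graph(1)[OF \<Omega>(1) dom(4)[OF 19]] by force
  next
    case (20 t) show ?case using dL[OF dom(1)[OF 20]] by blast
  next
    case (21 t) show ?case using H0_d0_graph(3)[OF \<Omega>(1) dom(2)[OF 21]] by blast
  next
    case (22 t) show ?case using Hstar_codiff(2)[OF \<Omega>(1) dom(3)[OF 22]] by blast
  next
    case (23 t) show ?case using Hstar_codiff(2)[OF \<Omega>(1) dom(5)[OF 23]] by simp
  next
    case 24 show ?case by (rule W11_time_weak_deriv[OF \<Omega>(1) w(1) T ct(1) H0_d0_graph(2)[OF \<Omega>(1) dom(1)]])
  next
    case 25 show ?case by (rule W11_time_weak_deriv[OF \<Omega>(1) w(2) T ct(2) H0_d0_graph(2)[OF \<Omega>(1) dom(2)]])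
  next
    case 26 show ?case by (rule W11_time_weak_deriv[OF \<Omega>(1) w(3) T ct(3) H0_d0_graph(2)[OF \<Omega>(1) dom(4)]])
  next
    case 27 show ?case by (rule N)
  next
    case (28 t x y)
    \<comment> \<open>Every pair of the graph has a representative in \<open>H0\<close>, to which
      the given equation applies; the next two equations are treated alike.\<close>
    then obtain \<tau> where \<tau>: "\<tau> \<in> H0 \<Omega> (k - 1)" "x = cls \<Omega> \<tau>" "y = cls \<Omega> (ext_d \<Omega> (k - 1) \<tau>)"
      using d0_graph_H0[OF \<Omega>] by blast
    have t: "t \<in> {0..T}" using 28 by auto
    have "ip \<Omega> (s' t) \<tau> = ip \<Omega> (ext_d \<Omega> (k - 1) \<tau>) (\<mu> t)" "s' t \<in> L2 \<Omega> (k - 1)"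
      using eq[OF 28(1)] \<tau>(1) by auto
    then show ?case unfolding \<tau>(2,3)
      using inner_cls[OF \<Omega>(1), of "s' t" "k - 1" \<tau> "k - 1"] H0_d0_graph(2)[OF \<Omega>(1) \<tau>(1)]
        inner_cls[OF \<Omega>(1) dL[OF \<tau>(1)] H0_d0_graph(2)[OF \<Omega>(1) dom(2)[OF t]]] by simp
  next
    case (29 t x y)
    then obtain v where v: "v \<in> H0 \<Omega> k" "x = cls \<Omega> v" "y = cls \<Omega> (ext_d \<Omega> k v)"
      using d0_graph_H0[OF \<Omega>] by blast
    have t: "t \<in> {0..T}" using 29 by auto
    note vL = H0_d0_graph(2,3)[OF \<Omega>(1) v(1)]
    have "ip \<Omega> (m' t) v + ip \<Omega> (ext_d \<Omega> (k - 1) (\<sigma> t)) v + ip \<Omega> (\<omega> t) (ext_d \<Omega> k v) = F t \<bullet> cls \<Omega> v"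
      and m'L: "m' t \<in> L2 \<Omega> k"
      using eq[OF 29(1)] v(1) vL(1) by auto
    then show ?case unfolding v(2,3)
      using inner_cls[OF \<Omega>(1) m'L vL(1)] inner_cls[OF \<Omega>(1) dL[OF dom(1)[OF t]] vL(1)]
        inner_cls[OF \<Omega>(1) H0_d0_graph(2)[OF \<Omega>(1) dom(4)[OF t]] vL(2)] by simp
  next
    case (30 t x)
    then obtain y where "(x, y) \<in> d0_graph \<Omega> (k + 1)" by auto
    then obtain \<phi> where \<phi>: "\<phi> \<in> H0 \<Omega> (k + 1)" "x = cls \<Omega> \<phi>"
      using d0_graph_H0[OF \<Omega>] by blast
    have t: "t \<in> {0..T}" using 30 by auto
    note \<phi>L = H0_d0_graph(2)[OF \<Omega>(1) \<phi>(1)]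
    have "ip \<Omega> (w' t) \<phi> = ip \<Omega> (ext_d \<Omega> k (\<mu> t)) \<phi>" "w' t \<in> L2 \<Omega> (k + 1)"
      using eq[OF 30(1)] \<phi>(1) by auto
    then show ?case unfolding \<phi>(2)
      using inner_cls[OF \<Omega>(1) _ \<phi>L, of "w' t" "k + 1"] inner_cls[OF \<Omega>(1) H0_d0_graph(3)[OF \<Omega>(1) dom(2)[OF t]] \<phi>L] by simp
  qed
  then show ?thesis by blast
qed

lemma hodge_wave_E_bound:
  fixes \<Omega> :: "(real^'n::{finite,linorder}) set"
  assumes \<Omega>: "open \<Omega>" "bounded \<Omega>" and T: "T > 0"
    and sol: "hodge_wave_solution \<Omega> k T f u0 u1 \<sigma> \<mu> \<omega>"
    and F: "AE t in time T. \<forall>v\<in>L2 \<Omega> k. ip \<Omega> (f t) v = F t \<bullet> cls \<Omega> v"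
    and c: "c integrable_on {0..T}" "\<And>r. r \<in> {0..T} \<Longrightarrow> 0 \<le> c r" "AE t in time T. norm (F t) \<le> c t"
    and ab: "a \<in> {0..T}" "b \<in> {0..T}"
  shows "energy_E \<Omega> \<sigma> \<mu> \<omega> b \<le> energy_E \<Omega> \<sigma> \<mu> \<omega> a + integral {0..T} c"
proof -
  obtain s' m' w' N where mw: "hodge_mixed_wave \<Omega> k T \<sigma> \<mu> \<omega> s' m' w' F N"
    using hodge_wave_mixed_wave[OF \<Omega> T sol F] by blast
  let ?U = "mixed_wave.U (\<lambda>t. cls \<Omega> (\<sigma> t)) (\<lambda>t. cls \<Omega> (\<mu> t)) (\<lambda>t. cls \<Omega> (\<omega> t))"
  have E: "energy_E \<Omega> \<sigma> \<mu> \<omega> t = norm (?U t)" if t: "t \<in> {0..T}" for t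
  proof -
    have "\<sigma> t \<in> H0 \<Omega> (k - 1)" "\<mu> t \<in> H0 \<Omega> k" "\<omega> t \<in> H0 \<Omega> (k + 1)"
      using sol t by (auto simp: hodge_wave_solution_def)
    then show ?thesis
      unfolding energy_E_def mixed_wave.norm_U[OF mw] by (simp add: norm_cls[OF \<Omega>(1) H0_d0_graph(2)[OF \<Omega>(1)]])
  qed
  obtain M where M: "negligible M" "\<And>t. t \<in> {0..T} - M \<Longrightarrow> norm (F t) \<le> c t"
    using c(3) unfolding time_AE by blast
  have "norm (?U b) \<le> norm (?U a) + integral {min a b..max a b} c"
    by (rule mixed_wave.energy_bound[OF mw c(1,2) M ab])
  also have "integral {min a b..max a b} c \<le> integral {0..T} c"
  proof (rule integral_subset_le)
    show sub: "{min a b..max a b} \<subseteq> {0..T}" using ab by auto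
    show "c integrable_on {min a b..max a b}" using c(1) sub by (rule integrable_on_subinterval)
  qed (use c in auto)
  finally show ?thesis using E ab by simp
qed

lemma hodge_wave_H_bound:
  fixes \<Omega> :: "(real^'n::{finite,linorder}) set"
  assumes \<Omega>: "open \<Omega>" "bounded \<Omega>" and T: "T > 0"
    and sol: "hodge_wave_solution \<Omega> k T f u0 u1 \<sigma> \<mu> \<omega>"
    and F: "AE t in time T. \<forall>v\<in>L2 \<Omega> k. ip \<Omega> (f t) v = F t \<bullet> cls \<Omega> v"
    and B: "0 \<le> B" "AE t in time T. norm (F t) \<le> B"
    and g: "g integrable_on {0..T}" "\<And>r. r \<in> {0..T} \<Longrightarrow> 0 \<le> g r" "AE t in time T. norm (F' t) \<le> g t"
    and F': "\<And>v. \<exists>c M. negligible M \<and> (\<forall>r\<in>{0..T} - M. ((\<lambda>x. F' x \<bullet> v) has_integral (F r \<bullet> v - c)) {0..r})"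
    and ab: "a \<in> {0..T}" "b \<in> {0..T}"
  shows "energy_H \<Omega> k \<sigma> \<mu> \<omega> b \<le> energy_H \<Omega> k \<sigma> \<mu> \<omega> a + 2 * B + integral {0..T} g"
proof -
  obtain s' m' w' N where mw: "hodge_mixed_wave \<Omega> k T \<sigma> \<mu> \<omega> s' m' w' F N"
    using hodge_wave_mixed_wave[OF \<Omega> T sol F] by blast
  let ?H = "mixed_wave.H (\<lambda>t. cls \<Omega> (ext_d \<Omega> (k - 1) (\<sigma> t))) (\<lambda>t. cls \<Omega> (ext_d \<Omega> k (\<mu> t)))
    (\<lambda>t. cls \<Omega> (codiff \<Omega> k (\<mu> t))) (\<lambda>t. cls \<Omega> (codiff \<Omega> (k + 1) (\<omega> t)))"
  have E: "energy_H \<Omega> k \<sigma> \<mu> \<omega> t = ?H t" if t: "t \<in> {0..T}" for t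
  proof -
    have "\<sigma> t \<in> H0 \<Omega> (k - 1)" "\<mu> t \<in> H0 \<Omega> k" "\<mu> t \<in> Hstar \<Omega> k" "\<omega> t \<in> Hstar \<Omega> (k + 1)"
      using sol t by (auto simp: hodge_wave_solution_def)
    then show ?thesis
      unfolding energy_H_def mixed_wave.H_def[OF mw]
      by (simp add: norm_cls[OF \<Omega>(1) H0_d0_graph(3)[OF \<Omega>(1)]] norm_cls[OF \<Omega>(1) Hstar_codiff(2)[OF \<Omega>(1)]])
  qed
  obtain M1 where M1: "negligible M1" "\<And>t. t \<in> {0..T} - M1 \<Longrightarrow> norm (F t) \<le> B"
    using B(2) unfolding time_AE by blast
  obtain M2 where M2: "negligible M2" "\<And>t. t \<in> {0..T} - M2 \<Longrightarrow> norm (F' t) \<le> g t"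
    using g(3) unfolding time_AE by blast
  have "?H b \<le> ?H a + 2 * B + integral {0..T} g"
    by (rule mixed_wave_W11.H_bound[OF mixed_wave_W11.intro[OF mw mixed_wave_W11_axioms.intro] ab, of _ "M1 \<union> M2" F'])
      (use B g F' M1 M2 in \<open>auto intro: negligible_Un\<close>)
  then show ?thesis using E ab by simp
qed

section \<open>Stability estimates and conservation of energy\<close>

theorem theorem2p2:
  fixes \<Omega> :: "(real^'n::{finite,linorder}) set" and T :: real and k :: int
    and f \<sigma> \<mu> \<omega> :: "real \<Rightarrow> 'n form" and u\<^sub>0 u\<^sub>1 :: "'n form"
  defines "E \<equiv> energy_E \<Omega> \<sigma> \<mu> \<omega>"
    and "H \<equiv> energy_H \<Omega> k \<sigma> \<mu> \<omega>"
  assumes "CARD('n) \<ge> 2"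
    and "ball_like_domain \<Omega>"
    and "T > 0"
    and "0 \<le> k" and "k \<le> int CARD('n)"
    and "\<And>j \<eta>. 1 \<le> j \<Longrightarrow> j \<le> int CARD('n) - 1 \<Longrightarrow> \<eta> \<in> harmonic \<Omega> j \<Longrightarrow> eq_L2 \<Omega> \<eta> (\<lambda>_. 0)"
    and "u\<^sub>0 \<in> Hd \<Omega> k \<inter> Hstar \<Omega> k" and "u\<^sub>1 \<in> L2 \<Omega> k"
    and "hodge_wave_solution \<Omega> k T f u\<^sub>0 u\<^sub>1 \<sigma> \<mu> \<omega>"
  shows
    "(f \<in> L1_time \<Omega> k T \<longrightarrow>
        (SUP t\<in>{0..T}. ereal (E t)) \<le> ereal (E 0 + 2 * (\<integral>s. L2norm \<Omega> (f s) \<partial>time T))) \<and>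
     (\<forall>f\<^sub>t. W11_time \<Omega> k T f f\<^sub>t \<longrightarrow>
        (SUP t\<in>{0..T}. ereal (H t))
          \<le> ereal (H 0) + 4 * esssup (time T) (\<lambda>t. ereal (L2norm \<Omega> (f t)))
            + ereal (2 * (\<integral>s. L2norm \<Omega> (f\<^sub>t s) \<partial>time T))) \<and>
     ((AE t in time T. eq_L2 \<Omega> (f t) (\<lambda>_. 0)) \<longrightarrow>
        (SUP t\<in>{0..T}. ereal (E t)) = ereal (E 0 + 2 * (\<integral>s. L2norm \<Omega> (f s) \<partial>time T)) \<and>
        (\<forall>f\<^sub>t. W11_time \<Omega> k T f f\<^sub>t \<longrightarrow>
           (SUP t\<in>{0..T}. ereal (H t))
             = ereal (H 0) + 4 * esssup (time T) (\<lambda>t. ereal (L2norm \<Omega> (f t)))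
               + ereal (2 * (\<integral>s. L2norm \<Omega> (f\<^sub>t s) \<partial>time T))) \<and>
        (\<forall>t\<in>{0<..T}. E t = E 0 \<and> H t = H 0))"
proof -
  have \<Omega>: "open \<Omega>" "bounded \<Omega>" using assms(4) by (auto simp: ball_like_domain_def)
  note T = \<open>T > 0\<close> and sol = \<open>hodge_wave_solution \<Omega> k T f u\<^sub>0 u\<^sub>1 \<sigma> \<mu> \<omega>\<close>
  have T0: "0 \<in> {0..T}" using T by simp
  have repr: "AE t in time T. \<forall>v\<in>L2 \<Omega> k. ip \<Omega> (f t) v = cls \<Omega> (f t) \<bullet> cls \<Omega> v"
    and nrm: "AE t in time T. norm (cls \<Omega> (f t)) = L2norm \<Omega> (f t)" if f: "f \<in> L1_time \<Omega> k T"
    using f by (auto simp: L1_time_def inner_cls[OF \<Omega>(1)] norm_cls[OF \<Omega>(1)] elim!: eventually_mono)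
  have part1: "(SUP t\<in>{0..T}. ereal (E t)) \<le> ereal (E 0 + 2 * (\<integral>s. L2norm \<Omega> (f s) \<partial>time T))"
    if f: "f \<in> L1_time \<Omega> k T"
  proof (rule SUP_least)
    fix t assume t: "t \<in> {0..T}"
    have i: "(\<lambda>t. L2norm \<Omega> (f t)) integrable_on {0..T}"
      and eq: "(\<integral>s. L2norm \<Omega> (f s) \<partial>time T) = integral {0..T} (\<lambda>s. L2norm \<Omega> (f s))"
      using f time_integral(2,3) by (auto simp: L1_time_def)
    have "E t \<le> E 0 + integral {0..T} (\<lambda>s. L2norm \<Omega> (f s))"
      unfolding E_def
      by (rule hodge_wave_E_bound[OF \<Omega> T sol repr[OF f] i L2norm_nonneg _ T0 t])
        (use nrm[OF f] in \<open>auto elim!: eventually_mono\<close>)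
    \<comment> \<open>The estimate holds with the integral taken once; its nonnegativity accounts
      for the factor 2.\<close>
    moreover have "0 \<le> integral {0..T} (\<lambda>s. L2norm \<Omega> (f s))"
      using i by (intro integral_nonneg L2norm_nonneg)
    ultimately show "ereal (E t) \<le> ereal (E 0 + 2 * (\<integral>s. L2norm \<Omega> (f s) \<partial>time T))"
      by (simp add: eq)
  qed
  have part2: "(SUP t\<in>{0..T}. ereal (H t))
          \<le> ereal (H 0) + 4 * esssup (time T) (\<lambda>t. ereal (L2norm \<Omega> (f t)))
            + ereal (2 * (\<integral>s. L2norm \<Omega> (f\<^sub>t s) \<partial>time T))"
    if w: "W11_time \<Omega> k T f f\<^sub>t" for f\<^sub>t
  proof (rule SUP_least)
    fix t assume t: "t \<in> {0..T}"
    have f: "f \<in> L1_time \<Omega> k T" and ft: "f\<^sub>t \<in> L1_time \<Omega> k T" using w by (auto simp: W11_time_def)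
    define e where "e = esssup (time T) (\<lambda>t. ereal (L2norm \<Omega> (f t)))"
    have ae: "AE t in time T. ereal (L2norm \<Omega> (f t)) \<le> e" unfolding e_def by (rule esssup_AE)
    \<comment> \<open>As (0, T) has positive measure, the bound by \<open>e\<close> holds at some
      time, so \<open>e\<close> is not negative and is either real or infinite.\<close>
    obtain t1 where "ereal (L2norm \<Omega> (f t1)) \<le> e" using time_AE_point[OF T ae] by blast
    then have "0 \<le> e" using L2norm_nonneg[of \<Omega> "f t1"] by (metis ereal_less_eq(5) order_trans)
    show "ereal (H t) \<le> ereal (H 0) + 4 * e + ereal (2 * (\<integral>s. L2norm \<Omega> (f\<^sub>t s) \<partial>time T))"
    proof (cases "e = \<infinity>")
      case True
      then show ?thesis by simp
    next
      case False
      then obtain B where B: "e = ereal B" using \<open>0 \<le> e\<close> by (cases e) auto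
      have "0 \<le> B" using \<open>0 \<le> e\<close> B by simp
      have i: "(\<lambda>t. L2norm \<Omega> (f\<^sub>t t)) integrable_on {0..T}"
        and eq: "(\<integral>s. L2norm \<Omega> (f\<^sub>t s) \<partial>time T) = integral {0..T} (\<lambda>s. L2norm \<Omega> (f\<^sub>t s))"
        using ft time_integral(2,3) by (auto simp: L1_time_def)
      have fB: "AE t in time T. norm (cls \<Omega> (f t)) \<le> B"
        using ae nrm[OF f] by eventually_elim (simp add: B)
      have ftn: "AE t in time T. norm (cls \<Omega> (f\<^sub>t t)) \<le> L2norm \<Omega> (f\<^sub>t t)"
        using ft by (auto simp: L1_time_def norm_cls[OF \<Omega>(1)] elim!: eventually_mono)
      have "H t \<le> H 0 + 2 * B + integral {0..T} (\<lambda>s. L2norm \<Omega> (f\<^sub>t s))"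
        unfolding H_def
        by (rule hodge_wave_H_bound[OF \<Omega> T sol repr[OF f] \<open>0 \<le> B\<close> fB i L2norm_nonneg ftn W11_time_weak[OF \<Omega>(1) w T] T0 t])
      moreover have "0 \<le> integral {0..T} (\<lambda>s. L2norm \<Omega> (f\<^sub>t s))"
        using i by (intro integral_nonneg L2norm_nonneg)
      ultimately show ?thesis using \<open>0 \<le> B\<close> by (simp add: eq B)
    qed
  qed
  have part3: "(SUP t\<in>{0..T}. ereal (E t)) = ereal (E 0 + 2 * (\<integral>s. L2norm \<Omega> (f s) \<partial>time T)) \<and>
        (\<forall>f\<^sub>t. W11_time \<Omega> k T f f\<^sub>t \<longrightarrow>
           (SUP t\<in>{0..T}. ereal (H t))
             = ereal (H 0) + 4 * esssup (time T) (\<lambda>t. ereal (L2norm \<Omega> (f t)))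
               + ereal (2 * (\<integral>s. L2norm \<Omega> (f\<^sub>t s) \<partial>time T))) \<and>
        (\<forall>t\<in>{0<..T}. E t = E 0 \<and> H t = H 0)"
    if 0: "AE t in time T. eq_L2 \<Omega> (f t) (\<lambda>_. 0)"
  proof -
    have repr0: "AE t in time T. \<forall>v\<in>L2 \<Omega> k. ip \<Omega> (f t) v = 0 \<bullet> cls \<Omega> v"
      using 0 by (auto elim!: eventually_mono simp: eq_L2_zero)
    \<comment> \<open>The bound is symmetric in the two times; with zero source it gives both
      inequalities. The same holds for H below.\<close>
    have E_le: "E b \<le> E a" if "a \<in> {0..T}" "b \<in> {0..T}" for a b
      using hodge_wave_E_bound[OF \<Omega> T sol repr0, of "\<lambda>_. 0" a b] that by (simp add: E_def integrable_0)
    have Ec: "E t = E 0" if "t \<in> {0..T}" for t by (rule antisym[OF E_le[OF T0 that] E_le[OF that T0]])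
    have "\<exists>c M. negligible M \<and> (\<forall>r\<in>{0..T} - M. ((\<lambda>x. 0 \<bullet> v) has_integral (0 \<bullet> v - c)) {0..r})"
      for v :: "(real^'n::{finite,linorder}, real^('n::{finite,linorder} set)) l2"
      by (intro exI[of _ 0] exI[of _ "{}"]) simp
    then have H_le: "H b \<le> H a" if "a \<in> {0..T}" "b \<in> {0..T}" for a b
      using hodge_wave_H_bound[OF \<Omega> T sol repr0, of 0 "\<lambda>_. 0" "\<lambda>_. 0" a b] that by (simp add: H_def integrable_0)
    have Hc: "H t = H 0" if "t \<in> {0..T}" for t by (rule antisym[OF H_le[OF T0 that] H_le[OF that T0]])
    have zero_int: "(\<integral>s. L2norm \<Omega> (f s) \<partial>time T) = 0"
      by (rule integral_eq_zero_AE) (use 0 in \<open>auto elim!: eventually_mono simp: eq_L2_zero\<close>)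
    have SE: "(SUP t\<in>{0..T}. ereal (E t)) = ereal (E 0)"
    proof (rule SUP_eq_const)
      show "ereal (E t) = ereal (E 0)" if "t \<in> {0..T}" for t by (simp only: Ec[OF that])
    qed (use T in simp)
    have SH: "(SUP t\<in>{0..T}. ereal (H t)) = ereal (H 0)"
    proof (rule SUP_eq_const)
      show "ereal (H t) = ereal (H 0)" if "t \<in> {0..T}" for t by (simp only: Hc[OF that])
    qed (use T in simp)
    have "(SUP t\<in>{0..T}. ereal (H t))
             = ereal (H 0) + 4 * esssup (time T) (\<lambda>t. ereal (L2norm \<Omega> (f t)))
               + ereal (2 * (\<integral>s. L2norm \<Omega> (f\<^sub>t s) \<partial>time T))" if w: "W11_time \<Omega> k T f f\<^sub>t" for f\<^sub>t
    proof -
      have "(\<lambda>t. L2norm \<Omega> (f t)) \<in> borel_measurable (time T)"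
        using w by (auto simp: W11_time_def L1_time_def)
      then have "(\<lambda>t. ereal (L2norm \<Omega> (f t))) \<in> borel_measurable (time T)" by measurable
      then have "esssup (time T) (\<lambda>t. ereal (L2norm \<Omega> (f t))) = esssup (time T) (\<lambda>t. 0)"
        by (rule esssup_AE_cong) (use 0 in \<open>auto elim!: eventually_mono simp: eq_L2_zero\<close>)
      \<comment> \<open>The essential supremum of a constant is that constant because (0, T) has
        positive measure.\<close>
      also have "\<dots> = 0"
        by (rule esssup_const) (use T in \<open>simp add: emeasure_restrict_space\<close>)
      finally have "esssup (time T) (\<lambda>t. ereal (L2norm \<Omega> (f t))) = 0" .
      moreover have "(\<integral>s. L2norm \<Omega> (f\<^sub>t s) \<partial>time T) = 0"
        by (rule integral_eq_zero_AE[OF W11_time_deriv_zero[OF \<Omega>(1) w 0]])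
      ultimately show ?thesis by (simp add: SH)
    qed
    moreover have "E t = E 0 \<and> H t = H 0" if "t \<in> {0<..T}" for t
    proof -
      from that have "t \<in> {0..T}" by simp
      from Ec[OF this] Hc[OF this] show ?thesis ..
    qed
    ultimately show ?thesis by (simp add: SE zero_int)
  qed
  show ?thesis using part1 part2 part3 by blast
qed

end
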